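(* Let $\mathcal{G}=(X,Y,A,B,\lambda)$ be an imitation game. The following assertions are equivalent: (i) $\mathcal{G}$ has a perfect spatial quantum strategy (i.e. a perfect strategy in $\mathcal{C}_{\rm qs}$); (ii) $\mathcal{G}$ has a perfect quantum strategy (i.e. a perfect strategy in $\mathcal{C}_{\rm q}$); (iii) $\mathcal{G}$ has a perfect quantum strategy using a maximally entangled vector; (iv) the C*-algebra of the game $C^*(\mathcal{G})$ is nonzero, and it has a nondegenerate finite-dimensional representation (on a nonzero Hilbert space).
   Context: $X,Y,A,B$ are finite non-empty sets. A non-signalling game is a tuple $\mathcal{G}=(X,Y,A,B,\lambda)$ with $\lambda:X\times Y\times A\times B\to\{0,1\}$. It is an imitation game if: (1) for every $x\in X$ and $a,a'\in A$ with $a\ne a'$ there is $y\in Y$ with $\sum_{b\in B}\lambda(x,y,a,b)\lambda(x,y,a',b)=0$; and (2) for every $y\in Y$ and $b,b'\in B$ with $b\neq b'$ there is $x\in X$ with $\sum_{a\in A}\lambda(x,y,a,b)\lambda(x,y,a,b')=0$. The game C*-algebra $C^*(\mathcal{G})$ is the universal unital C*-algebra generated by projections $(p_{x,a})_{x\in X,a\in A}$ and $(q_{y,b})_{y\in Y,b\in B}$ satisfying $\sum_{a}p_{x,a}=1$ for every $x$, $\sum_{b}q_{y,b}=1$ for every $y$, and $p_{x,a}q_{y,b}=0$ whenever $\lambda(x,y,a,b)=0$. The zero C*-algebra is regarded as a unital C*-algebra, so $C^*(\mathcal{G})=\{0\}$ is possible. A PVM is a finite tuple of projections on a Hilbert space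 summing to the identity. $\mathcal{C}_{\rm qs}$ is the set of families $p(a,b|x,y)=\langle\xi|P_{x,a}\otimes Q_{y,b}|\xi\rangle$ with $\mathcal{H}$ a Hilbert space, $\xi\in\mathcal{H}\otimes\mathcal{H}$ a unit vector, and $(P_{x,a})_{a\in A}$, $(Q_{y,b})_{b\in B}$ PVMs on $\mathcal{H}$ for all $x,y$; $\mathcal{C}_{\rm q}$ is the set of those with $\mathcal{H}$ finite-dimensional; a quantum strategy uses a maximally entangled vector if it is of this form with $\mathcal{H}$ finite-dimensional with fixed orthonormal basis $|1\rangle,\dots,|d\rangle$ and $\xi=d^{-1/2}\sum_{i=1}^d|i\rangle\otimes|i\rangle$. A family $p$ is a perfect strategy for $\mathcal{G}$ if $\lambda(x,y,a,b)=0$ implies $p(a,b|x,y)=0$. *)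

theory Defs
  imports "HOL-Analysis.Analysis" "HOL-Library.Poly_Mapping" "HOL-Algebra.Module"
begin

section \<open>Complex Hilbert spaces\<close>

text \<open>The inner product \<open>cinner\<close> is conjugate-linear in the first argument. The norm is the one
  of the underlying real inner product \<open>Re (cinner x y)\<close>.\<close>

class complex_hilbert_space = real_inner + complete_space +
  fixes scaleC :: "complex \<Rightarrow> 'a \<Rightarrow> 'a" (infixr "*\<^sub>C" 75)
    and cinner :: "'a \<Rightarrow> 'a \<Rightarrow> complex"
  assumes scaleC_add_right: "c *\<^sub>C (x + y) = c *\<^sub>C x + c *\<^sub>C y"
    and scaleC_add_left: "(c + d) *\<^sub>C x = c *\<^sub>C x + d *\<^sub>C x"
    and scaleC_scaleC: "c *\<^sub>C d *\<^sub>C x = (c * d) *\<^sub>C x"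
    and scaleC_of_real: "complex_of_real r *\<^sub>C x = r *\<^sub>R x"
    and cinner_add_right: "cinner x (y + z) = cinner x y + cinner x z"
    and cinner_scaleC_right: "cinner x (c *\<^sub>C y) = c * cinner x y"
    and cinner_commute: "cinner x y = cnj (cinner y x)"
    and Re_cinner: "Re (cinner x y) = inner x y"

lemma scaleC_one: "1 *\<^sub>C x = (x :: 'a::complex_hilbert_space)"
  using scaleC_of_real[of 1 x] by simp

global_interpretation complex_vector: vector_space "scaleC :: complex \<Rightarrow> 'a \<Rightarrow> 'a::complex_hilbert_space"
  defines csubspace_raw_def: csubspace = complex_vector.subspace
    and cspan_raw_def: cspan = complex_vector.span
  by unfold_locales (simp_all add: scaleC_add_right scaleC_add_left scaleC_scaleC scaleC_one)

text \<open>Hilbert spaces are presented as closed complex subspaces of an ambient Hilbert space \<open>'h\<close>.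
  If \<open>'h\<close> ranges over all infinite-dimensional Hilbert spaces, every Hilbert space occurs among
  these subspaces, up to unitary equivalence. Below, \<open>H\<close> and a realization of its tensor square are
  both taken inside \<open>'h\<close>; for infinite-dimensional \<open>'h\<close> this excludes no \<open>H\<close>, because the Hilbert
  space dimension of \<open>'h \<otimes> 'h\<close> is that of \<open>'h\<close>.\<close>

definition hilbert_subspace :: "'h::complex_hilbert_space set \<Rightarrow> bool" where
  "hilbert_subspace H \<longleftrightarrow> csubspace H \<and> closed H"

definition finite_dimensional :: "'h::complex_hilbert_space set \<Rightarrow> bool" where
  "finite_dimensional H \<longleftrightarrow> (\<exists>B. finite B \<and> H = cspan B)"

definition infinite_dimensional_type :: "'h::complex_hilbert_space itself \<Rightarrow> bool" where
  "infinite_dimensional_type _ \<longleftrightarrow> \<not> finite_dimensional (UNIV :: 'h set)"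

text \<open>Operators on \<open>H\<close> are functions on \<open>'h\<close> of which only the values on \<open>H\<close> matter.\<close>

definition bounded_operator_on :: "'h::complex_hilbert_space set \<Rightarrow> ('h \<Rightarrow> 'h) \<Rightarrow> bool" where
  "bounded_operator_on H F \<longleftrightarrow>
     (\<forall>u\<in>H. F u \<in> H) \<and>
     (\<forall>u\<in>H. \<forall>v\<in>H. F (u + v) = F u + F v) \<and>
     (\<forall>c. \<forall>u\<in>H. F (c *\<^sub>C u) = c *\<^sub>C F u) \<and>
     (\<exists>K. \<forall>u\<in>H. norm (F u) \<le> K * norm u)"

definition projection_on :: "'h::complex_hilbert_space set \<Rightarrow> ('h \<Rightarrow> 'h) \<Rightarrow> bool" where
  "projection_on H F \<longleftrightarrow> bounded_operator_on H F \<and>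
     (\<forall>u\<in>H. F (F u) = F u) \<and> (\<forall>u\<in>H. \<forall>v\<in>H. cinner (F u) v = cinner u (F v))"

definition pvm_on :: "'h::complex_hilbert_space set \<Rightarrow> ('i::finite \<Rightarrow> 'h \<Rightarrow> 'h) \<Rightarrow> bool" where
  "pvm_on H P \<longleftrightarrow> (\<forall>i. projection_on H (P i)) \<and> (\<forall>u\<in>H. (\<Sum>i\<in>UNIV. P i u) = u)"

text \<open>\<open>T\<close> with the bilinear map \<open>tns\<close> is a Hilbert space tensor product of \<open>H\<close> and \<open>K\<close>; this
  determines \<open>(T, tns)\<close> up to a unique unitary.\<close>

definition tensor_product ::
  "'h::complex_hilbert_space set \<Rightarrow> 'h set \<Rightarrow> 'h set \<Rightarrow> ('h \<Rightarrow> 'h \<Rightarrow> 'h) \<Rightarrow> bool" where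
  "tensor_product H K T tns \<longleftrightarrow>
     hilbert_subspace T \<and>
     (\<forall>u\<in>H. \<forall>u'\<in>H. \<forall>v\<in>K. tns (u + u') v = tns u v + tns u' v) \<and>
     (\<forall>u\<in>H. \<forall>v\<in>K. \<forall>v'\<in>K. tns u (v + v') = tns u v + tns u v') \<and>
     (\<forall>c. \<forall>u\<in>H. \<forall>v\<in>K. tns (c *\<^sub>C u) v = c *\<^sub>C tns u v \<and> tns u (c *\<^sub>C v) = c *\<^sub>C tns u v) \<and>
     (\<forall>u\<in>H. \<forall>u'\<in>H. \<forall>v\<in>K. \<forall>v'\<in>K. cinner (tns u v) (tns u' v') = cinner u u' * cinner v v') \<and>
     closure (cspan {tns u v | u v. u \<in> H \<and> v \<in> K}) = T"

text \<open>\<open>R\<close> is the operator \<open>F \<otimes> G\<close> on \<open>T\<close>. On \<open>T\<close> it is determined uniquely by this condition, and it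
  exists whenever \<open>F\<close> and \<open>G\<close> are bounded.\<close>

definition tensor_operator ::
  "'h::complex_hilbert_space set \<Rightarrow> 'h set \<Rightarrow> 'h set \<Rightarrow> ('h \<Rightarrow> 'h \<Rightarrow> 'h) \<Rightarrow>
     ('h \<Rightarrow> 'h) \<Rightarrow> ('h \<Rightarrow> 'h) \<Rightarrow> ('h \<Rightarrow> 'h) \<Rightarrow> bool" where
  "tensor_operator H K T tns F G R \<longleftrightarrow>
     bounded_operator_on T R \<and> (\<forall>u\<in>H. \<forall>v\<in>K. R (tns u v) = tns (F u) (G v))"

section \<open>Games and strategies\<close>

type_synonym ('x, 'y, 'a, 'b) game = "'x \<Rightarrow> 'y \<Rightarrow> 'a \<Rightarrow> 'b \<Rightarrow> bool"

definition imitation_game :: "('x::finite, 'y::finite, 'a::finite, 'b::finite) game \<Rightarrow> bool" where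
  "imitation_game lam \<longleftrightarrow>
     (\<forall>x a a'. a \<noteq> a' \<longrightarrow>
        (\<exists>y. (\<Sum>b\<in>UNIV. of_bool (lam x y a b) * of_bool (lam x y a' b)) = (0::nat))) \<and>
     (\<forall>y b b'. b \<noteq> b' \<longrightarrow>
        (\<exists>x. (\<Sum>a\<in>UNIV. of_bool (lam x y a b) * of_bool (lam x y a b')) = (0::nat)))"

text \<open>A family \<open>p\<close> is applied as \<open>p a b x y\<close>, standing for the conditional probability of the
  answers \<open>a, b\<close> given the questions \<open>x, y\<close>.\<close>

type_synonym ('x, 'y, 'a, 'b) correlation = "'a \<Rightarrow> 'b \<Rightarrow> 'x \<Rightarrow> 'y \<Rightarrow> real"

definition perfect_strategy ::
  "('x, 'y, 'a, 'b) game \<Rightarrow> ('x, 'y, 'a, 'b) correlation \<Rightarrow> bool" where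
  "perfect_strategy lam p \<longleftrightarrow> (\<forall>x y a b. \<not> lam x y a b \<longrightarrow> p a b x y = 0)"

definition realizes ::
  "'h::complex_hilbert_space set \<Rightarrow> 'h set \<Rightarrow> ('h \<Rightarrow> 'h \<Rightarrow> 'h) \<Rightarrow> 'h \<Rightarrow>
   ('x \<Rightarrow> 'a::finite \<Rightarrow> 'h \<Rightarrow> 'h) \<Rightarrow> ('y \<Rightarrow> 'b::finite \<Rightarrow> 'h \<Rightarrow> 'h) \<Rightarrow>
   ('x, 'y, 'a, 'b) correlation \<Rightarrow> bool" where
  "realizes H T tns \<xi> P Q p \<longleftrightarrow>
     hilbert_subspace H \<and> tensor_product H H T tns \<and> \<xi> \<in> T \<and> norm \<xi> = 1 \<and>
     (\<forall>x. pvm_on H (P x)) \<and> (\<forall>y. pvm_on H (Q y)) \<and>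
     (\<forall>a b x y. \<exists>R. tensor_operator H H T tns (P x a) (Q y b) R \<and>
        complex_of_real (p a b x y) = cinner \<xi> (R \<xi>))"

definition C_qs :: "'h::complex_hilbert_space itself \<Rightarrow>
    ('x::finite, 'y::finite, 'a::finite, 'b::finite) correlation set" where
  "C_qs _ = {p. \<exists>(H::'h set) T tns \<xi> P Q. realizes H T tns \<xi> P Q p}"

definition C_q :: "'h::complex_hilbert_space itself \<Rightarrow>
    ('x::finite, 'y::finite, 'a::finite, 'b::finite) correlation set" where
  "C_q _ = {p. \<exists>(H::'h set) T tns \<xi> P Q. finite_dimensional H \<and> realizes H T tns \<xi> P Q p}"

definition orthonormal_basis_of :: "'h::complex_hilbert_space set \<Rightarrow> nat \<Rightarrow> (nat \<Rightarrow> 'h) \<Rightarrow> bool" where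
  "orthonormal_basis_of H d e \<longleftrightarrow>
     (\<forall>i<d. \<forall>j<d. cinner (e i) (e j) = (if i = j then 1 else 0)) \<and> cspan (e ` {..<d}) = H"

text \<open>The correlations in \<open>C_q\<close> that use a maximally entangled vector.\<close>

definition C_q_max_entangled :: "'h::complex_hilbert_space itself \<Rightarrow>
    ('x::finite, 'y::finite, 'a::finite, 'b::finite) correlation set" where
  "C_q_max_entangled _ = {p. \<exists>(H::'h set) T tns d e P Q. orthonormal_basis_of H d e \<and>
     realizes H T tns (complex_of_real (1 / sqrt (real d)) *\<^sub>C (\<Sum>i<d. tns (e i) (e i))) P Q p}"

section \<open>The universal unital C*-algebra of a set of generators and relations\<close>

datatype 'g gen_word = GenWord (letters: "'g list")

instantiation gen_word :: (type) monoid_add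
begin

definition "0 = GenWord []"
definition "v + w = GenWord (letters v @ letters w)"

instance
  by standard (simp_all add: zero_gen_word_def plus_gen_word_def)

end

definition rev_word :: "'g gen_word \<Rightarrow> 'g gen_word" where
  "rev_word w = GenWord (rev (letters w))"

text \<open>The free unital complex *-algebra on self-adjoint generators \<open>'g\<close> is the monoid algebra of
  the words in \<open>'g\<close>; the convolution product is the one of \<open>Poly_Mapping\<close>. Its involution reverses
  words and conjugates coefficients.\<close>

type_synonym 'g free_alg = "'g gen_word \<Rightarrow>\<^sub>0 complex"

definition gen :: "'g \<Rightarrow> 'g free_alg" where
  "gen g = Poly_Mapping.single (GenWord [g]) 1"

definition free_smult :: "complex \<Rightarrow> 'g free_alg \<Rightarrow> 'g free_alg" where
  "free_smult c f = Poly_Mapping.single 0 c * f"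

definition free_star :: "'g free_alg \<Rightarrow> 'g free_alg" where
  "free_star f = Poly_Mapping.map_key rev_word (Poly_Mapping.map cnj f)"

lemma inj_rev_word: "inj rev_word"
  by (rule injI) (auto simp: rev_word_def intro: gen_word.expand)

lemma lookup_free_star:
  "Poly_Mapping.lookup (free_star f) w = cnj (Poly_Mapping.lookup f (rev_word w))"
  by (simp add: free_star_def map_key.rep_eq[OF inj_rev_word] map.rep_eq when_def)

lemma lookup_free_smult:
  "Poly_Mapping.lookup (free_smult c f) w = c * Poly_Mapping.lookup f w"
proof -
  have "free_smult c f = Poly_Mapping.map ((*) c) f"
    unfolding free_smult_def by (rule mult_map_scale_conv_mult[symmetric])
  then show ?thesis
    by (simp add: map.rep_eq when_def)
qed

definition cstar_seminorm :: "('g free_alg \<Rightarrow> real) \<Rightarrow> bool" where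
  "cstar_seminorm s \<longleftrightarrow>
     (\<forall>f g. s (f + g) \<le> s f + s g) \<and>
     (\<forall>c f. s (free_smult c f) = cmod c * s f) \<and>
     (\<forall>f g. s (f * g) \<le> s f * s g) \<and>
     (\<forall>f. s (free_star f * f) = (s f)\<^sup>2)"

text \<open>The universal C*-seminorm for the relations \<open>r = 0\<close>, \<open>r \<in> Rel\<close>. The supremum is over a
  non-empty set (it contains the zero seminorm) and is finite if the relations bound every
  generator, as they do when each generator is required to be a projection.\<close>

definition univ_seminorm :: "'g free_alg set \<Rightarrow> 'g free_alg \<Rightarrow> real" where
  "univ_seminorm Rel f = (SUP s \<in> {s. cstar_seminorm s \<and> (\<forall>r\<in>Rel. s r = 0)}. s f)"

text \<open>The universal C*-algebra is the Hausdorff completion of the free *-algebra: Cauchy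
  sequences modulo null sequences.\<close>

definition cauchy_seqs :: "'g free_alg set \<Rightarrow> (nat \<Rightarrow> 'g free_alg) set" where
  "cauchy_seqs Rel =
     {f. \<forall>e>0. \<exists>N. \<forall>m\<ge>N. \<forall>n\<ge>N. univ_seminorm Rel (f m - f n) < e}"

definition null_rel :: "'g free_alg set \<Rightarrow> ((nat \<Rightarrow> 'g free_alg) \<times> (nat \<Rightarrow> 'g free_alg)) set" where
  "null_rel Rel = {(f, g). f \<in> cauchy_seqs Rel \<and> g \<in> cauchy_seqs Rel \<and>
     (\<lambda>n. univ_seminorm Rel (f n - g n)) \<longlonglongrightarrow> 0}"

definition limit_class :: "'g free_alg set \<Rightarrow> (nat \<Rightarrow> 'g free_alg) \<Rightarrow> (nat \<Rightarrow> 'g free_alg) set" where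
  "limit_class Rel f = null_rel Rel `` {f}"

record 'c star_algebra = "(complex, 'c) module" +
  star :: "'c \<Rightarrow> 'c"
  alg_norm :: "'c \<Rightarrow> real"

definition universal_cstar_algebra ::
  "'g free_alg set \<Rightarrow> (nat \<Rightarrow> 'g free_alg) set star_algebra" where
  "universal_cstar_algebra Rel =
     \<lparr> carrier = cauchy_seqs Rel // null_rel Rel,
       mult = (\<lambda>U V. \<Union>f\<in>U. \<Union>g\<in>V. limit_class Rel (\<lambda>n. f n * g n)),
       one = limit_class Rel (\<lambda>n. 1),
       zero = limit_class Rel (\<lambda>n. 0),
       add = (\<lambda>U V. \<Union>f\<in>U. \<Union>g\<in>V. limit_class Rel (\<lambda>n. f n + g n)),
       smult = (\<lambda>c U. \<Union>f\<in>U. limit_class Rel (\<lambda>n. free_smult c (f n))),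
       star = (\<lambda>U. \<Union>f\<in>U. limit_class Rel (\<lambda>n. free_star (f n))),
       alg_norm = (\<lambda>U. THE l. \<forall>f\<in>U. (\<lambda>n. univ_seminorm Rel (f n)) \<longlonglongrightarrow> l) \<rparr>"

section \<open>The C*-algebra of a game and its representations\<close>

datatype ('x, 'y, 'a, 'b) game_gen = GenP 'x 'a | GenQ 'y 'b

definition game_relations :: "('x::finite, 'y::finite, 'a::finite, 'b::finite) game \<Rightarrow>
    ('x, 'y, 'a, 'b) game_gen free_alg set" where
  "game_relations lam =
     {gen (GenP x a) * gen (GenP x a) - gen (GenP x a) | x a. True} \<union>
     {gen (GenQ y b) * gen (GenQ y b) - gen (GenQ y b) | y b. True} \<union>
     {(\<Sum>a\<in>UNIV. gen (GenP x a)) - 1 | x. True} \<union>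
     {(\<Sum>b\<in>UNIV. gen (GenQ y b)) - 1 | y. True} \<union>
     {gen (GenP x a) * gen (GenQ y b) | x y a b. \<not> lam x y a b}"

definition game_algebra :: "('x::finite, 'y::finite, 'a::finite, 'b::finite) game \<Rightarrow>
    (nat \<Rightarrow> ('x, 'y, 'a, 'b) game_gen free_alg) set star_algebra" where
  "game_algebra lam = universal_cstar_algebra (game_relations lam)"

text \<open>A representation is a *-homomorphism into the bounded operators on \<open>H\<close>; it is not required to
  preserve the unit.\<close>

definition representation_on ::
  "'c star_algebra \<Rightarrow> 'h::complex_hilbert_space set \<Rightarrow> ('c \<Rightarrow> 'h \<Rightarrow> 'h) \<Rightarrow> bool" where
  "representation_on A H \<pi> \<longleftrightarrow>
     (\<forall>U\<in>carrier A. bounded_operator_on H (\<pi> U)) \<and>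
     (\<forall>U\<in>carrier A. \<forall>V\<in>carrier A. \<forall>u\<in>H. \<pi> (U \<oplus>\<^bsub>A\<^esub> V) u = \<pi> U u + \<pi> V u) \<and>
     (\<forall>c. \<forall>U\<in>carrier A. \<forall>u\<in>H. \<pi> (c \<odot>\<^bsub>A\<^esub> U) u = c *\<^sub>C \<pi> U u) \<and>
     (\<forall>U\<in>carrier A. \<forall>V\<in>carrier A. \<forall>u\<in>H. \<pi> (U \<otimes>\<^bsub>A\<^esub> V) u = \<pi> U (\<pi> V u)) \<and>
     (\<forall>U\<in>carrier A. \<forall>u\<in>H. \<forall>v\<in>H. cinner (\<pi> U u) v = cinner u (\<pi> (star A U) v))"

definition nondegenerate_on ::
  "'c star_algebra \<Rightarrow> 'h::complex_hilbert_space set \<Rightarrow> ('c \<Rightarrow> 'h \<Rightarrow> 'h) \<Rightarrow> bool" where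
  "nondegenerate_on A H \<pi> \<longleftrightarrow> closure (cspan {\<pi> U u | U u. U \<in> carrier A \<and> u \<in> H}) = H"

definition has_nondegenerate_fd_representation ::
  "'h::complex_hilbert_space itself \<Rightarrow> 'c star_algebra \<Rightarrow> bool" where
  "has_nondegenerate_fd_representation _ A \<longleftrightarrow>
     (\<exists>(H::'h set) \<pi>. hilbert_subspace H \<and> finite_dimensional H \<and> H \<noteq> {0} \<and>
        representation_on A H \<pi> \<and> nondegenerate_on A H \<pi>)"

end

theory Submission
  imports Defs
begin

text \<open>All four conditions say that the game has a finite-dimensional model: projection-valued
  measures \<open>p x\<close> and \<open>q y\<close> on one nonzero finite-dimensional Hilbert space such that
  \<open>p x a q y b = 0\<close> for all answers \<open>a, b\<close> that lose on the questions \<open>x, y\<close>.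

  The heart is to extract a model from a perfect spatial strategy (\<open>model_of_spatial_strategy\<close>). The
  vector \<open>\<xi>\<close> of the strategy is a Hilbert--Schmidt operator in disguise: it defines antilinear
  operators \<open>N\<close> and \<open>M\<close> with \<open>\<langle>u \<otimes> v, \<xi>\<rangle> = \<langle>v, N u\<rangle> = \<langle>u, M v\<rangle>\<close>, and \<open>M N\<close> and \<open>N M\<close> are its two
  reduced density operators. Perfection means \<open>Q y b N P x a = 0\<close> and \<open>P x a M Q y b = 0\<close> for losing
  answers. Let \<open>a\<close> and \<open>a'\<close> be different answers to \<open>x\<close>. In an imitation game some question \<open>y\<close>
  separates them: no answer \<open>b\<close> wins against both. Then \<open>N P x a\<close> and \<open>N P x a'\<close> have orthogonal
  ranges, which says that \<open>P x a' M N P x a = 0\<close>. So \<open>M N\<close> is block diagonal for every \<open>P x\<close> and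
  commutes with it; likewise \<open>N M\<close> commutes with every \<open>Q y\<close> (\<open>MN_commutes_pvm\<close>). Since \<open>M N\<close> is
  compact, positive and nonzero, its largest eigenvalue \<open>c\<close> is attained (\<open>top_eigenvector\<close>), and by
  the Hilbert--Schmidt bound the eigenspace is finite-dimensional. The measures \<open>P x\<close> restrict to
  this eigenspace, \<open>c\<^sup>-\<^sup>1 M Q y b N\<close> are projections on it, and together they form a model
  (\<open>eigenspace_model\<close>).

  Conversely, in a model with orthonormal basis \<open>e\<close> the measures \<open>p x\<close> and the transposes of the
  \<open>q y\<close> on a maximally entangled vector give answers \<open>a, b\<close> with probability the normalized trace of
  \<open>p x a q y b\<close>, so this strategy is perfect (\<open>maximally_entangled_strategy_of_model\<close>). Such
  strategies are quantum strategies, and these are spatial ones, which closes the circle for the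
  first three conditions.

  Models and finite-dimensional representations correspond by the universal property of the game
  algebra. The operator norm of a model is a C*-seminorm that vanishes on the relations, hence is
  dominated by the universal one, and evaluation at the model extends to the completion
  (\<open>representation_of_model\<close>). A nondegenerate representation maps the unit to the identity, so the
  images of the generators form a model (\<open>model_of_representation\<close>).\<close>

section \<open>Complex Hilbert spaces\<close>

lemma cinner_add_left: "cinner (x + y) z = cinner x z + cinner y (z :: 'a::complex_hilbert_space)"
  by (metis cinner_add_right cinner_commute complex_cnj_add)

lemma cinner_scaleC_left: "cinner (c *\<^sub>C x) y = cnj c * cinner x (y :: 'a::complex_hilbert_space)"
  by (metis cinner_scaleC_right cinner_commute complex_cnj_mult)

lemma cinner_zero_right [simp]: "cinner x (0 :: 'a::complex_hilbert_space) = 0"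
  using cinner_add_right[of x 0 0] by simp

lemma cinner_zero_left [simp]: "cinner 0 (x :: 'a::complex_hilbert_space) = 0"
  using cinner_add_left[of 0 0 x] by simp

lemma cinner_minus_right: "cinner x (- y) = - cinner x (y :: 'a::complex_hilbert_space)"
  using cinner_add_right[of x y "- y"] by (simp add: eq_neg_iff_add_eq_0 add.commute)

lemma cinner_diff_right: "cinner x (y - z) = cinner x y - cinner x (z :: 'a::complex_hilbert_space)"
  using cinner_add_right[of x y "- z"] by (simp add: cinner_minus_right)

lemma cinner_sum_right: "cinner x (\<Sum>i\<in>I. f i) = (\<Sum>i\<in>I. cinner x (f i :: 'a::complex_hilbert_space))"
  by (induction I rule: infinite_finite_induct) (simp_all add: cinner_add_right)

lemma cinner_sum_left: "cinner (\<Sum>i\<in>I. f i) x = (\<Sum>i\<in>I. cinner (f i) (x :: 'a::complex_hilbert_space))"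
  by (induction I rule: infinite_finite_induct) (simp_all add: cinner_add_left)

lemma cinner_self: "cinner x x = complex_of_real ((norm (x :: 'a::complex_hilbert_space))\<^sup>2)"
proof -
  have "Im (cinner x x) = 0"
    using arg_cong[OF cinner_commute[of x x], of Im] by simp
  then show ?thesis
    by (simp add: complex_eq_iff Re_cinner power2_norm_eq_inner)
qed

lemma cinner_self_eq_zero: "cinner x x = 0 \<longleftrightarrow> x = (0 :: 'a::complex_hilbert_space)"
  by (simp add: cinner_self)

lemma norm_scaleC [simp]: "norm (c *\<^sub>C x) = cmod c * norm (x :: 'a::complex_hilbert_space)"
proof -
  have "complex_of_real ((norm (c *\<^sub>C x))\<^sup>2) = cnj c * c * complex_of_real ((norm x)\<^sup>2)"
    unfolding cinner_self[symmetric] by (simp add: cinner_scaleC_left cinner_scaleC_right)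
  also have "\<dots> = complex_of_real ((cmod c * norm x)\<^sup>2)"
    by (simp add: power_mult_distrib mult.commute[of "cnj c"] flip: complex_norm_square)
  finally have "(norm (c *\<^sub>C x))\<^sup>2 = (cmod c * norm x)\<^sup>2"
    using of_real_eq_iff by blast
  then show ?thesis
    by simp
qed

lemma cinner_Cauchy_Schwarz: "cmod (cinner x y) \<le> norm x * norm (y :: 'a::complex_hilbert_space)"
proof (cases "cinner x y = 0")
  case False
  \<comment> \<open>Rotating \<open>y\<close> by a phase makes the inner product real and reduces the claim to the real case.\<close>
  define c where "c = cnj (cinner x y) / cmod (cinner x y)"
  have c: "cmod c = 1"
    using False by (simp add: c_def norm_divide)
  have "cinner x (c *\<^sub>C y) = complex_of_real (cmod (cinner x y))"
    using False
    by (simp add: cinner_scaleC_right c_def mult.commute[of "cnj _"] power2_eq_square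
        flip: complex_norm_square)
  then have "cmod (cinner x y) = inner x (c *\<^sub>C y)"
    by (metis Re_cinner Re_complex_of_real)
  also have "\<dots> \<le> norm x * norm (c *\<^sub>C y)"
    by (rule norm_cauchy_schwarz)
  finally show ?thesis
    by (simp add: c)
qed simp

text \<open>The form in which the Cauchy--Schwarz inequality gives norm bounds: the square norm of an operator
  value is rewritten by an adjointness relation, and one factor of the norm is then cancelled.\<close>

lemma norm_square_le:
  fixes w :: "'a::complex_hilbert_space"
  assumes "cinner w w = cinner x y"
  shows "(norm w)\<^sup>2 \<le> norm x * norm (y :: 'b::complex_hilbert_space)"
  using cinner_Cauchy_Schwarz[of x y] unfolding assms[symmetric] cinner_self norm_of_real by simp

lemma bounded_bilinear_cinner: "bounded_bilinear (cinner :: 'a::complex_hilbert_space \<Rightarrow> 'a \<Rightarrow> complex)"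
proof
  show "\<exists>K. \<forall>a b. norm (cinner a (b :: 'a)) \<le> norm a * norm b * K"
    by (rule exI[of _ 1]) (simp add: cinner_Cauchy_Schwarz)
qed (simp_all add: cinner_add_left cinner_add_right cinner_scaleC_left cinner_scaleC_right
    scaleR_conv_of_real flip: scaleC_of_real)

lemma bounded_bilinear_scaleC: "bounded_bilinear (scaleC :: complex \<Rightarrow> 'a::complex_hilbert_space \<Rightarrow> 'a)"
proof
  show "\<exists>K. \<forall>a (b :: 'a). norm (a *\<^sub>C b) \<le> norm a * norm b * K"
    by (rule exI[of _ 1]) simp
qed (simp_all add: scaleC_add_left scaleC_add_right scaleC_scaleC mult.commute scaleR_conv_of_real
    flip: scaleC_of_real)

lemmas tendsto_cinner = bounded_bilinear.tendsto[OF bounded_bilinear_cinner]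
lemmas tendsto_scaleC = bounded_bilinear.tendsto[OF bounded_bilinear_scaleC]
lemmas continuous_on_cinner = bounded_bilinear.continuous_on[OF bounded_bilinear_cinner]
lemmas continuous_on_scaleC = bounded_bilinear.continuous_on[OF bounded_bilinear_scaleC]

lemma csubspace_sum: "csubspace S \<Longrightarrow> (\<And>i. i \<in> I \<Longrightarrow> f i \<in> S) \<Longrightarrow> (\<Sum>i\<in>I. f i) \<in> S"
  by (rule complex_vector.subspace_sum)

lemmas csubspace_0 = complex_vector.subspace_0
lemmas csubspace_add = complex_vector.subspace_add
lemmas csubspace_diff = complex_vector.subspace_diff
lemmas csubspace_scale = complex_vector.subspace_scale

lemma hilbert_subspace_csubspace: "hilbert_subspace H \<Longrightarrow> csubspace H"
  by (simp add: hilbert_subspace_def)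

lemma hilbert_subspace_limit:
  assumes "hilbert_subspace H" "\<And>n. f n \<in> H" "f \<longlonglongrightarrow> l"
  shows "l \<in> H"
  using assms closed_sequentially unfolding hilbert_subspace_def by blast

text \<open>Equations between vectors of a subspace are tested weakly, so that linearity, uniqueness and
  vanishing statements for operators given by adjointness relations are all proved the same way.\<close>

lemma csubspace_eqI:
  assumes "csubspace H" "u \<in> H" "v \<in> H" "\<And>w. w \<in> H \<Longrightarrow> cinner w u = cinner w v"
  shows "u = v"
proof -
  have "cinner (u - v) (u - v) = 0"
    using assms(4)[of "u - v"] csubspace_diff[OF assms(1-3)] by (simp add: cinner_diff_right)
  then show ?thesis
    by (simp add: cinner_self_eq_zero)
qed

subsection \<open>Orthonormal families\<close>

definition orthonormal :: "nat \<Rightarrow> (nat \<Rightarrow> 'h::complex_hilbert_space) \<Rightarrow> bool" where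
  "orthonormal d e \<longleftrightarrow> (\<forall>i<d. \<forall>j<d. cinner (e i) (e j) = (if i = j then 1 else 0))"

lemma orthonormal_cinner_sum:
  assumes "orthonormal d e" "i < d"
  shows "cinner (e i) (\<Sum>j<d. a j *\<^sub>C e j) = a i"
proof -
  have "cinner (e i) (\<Sum>j<d. a j *\<^sub>C e j) = (\<Sum>j<d. if i = j then a j else 0)"
    unfolding cinner_sum_right
    by (rule sum.cong) (use assms in \<open>auto simp: cinner_scaleC_right orthonormal_def\<close>)
  then show ?thesis
    using assms(2) by simp
qed

lemma orthonormal_expansion:
  assumes "orthonormal d e" "u \<in> cspan (e ` {..<d})"
  shows "u = (\<Sum>i<d. cinner (e i) u *\<^sub>C e i)"
  using assms(2)
proof (induction rule: complex_vector.span_induct_alt)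
  case base
  show ?case by simp
next
  case (step c x y)
  then obtain k where k: "k < d" "x = e k"
    by auto
  have "(\<Sum>i<d. cinner (e i) x *\<^sub>C e i) = (\<Sum>i<d. if k = i then e i else 0)"
    by (rule sum.cong) (use k assms(1) in \<open>auto simp: orthonormal_def scaleC_one\<close>)
  then have "(\<Sum>i<d. cinner (e i) x *\<^sub>C e i) = x"
    using k by simp
  moreover have "(\<Sum>i<d. cinner (e i) (c *\<^sub>C x + y) *\<^sub>C e i)
      = c *\<^sub>C (\<Sum>i<d. cinner (e i) x *\<^sub>C e i) + (\<Sum>i<d. cinner (e i) y *\<^sub>C e i)"
    by (simp add: cinner_add_right cinner_scaleC_right scaleC_add_left sum.distrib
        complex_vector.scale_sum_right scaleC_scaleC)
  ultimately show ?case
    using step.IH by metis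
qed

lemma orthonormal_Parseval:
  assumes "orthonormal d e" "u \<in> cspan (e ` {..<d})"
  shows "cinner v u = (\<Sum>i<d. cinner v (e i) * cinner (e i) u)"
  by (subst orthonormal_expansion[OF assms])
    (simp add: cinner_sum_right cinner_scaleC_right mult.commute)

text \<open>The span is the set of fixed points of the expansion in the orthonormal family, which is
  continuous.\<close>

lemma orthonormal_closed_span:
  assumes "orthonormal d e"
  shows "closed (cspan (e ` {..<d}))"
proof -
  have "cspan (e ` {..<d}) = {u. u = (\<Sum>i<d. cinner (e i) u *\<^sub>C e i)}"
  proof (intro equalityI subsetI CollectI)
    fix u assume "u \<in> {u. u = (\<Sum>i<d. cinner (e i) u *\<^sub>C e i)}"
    then have "u = (\<Sum>i<d. cinner (e i) u *\<^sub>C e i)"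
      by simp
    also have "\<dots> \<in> cspan (e ` {..<d})"
      by (intro complex_vector.span_sum complex_vector.span_scale complex_vector.span_base) auto
    finally show "u \<in> cspan (e ` {..<d})" .
  qed (rule orthonormal_expansion[OF assms])
  moreover have "closed {u. u = (\<Sum>i<d. cinner (e i) u *\<^sub>C e i)}"
    by (intro closed_Collect_eq continuous_on_id continuous_on_sum continuous_on_scaleC
        continuous_on_cinner continuous_on_const)
  ultimately show ?thesis
    by simp
qed

text \<open>One Gram--Schmidt step: the normalized residual of a vector outside the span.\<close>

lemma orthonormal_extend:
  assumes "orthonormal d e" "csubspace K" "\<And>i. i < d \<Longrightarrow> e i \<in> K" "cspan (e ` {..<d}) \<noteq> K"
  obtains x where "x \<in> K" "orthonormal (Suc d) (e(d := x))"
proof -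
  have "cspan (e ` {..<d}) \<subseteq> K"
    by (rule complex_vector.span_minimal) (use assms in auto)
  then obtain u where u: "u \<in> K" "u \<notin> cspan (e ` {..<d})"
    using assms(4) by blast
  define w where "w = (\<Sum>i<d. cinner (e i) u *\<^sub>C e i)"
  define r where "r = u - w"
  define x where "x = complex_of_real (1 / norm r) *\<^sub>C r"
  have wspan: "w \<in> cspan (e ` {..<d})"
    unfolding w_def
    by (intro complex_vector.span_sum complex_vector.span_scale complex_vector.span_base) auto
  have wK: "w \<in> K"
    using wspan \<open>cspan (e ` {..<d}) \<subseteq> K\<close> by blast
  have r0: "r \<noteq> 0"
    using wspan u unfolding r_def by auto
  have xK: "x \<in> K"
    unfolding x_def r_def using u wK assms(2) by (intro csubspace_scale csubspace_diff)
  have orth: "cinner (e i) x = 0" if "i < d" for i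
    using orthonormal_cinner_sum[OF assms(1) that]
    by (simp add: x_def r_def w_def cinner_scaleC_right cinner_diff_right)
  have orth': "cinner x (e i) = 0" if "i < d" for i
    using orth[OF that] cinner_commute[of x "e i"] by simp
  have "norm x = 1"
    using r0 by (simp add: x_def norm_divide)
  then have "cinner x x = 1"
    by (simp add: cinner_self)
  then have "orthonormal (Suc d) (e(d := x))"
    using assms(1) orth orth' by (auto simp: orthonormal_def less_Suc_eq)
  then show ?thesis
    using xK that by blast
qed

text \<open>Iterated Gram--Schmidt steps either end at a finite orthonormal basis or never end. This
  dichotomy serves as the dimension theory here: it yields bases of finite-dimensional spaces, long
  orthonormal families in infinite-dimensional ones, and finite dimension of a space in which the
  length of orthonormal families is bounded.\<close>

lemma orthonormal_basis_or_sequences: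
  assumes "csubspace K"
  obtains d e where "orthonormal d e" "cspan (e ` {..<d}) = K"
    | "\<And>n. \<exists>e. orthonormal n e \<and> (\<forall>i<n. e i \<in> K)"
proof (cases "\<exists>d e. orthonormal d e \<and> cspan (e ` {..<d}) = K")
  case False
  have "\<exists>e. orthonormal n e \<and> (\<forall>i<n. e i \<in> K)" for n
  proof (induction n)
    case 0
    show ?case by (simp add: orthonormal_def)
  next
    case (Suc n)
    then obtain e where e: "orthonormal n e" "\<And>i. i < n \<Longrightarrow> e i \<in> K"
      by blast
    then obtain x where "x \<in> K" "orthonormal (Suc n) (e(n := x))"
      using orthonormal_extend[OF e(1) assms e(2)] False by blast
    moreover from this have "\<forall>i<Suc n. (e(n := x)) i \<in> K"
      using e by (auto simp: less_Suc_eq)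
    ultimately show ?case
      by blast
  qed
  then show ?thesis
    using that(2) by blast
qed (use that(1) in blast)

lemma orthonormal_inj: "orthonormal d e \<Longrightarrow> inj_on e {..<d}"
  by (rule inj_onI) (metis lessThan_iff orthonormal_def zero_neq_one)

lemma orthonormal_independent:
  assumes "orthonormal d e"
  shows "\<not> complex_vector.dependent (e ` {..<d})"
proof
  assume "complex_vector.dependent (e ` {..<d})"
  then obtain c v where c: "v \<in> e ` {..<d}" "c v \<noteq> 0" "(\<Sum>v\<in>e ` {..<d}. c v *\<^sub>C v) = 0"
    using complex_vector.dependent_finite[of "e ` {..<d}"] by auto
  then obtain i where i: "i < d" "v = e i"
    by blast
  have "(\<Sum>j<d. c (e j) *\<^sub>C e j) = 0"
    using c(3) by (simp add: sum.reindex[OF orthonormal_inj[OF assms]] o_def)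
  then have "c (e i) = 0"
    using orthonormal_cinner_sum[OF assms i(1), of "\<lambda>j. c (e j)"] by simp
  then show False
    using c i by simp
qed

lemma finite_dimensional_orthonormal_basis:
  assumes "finite_dimensional H"
  obtains d e where "orthonormal d e" "cspan (e ` {..<d}) = H"
proof -
  obtain B where B: "finite B" "H = cspan B"
    using assms by (auto simp: finite_dimensional_def)
  have "csubspace H"
    by (simp add: B)
  then show ?thesis
  proof (cases rule: orthonormal_basis_or_sequences)
    case 2
    then obtain e where e: "orthonormal (Suc (card B)) e" "\<And>i. i < Suc (card B) \<Longrightarrow> e i \<in> H"
      by metis
    have "card (e ` {..<Suc (card B)}) \<le> card B"
      using complex_vector.independent_span_bound[OF B(1) orthonormal_independent[OF e(1)]] e(2) B
      by auto
    then show ?thesis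
      by (simp add: card_image[OF orthonormal_inj[OF e(1)]] del: lessThan_Suc)
  qed (use that in blast)
qed

lemma infinite_dimensional_orthonormal:
  assumes "infinite_dimensional_type TYPE('h::complex_hilbert_space)"
  obtains e :: "nat \<Rightarrow> 'h::complex_hilbert_space" where "orthonormal n e"
proof -
  have "csubspace (UNIV :: 'h set)"
    by simp
  then show ?thesis
  proof (cases rule: orthonormal_basis_or_sequences)
    case (1 d e)
    then have "finite_dimensional (UNIV :: 'h set)"
      unfolding finite_dimensional_def by (intro exI[of _ "e ` {..<d}"]) auto
    then show ?thesis
      using assms by (simp add: infinite_dimensional_type_def)
  qed (use that in blast)
qed

lemma finite_dimensional_closed:
  assumes "finite_dimensional H"
  shows "closed H"
  using finite_dimensional_orthonormal_basis[OF assms] orthonormal_closed_span by metis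

lemma finite_dimensional_csubspace: "finite_dimensional H \<Longrightarrow> csubspace H"
  by (auto simp: finite_dimensional_def)

lemma finite_dimensional_hilbert_subspace: "finite_dimensional H \<Longrightarrow> hilbert_subspace H"
  by (simp add: hilbert_subspace_def finite_dimensional_closed finite_dimensional_csubspace)

subsection \<open>Operators on closed subspaces\<close>

lemma bounded_operator_onD:
  assumes "bounded_operator_on H F"
  shows bounded_operator_in: "u \<in> H \<Longrightarrow> F u \<in> H"
    and bounded_operator_add: "u \<in> H \<Longrightarrow> v \<in> H \<Longrightarrow> F (u + v) = F u + F v"
    and bounded_operator_scale: "u \<in> H \<Longrightarrow> F (c *\<^sub>C u) = c *\<^sub>C F u"
  using assms by (auto simp: bounded_operator_on_def)

lemma bounded_operator_bound:
  assumes "bounded_operator_on H F"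
  obtains K where "K \<ge> 0" "\<And>u. u \<in> H \<Longrightarrow> norm (F u) \<le> K * norm u"
proof -
  obtain K where K: "\<And>u. u \<in> H \<Longrightarrow> norm (F u) \<le> K * norm u"
    using assms unfolding bounded_operator_on_def by blast
  have "norm (F u) \<le> max K 0 * norm u" if "u \<in> H" for u
    using K[OF that] mult_right_mono[of K "max K 0" "norm u"] by auto
  then show ?thesis
    using that[of "max K 0"] by simp
qed

lemma bounded_operator_zero:
  assumes "bounded_operator_on H F" "csubspace H"
  shows "F 0 = 0"
  using bounded_operator_scale[OF assms(1) csubspace_0[OF assms(2)], of 0] by simp

lemma bounded_operator_diff:
  assumes "bounded_operator_on H F" "csubspace H" "u \<in> H" "v \<in> H"
  shows "F (u - v) = F u - F v"
proof -
  have "F (u + (-1) *\<^sub>C v) = F u + (-1) *\<^sub>C F v"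
    using assms by (simp only: bounded_operator_add bounded_operator_scale csubspace_scale)
  then show ?thesis
    by (simp add: scaleC_one)
qed

lemma bounded_operator_sum:
  assumes "bounded_operator_on H F" "csubspace H" "\<And>i. i \<in> I \<Longrightarrow> f i \<in> H"
  shows "F (\<Sum>i\<in>I. f i) = (\<Sum>i\<in>I. F (f i))"
  using assms(3)
  by (induction I rule: infinite_finite_induct)
    (simp_all add: assms bounded_operator_zero[OF assms(1,2)] bounded_operator_add[OF assms(1)] csubspace_sum)

lemma bounded_operator_tendsto:
  assumes "bounded_operator_on H F" "csubspace H" "\<And>n. f n \<in> H" "l \<in> H" "f \<longlonglongrightarrow> l"
  shows "(\<lambda>n. F (f n)) \<longlonglongrightarrow> F l"
proof -
  obtain K where K: "\<And>u. u \<in> H \<Longrightarrow> norm (F u) \<le> K * norm u"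
    using bounded_operator_bound[OF assms(1)] by blast
  have "norm (F (f n) - F l) \<le> norm (f n - l) * K" for n
    using K[of "f n - l"] bounded_operator_diff[OF assms(1,2)] assms(3,4) csubspace_diff[OF assms(2)]
    by (simp add: mult.commute)
  then have "\<forall>\<^sub>F n in sequentially. norm (F (f n) - F l) \<le> norm (f n - l) * K"
    by simp
  moreover have "(\<lambda>n. norm (f n - l) * K) \<longlonglongrightarrow> 0"
    by (intro tendsto_mult_left_zero tendsto_norm_zero LIM_zero assms(5))
  ultimately have "(\<lambda>n. F (f n) - F l) \<longlonglongrightarrow> 0"
    by (rule Lim_null_comparison)
  then show ?thesis
    by (rule LIM_zero_cancel)
qed

lemma projection_onD:
  assumes "projection_on H F"
  shows projection_bounded: "bounded_operator_on H F"
    and projection_idem: "u \<in> H \<Longrightarrow> F (F u) = F u"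
    and projection_sym: "u \<in> H \<Longrightarrow> v \<in> H \<Longrightarrow> cinner (F u) v = cinner u (F v)"
    and projection_in: "u \<in> H \<Longrightarrow> F u \<in> H"
  using assms by (auto simp: projection_on_def bounded_operator_on_def)

lemma symmetric_idempotent_norm_le:
  assumes "F u \<in> H" "F (F u) = F u" "u \<in> H"
    and sym: "\<And>u v. u \<in> H \<Longrightarrow> v \<in> H \<Longrightarrow> cinner (F u) v = cinner u (F v)"
  shows "norm (F u) \<le> norm u"
proof -
  have "cinner (F u) (F u) = cinner (F u) u"
    using sym[OF assms(3,1)] sym[OF assms(3,3)] assms(2) by simp
  then have "(norm (F u))\<^sup>2 \<le> norm (F u) * norm u"
    by (rule norm_square_le)
  then show ?thesis
    by (cases "norm (F u) = 0") (auto simp: power2_eq_square)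
qed

lemma projection_norm_le: "projection_on H F \<Longrightarrow> u \<in> H \<Longrightarrow> norm (F u) \<le> norm u"
  by (rule symmetric_idempotent_norm_le[where H = H]) (blast intro: projection_in projection_idem projection_sym)+

lemma projection_onI:
  assumes "\<And>u. u \<in> H \<Longrightarrow> F u \<in> H"
    and "\<And>u v. u \<in> H \<Longrightarrow> v \<in> H \<Longrightarrow> F (u + v) = F u + F v"
    and "\<And>c u. u \<in> H \<Longrightarrow> F (c *\<^sub>C u) = c *\<^sub>C F u"
    and "\<And>u. u \<in> H \<Longrightarrow> F (F u) = F u"
    and "\<And>u v. u \<in> H \<Longrightarrow> v \<in> H \<Longrightarrow> cinner (F u) v = cinner u (F v)"
  shows "projection_on H F"
proof -
  have "norm (F u) \<le> 1 * norm u" if "u \<in> H" for u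
    using symmetric_idempotent_norm_le[of F u H] assms that by simp
  then show ?thesis
    using assms unfolding projection_on_def bounded_operator_on_def by blast
qed

lemma pvm_onD:
  assumes "pvm_on H P"
  shows pvm_projection: "projection_on H (P i)"
    and pvm_sum: "u \<in> H \<Longrightarrow> (\<Sum>i\<in>UNIV. P i u) = u"
  using assms by (auto simp: pvm_on_def)

section \<open>Hilbert space tensor products\<close>

lemma tensor_productD:
  assumes "tensor_product H K T tns"
  shows tensor_hilbert: "hilbert_subspace T"
    and tensor_add_left: "u \<in> H \<Longrightarrow> u' \<in> H \<Longrightarrow> v \<in> K \<Longrightarrow> tns (u + u') v = tns u v + tns u' v"
    and tensor_scale_left: "u \<in> H \<Longrightarrow> v \<in> K \<Longrightarrow> tns (c *\<^sub>C u) v = c *\<^sub>C tns u v"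
    and tensor_cinner: "u \<in> H \<Longrightarrow> u' \<in> H \<Longrightarrow> v \<in> K \<Longrightarrow> v' \<in> K \<Longrightarrow>
      cinner (tns u v) (tns u' v') = cinner u u' * cinner v v'"
    and tensor_closure: "closure (cspan {tns u v | u v. u \<in> H \<and> v \<in> K}) = T"
  using assms unfolding tensor_product_def by blast+

lemma tensor_in:
  assumes "tensor_product H K T tns" "u \<in> H" "v \<in> K"
  shows "tns u v \<in> T"
proof -
  have "tns u v \<in> cspan {tns u v | u v. u \<in> H \<and> v \<in> K}"
    using assms(2,3) by (intro complex_vector.span_base) blast
  then show ?thesis
    using tensor_closure[OF assms(1)] closure_subset by blast
qed

lemma tensor_norm:
  assumes "tensor_product H K T tns" "u \<in> H" "v \<in> K"
  shows "norm (tns u v) = norm u * norm v"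
proof -
  have "complex_of_real ((norm (tns u v))\<^sup>2) = complex_of_real ((norm u * norm v)\<^sup>2)"
    using tensor_cinner[OF assms(1,2,2,3,3)] by (simp add: cinner_self power_mult_distrib)
  then have "(norm (tns u v))\<^sup>2 = (norm u * norm v)\<^sup>2"
    using of_real_eq_iff by blast
  then show ?thesis
    by simp
qed

text \<open>Linear combinations of simple tensors are dense.\<close>

lemma tensor_product_induct [consumes 2, case_names tns zero add scale limit]:
  assumes "tensor_product H K T tns" "t \<in> T"
    and tns: "\<And>u v. u \<in> H \<Longrightarrow> v \<in> K \<Longrightarrow> Pr (tns u v)"
    and zero: "Pr 0"
    and add: "\<And>s t. s \<in> T \<Longrightarrow> t \<in> T \<Longrightarrow> Pr s \<Longrightarrow> Pr t \<Longrightarrow> Pr (s + t)"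
    and scale: "\<And>c t. t \<in> T \<Longrightarrow> Pr t \<Longrightarrow> Pr (c *\<^sub>C t)"
    and limit: "\<And>f t. (\<And>n. f n \<in> T) \<Longrightarrow> t \<in> T \<Longrightarrow> f \<longlonglongrightarrow> t \<Longrightarrow> (\<And>n. Pr (f n)) \<Longrightarrow> Pr t"
  shows "Pr t"
proof -
  let ?S = "{tns u v | u v. u \<in> H \<and> v \<in> K}"
  have T: "csubspace T"
    using tensor_hilbert[OF assms(1)] by (rule hilbert_subspace_csubspace)
  have "s \<in> T \<and> Pr s" if "s \<in> cspan ?S" for s
    using that
  proof (induction rule: complex_vector.span_induct_alt)
    case base
    show ?case using zero csubspace_0[OF T] by simp
  next
    case (step c x y)
    then obtain u v where uv: "u \<in> H" "v \<in> K" "x = tns u v"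
      by blast
    have x: "c *\<^sub>C x \<in> T" "Pr (c *\<^sub>C x)"
      using tensor_in[OF assms(1) uv(1,2)] tns[OF uv(1,2)] uv(3) scale csubspace_scale[OF T] by auto
    then show ?case
      using step.IH add csubspace_add[OF T] by blast
  qed
  moreover obtain f where "\<forall>n. f n \<in> cspan ?S" "f \<longlonglongrightarrow> t"
    using assms(2) closure_sequential[of t "cspan ?S"] unfolding tensor_closure[OF assms(1)] by blast
  ultimately show ?thesis
    using limit[of f t] assms(2) by blast
qed

lemma tensor_product_swap:
  assumes "tensor_product H K T tns"
  shows "tensor_product K H T (\<lambda>u v. tns v u)"
proof -
  have "{tns v u | u v. u \<in> K \<and> v \<in> H} = {tns u v | u v. u \<in> H \<and> v \<in> K}"
    by blast
  then show ?thesis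
    using assms unfolding tensor_product_def by (auto simp: mult.commute)
qed

text \<open>Both identities hold on simple tensors and persist under linear combinations and limits. For
  symmetry the two arguments are extended from simple tensors to all of \<open>T\<close> one after the other.\<close>

lemma tensor_operator_projection_sym_idem:
  assumes tp: "tensor_product H K T tns"
    and F: "projection_on H F" and G: "projection_on K G" and R: "tensor_operator H K T tns F G R"
    and "s \<in> T" "t \<in> T"
  shows "cinner (R s) t = cinner s (R t)" and "R (R t) = R t"
proof -
  have T: "hilbert_subspace T" "csubspace T"
    using tensor_hilbert[OF tp] hilbert_subspace_csubspace by blast+
  have Rb: "bounded_operator_on T R" and Rt: "\<And>u v. u \<in> H \<Longrightarrow> v \<in> K \<Longrightarrow> R (tns u v) = tns (F u) (G v)"
    using R by (auto simp: tensor_operator_def)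
  have lim: "(\<lambda>n. R (f n)) \<longlonglongrightarrow> R t" if "\<And>n. f n \<in> T" "t \<in> T" "f \<longlonglongrightarrow> t" for f t
    using bounded_operator_tendsto[OF Rb T(2) that] .
  have simple: "cinner (R s) (tns u v) = cinner s (R (tns u v))"
    if uv: "u \<in> H" "v \<in> K" and "s \<in> T" for s u v
    using tp \<open>s \<in> T\<close>
  proof (induction rule: tensor_product_induct)
    case (tns u' v')
    then show ?case
      using uv by (simp add: Rt tensor_cinner[OF tp] projection_in[OF F] projection_in[OF G]
          projection_sym[OF F] projection_sym[OF G])
  next
    case zero
    show ?case by (simp add: bounded_operator_zero[OF Rb T(2)])
  next
    case (add s t)
    then show ?case by (simp add: bounded_operator_add[OF Rb] cinner_add_left)
  next
    case (scale c t)
    then show ?case by (simp add: bounded_operator_scale[OF Rb] cinner_scaleC_left)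
  next
    case (limit f t)
    have "(\<lambda>n. cinner (R (f n)) (tns u v)) \<longlonglongrightarrow> cinner (R t) (tns u v)"
      using lim[OF limit(1-3)] by (intro tendsto_cinner tendsto_const)
    moreover have "(\<lambda>n. cinner (f n) (R (tns u v))) \<longlonglongrightarrow> cinner t (R (tns u v))"
      using limit by (intro tendsto_cinner tendsto_const)
    ultimately show ?case
      using limit(4) LIMSEQ_unique by simp
  qed
  show "cinner (R s) t = cinner s (R t)"
    using tp \<open>t \<in> T\<close>
  proof (induction rule: tensor_product_induct)
    case (tns u v)
    then show ?case using simple \<open>s \<in> T\<close> by blast
  next
    case zero
    show ?case by (simp add: bounded_operator_zero[OF Rb T(2)])
  next
    case (add s t)
    then show ?case by (simp add: bounded_operator_add[OF Rb] cinner_add_right)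
  next
    case (scale c t)
    then show ?case by (simp add: bounded_operator_scale[OF Rb] cinner_scaleC_right)
  next
    case (limit f t)
    have "(\<lambda>n. cinner s (R (f n))) \<longlonglongrightarrow> cinner s (R t)"
      using lim[OF limit(1-3)] by (intro tendsto_cinner tendsto_const)
    moreover have "(\<lambda>n. cinner (R s) (f n)) \<longlonglongrightarrow> cinner (R s) t"
      using limit by (intro tendsto_cinner tendsto_const)
    ultimately show ?case
      using limit(4) LIMSEQ_unique by simp
  qed
  show "R (R t) = R t"
    using tp \<open>t \<in> T\<close>
  proof (induction rule: tensor_product_induct)
    case (tns u v)
    then show ?case
      by (simp add: Rt projection_in[OF F] projection_in[OF G] projection_idem[OF F] projection_idem[OF G])
  next
    case zero
    show ?case by (simp add: bounded_operator_zero[OF Rb T(2)])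
  next
    case (add s t)
    then show ?case by (simp add: bounded_operator_add[OF Rb] bounded_operator_in[OF Rb])
  next
    case (scale c t)
    then show ?case by (simp add: bounded_operator_scale[OF Rb] bounded_operator_in[OF Rb])
  next
    case (limit f t)
    have "(\<lambda>n. R (f n)) \<longlonglongrightarrow> R t"
      using lim[OF limit(1-3)] .
    moreover from this have "(\<lambda>n. R (R (f n))) \<longlonglongrightarrow> R (R t)"
      using lim[of "\<lambda>n. R (f n)" "R t"] limit(1,2) bounded_operator_in[OF Rb] by blast
    ultimately show ?case
      using limit(4) LIMSEQ_unique by simp
  qed
qed

text \<open>As \<open>R\<close> is a projection, its expectation at \<open>\<xi>\<close> is the square norm of \<open>R \<xi>\<close>. So losing answers
  annihilate \<open>\<xi>\<close>, and symmetry moves the projections to the simple tensor.\<close>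

lemma tensor_operator_zero_expectation:
  assumes tp: "tensor_product H K T tns"
    and F: "projection_on H F" and G: "projection_on K G" and R: "tensor_operator H K T tns F G R"
    and "\<xi> \<in> T" "cinner \<xi> (R \<xi>) = 0" "u \<in> H" "v \<in> K"
  shows "cinner (tns (F u) (G v)) \<xi> = 0"
proof -
  have Rb: "bounded_operator_on T R" and Rt: "R (tns u v) = tns (F u) (G v)"
    using R assms(7,8) by (auto simp: tensor_operator_def)
  have RT: "R \<xi> \<in> T"
    using bounded_operator_in[OF Rb \<open>\<xi> \<in> T\<close>] .
  have "cinner (R \<xi>) (R \<xi>) = cinner \<xi> (R (R \<xi>))"
    by (rule tensor_operator_projection_sym_idem(1)[OF assms(1-4) \<open>\<xi> \<in> T\<close> RT])
  also have "\<dots> = 0"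
    using tensor_operator_projection_sym_idem(2)[OF assms(1-4) \<open>\<xi> \<in> T\<close> \<open>\<xi> \<in> T\<close>] assms(6) by simp
  finally have "R \<xi> = 0"
    by (simp add: cinner_self_eq_zero)
  then show ?thesis
    using tensor_operator_projection_sym_idem(1)[OF assms(1-4) tensor_in[OF tp assms(7,8)] \<open>\<xi> \<in> T\<close>]
    by (simp add: Rt)
qed

section \<open>Tensors as antilinear operators\<close>

text \<open>The vector \<open>w\<close> is the value at \<open>u\<close> of the antilinear Hilbert--Schmidt operator that corresponds
  to \<open>\<xi>\<close>. It is stated as a relation because its existence is a theorem (\<open>slice_exists\<close>).\<close>

definition slice :: "'h::complex_hilbert_space set \<Rightarrow> ('h \<Rightarrow> 'h \<Rightarrow> 'h) \<Rightarrow> 'h \<Rightarrow> 'h \<Rightarrow> 'h \<Rightarrow> bool" where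
  "slice K tns \<xi> u w \<longleftrightarrow> w \<in> K \<and> (\<forall>v\<in>K. cinner (tns u v) \<xi> = cinner v w)"

lemma slice_unique:
  assumes "csubspace K" "slice K tns \<xi> u w" "slice K tns \<xi> u w'"
  shows "w = w'"
  using assms by (intro csubspace_eqI[OF assms(1)]) (auto simp: slice_def)

lemma slice_simple:
  assumes "tensor_product H K T tns" "csubspace K" "u \<in> H" "a \<in> H" "b \<in> K"
  shows "slice K tns (tns a b) u (cinner u a *\<^sub>C b)"
  using assms by (auto simp: slice_def tensor_cinner cinner_scaleC_right csubspace_scale)

lemma slice_zero: "csubspace K \<Longrightarrow> slice K tns 0 u 0"
  by (simp add: slice_def csubspace_0)

lemma slice_add:
  assumes "csubspace K" "slice K tns \<xi> u w" "slice K tns \<xi>' u w'"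
  shows "slice K tns (\<xi> + \<xi>') u (w + w')"
  using assms by (auto simp: slice_def cinner_add_right csubspace_add)

lemma slice_scale:
  assumes "csubspace K" "slice K tns \<xi> u w"
  shows "slice K tns (c *\<^sub>C \<xi>) u (c *\<^sub>C w)"
  using assms by (auto simp: slice_def cinner_scaleC_right csubspace_scale)

lemma slice_diff:
  assumes "csubspace K" "slice K tns \<xi> u w" "slice K tns \<xi>' u w'"
  shows "slice K tns (\<xi> - \<xi>') u (w - w')"
  using assms by (auto simp: slice_def cinner_diff_right csubspace_diff)

lemma slice_norm_le:
  assumes "tensor_product H K T tns" "u \<in> H" "slice K tns \<xi> u w"
  shows "norm w \<le> norm u * norm \<xi>"
proof -
  have w: "w \<in> K"
    using assms(3) by (simp add: slice_def)
  have "cinner w w = cinner (tns u w) \<xi>"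
    using assms(3) w by (simp add: slice_def)
  then have "(norm w)\<^sup>2 \<le> norm (tns u w) * norm \<xi>"
    by (rule norm_square_le)
  then have "norm w * norm w \<le> (norm u * norm \<xi>) * norm w"
    by (simp add: tensor_norm[OF assms(1,2) w] power2_eq_square mult.commute mult.left_commute)
  then show ?thesis
    by (cases "norm w = 0") auto
qed

text \<open>A simple tensor has an explicit slice, and by \<open>slice_norm_le\<close> the slices of a convergent sequence
  of tensors converge; so completeness of \<open>K\<close> does what the Riesz representation theorem would do.\<close>

lemma slice_exists:
  assumes tp: "tensor_product H K T tns" and K: "hilbert_subspace K" and u: "u \<in> H" and "\<xi> \<in> T"
  shows "\<exists>w. slice K tns \<xi> u w"
  using tp \<open>\<xi> \<in> T\<close>
proof (induction rule: tensor_product_induct)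
  case (tns a b)
  then show ?case
    using slice_simple[OF tp hilbert_subspace_csubspace[OF K] u] by blast
next
  case (limit f t)
  have K': "csubspace K"
    using K by (rule hilbert_subspace_csubspace)
  obtain w where w: "\<And>n. slice K tns (f n) u (w n)"
    using limit(4) by metis
  have bnd: "norm (w m - w n) \<le> norm u * norm (f m - f n)" for m n
    by (rule slice_norm_le[OF tp u slice_diff[OF K' w w]])
  have "Cauchy w"
  proof (rule metric_CauchyI)
    fix \<epsilon> :: real assume "\<epsilon> > 0"
    define \<delta> where "\<delta> = \<epsilon> / (norm u + 1)"
    have "\<delta> > 0"
      using \<open>\<epsilon> > 0\<close> by (simp add: \<delta>_def add_nonneg_pos)
    then obtain N where N: "\<And>m n. m \<ge> N \<Longrightarrow> n \<ge> N \<Longrightarrow> dist (f m) (f n) < \<delta>"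
      using LIMSEQ_imp_Cauchy[OF limit(3)] metric_CauchyD by metis
    have "dist (w m) (w n) < \<epsilon>" if "m \<ge> N" "n \<ge> N" for m n
    proof -
      have "norm (w m - w n) \<le> norm u * norm (f m - f n)"
        by (rule bnd)
      also have "\<dots> \<le> (norm u + 1) * norm (f m - f n)"
        by (intro mult_right_mono) auto
      also have "\<dots> < (norm u + 1) * \<delta>"
        using N[OF that] by (intro mult_strict_left_mono) (auto simp: dist_norm add_nonneg_pos)
      also have "\<dots> = \<epsilon>"
        by (simp add: \<delta>_def add_nonneg_eq_0_iff)
      finally show ?thesis
        by (simp add: dist_norm)
    qed
    then show "\<exists>N. \<forall>m\<ge>N. \<forall>n\<ge>N. dist (w m) (w n) < \<epsilon>"
      by blast
  qed
  then obtain l where l: "w \<longlonglongrightarrow> l"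
    using convergent_eq_Cauchy by blast
  have "l \<in> K"
    using hilbert_subspace_limit[OF K _ l] w by (simp add: slice_def)
  moreover have "cinner (tns u v) t = cinner v l" if "v \<in> K" for v
  proof (rule LIMSEQ_unique)
    show "(\<lambda>n. cinner (tns u v) (f n)) \<longlonglongrightarrow> cinner (tns u v) t"
      using limit(3) by (intro tendsto_cinner tendsto_const)
    have "(\<lambda>n. cinner v (w n)) \<longlonglongrightarrow> cinner v l"
      using l by (intro tendsto_cinner tendsto_const)
    then show "(\<lambda>n. cinner (tns u v) (f n)) \<longlonglongrightarrow> cinner v l"
      using w that by (simp add: slice_def)
  qed
  ultimately show ?case
    by (auto simp: slice_def)
qed (use hilbert_subspace_csubspace[OF K] slice_zero slice_add slice_scale in blast)+

text \<open>Simple tensors slice to rank-one operators, so every tensor slices to a norm limit of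
  operators of finite rank; this is compactness, here in the form of approximation of the image of
  the unit ball by compact sets.\<close>

lemma slice_approx_compact:
  assumes tp: "tensor_product H K T tns" and K: "hilbert_subspace K" and "\<xi> \<in> T" "\<epsilon> > 0"
  shows "\<exists>C. compact C \<and> (\<forall>u\<in>H. \<forall>w. norm u \<le> 1 \<longrightarrow> slice K tns \<xi> u w \<longrightarrow> (\<exists>z\<in>C. dist z w \<le> \<epsilon>))"
  using tp \<open>\<xi> \<in> T\<close> \<open>\<epsilon> > 0\<close>
proof (induction arbitrary: \<epsilon> rule: tensor_product_induct)
  case (tns a b)
  have K': "csubspace K"
    using K by (rule hilbert_subspace_csubspace)
  let ?C = "(\<lambda>c. c *\<^sub>C b) ` cball 0 (norm a)"
  have "compact ?C"
    by (intro compact_continuous_image continuous_on_scaleC continuous_on_id continuous_on_const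
        compact_cball)
  moreover have "w \<in> ?C" if "u \<in> H" "norm u \<le> 1" "slice K tns (tns a b) u w" for u w
  proof -
    have "w = cinner u a *\<^sub>C b"
      using slice_unique[OF K' that(3)] slice_simple[OF tp K' that(1) tns(1,2)] by blast
    moreover have "norm (cinner u a) \<le> norm a"
      using cinner_Cauchy_Schwarz[of u a] that(2) mult_right_mono[of "norm u" 1 "norm a"] by auto
    ultimately show ?thesis
      by auto
  qed
  ultimately show ?case
    using tns(3) by (intro exI[of _ ?C]) (metis dist_self less_imp_le)
next
  case zero
  have K': "csubspace K"
    using K by (rule hilbert_subspace_csubspace)
  show ?case
    using slice_unique[OF K' _ slice_zero[OF K']] zero
    by (intro exI[of _ "{0}"]) (metis compact_sing dist_self less_imp_le singletonI)
next
  case (add s t)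
  have K': "csubspace K"
    using K by (rule hilbert_subspace_csubspace)
  have e: "\<epsilon> / 2 > 0"
    using add by simp
  obtain C D where C: "compact C"
      "\<And>u w. u \<in> H \<Longrightarrow> norm u \<le> 1 \<Longrightarrow> slice K tns s u w \<Longrightarrow> \<exists>z\<in>C. dist z w \<le> \<epsilon> / 2"
    and D: "compact D"
      "\<And>u w. u \<in> H \<Longrightarrow> norm u \<le> 1 \<Longrightarrow> slice K tns t u w \<Longrightarrow> \<exists>z\<in>D. dist z w \<le> \<epsilon> / 2"
    using add.IH(1)[OF e] add.IH(2)[OF e] by metis
  have "\<exists>z\<in>{x + y | x y. x \<in> C \<and> y \<in> D}. dist z w \<le> \<epsilon>"
    if u: "u \<in> H" "norm u \<le> 1" and w: "slice K tns (s + t) u w" for u w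
  proof -
    obtain w1 w2 where w12: "slice K tns s u w1" "slice K tns t u w2"
      using slice_exists[OF tp K u(1)] add(1,2) by metis
    have "w = w1 + w2"
      using slice_unique[OF K' w slice_add[OF K' w12]] .
    moreover obtain x y where "x \<in> C" "dist x w1 \<le> \<epsilon> / 2" "y \<in> D" "dist y w2 \<le> \<epsilon> / 2"
      using C(2)[OF u w12(1)] D(2)[OF u w12(2)] by blast
    moreover from this have "dist (x + y) (w1 + w2) \<le> \<epsilon>"
      using dist_triangle_add[of x y w1 w2] by linarith
    ultimately show ?thesis
      by blast
  qed
  then show ?case
    using compact_sums[OF C(1) D(1)] by blast
next
  case (scale c t)
  have K': "csubspace K"
    using K by (rule hilbert_subspace_csubspace)
  have "\<epsilon> / (cmod c + 1) > 0"
    using scale by (simp add: add_nonneg_pos)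
  then obtain C where C: "compact C"
      "\<And>u w. u \<in> H \<Longrightarrow> norm u \<le> 1 \<Longrightarrow> slice K tns t u w \<Longrightarrow> \<exists>z\<in>C. dist z w \<le> \<epsilon> / (cmod c + 1)"
    using scale.IH by metis
  have "\<exists>z\<in>(*\<^sub>C) c ` C. dist z w \<le> \<epsilon>"
    if u: "u \<in> H" "norm u \<le> 1" and w: "slice K tns (c *\<^sub>C t) u w" for u w
  proof -
    obtain w1 where w1: "slice K tns t u w1"
      using slice_exists[OF tp K u(1)] scale(1) by metis
    have "w = c *\<^sub>C w1"
      using slice_unique[OF K' w slice_scale[OF K' w1]] .
    moreover obtain x where x: "x \<in> C" "dist x w1 \<le> \<epsilon> / (cmod c + 1)"
      using C(2)[OF u w1] by blast
    moreover have "dist (c *\<^sub>C x) (c *\<^sub>C w1) \<le> \<epsilon>"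
    proof -
      have "dist (c *\<^sub>C x) (c *\<^sub>C w1) = cmod c * dist x w1"
        by (simp add: dist_norm flip: complex_vector.scale_right_diff_distrib)
      also have "\<dots> \<le> (cmod c + 1) * (\<epsilon> / (cmod c + 1))"
        using x(2) by (intro mult_mono) auto
      also have "\<dots> = \<epsilon>"
        by (simp add: add_nonneg_eq_0_iff)
      finally show ?thesis .
    qed
    ultimately show ?thesis
      using x(1) by blast
  qed
  moreover have "compact ((*\<^sub>C) c ` C)"
    by (intro compact_continuous_image continuous_on_scaleC continuous_on_id continuous_on_const C(1))
  ultimately show ?case
    by blast
next
  case (limit f t)
  have K': "csubspace K"
    using K by (rule hilbert_subspace_csubspace)
  have e: "\<epsilon> / 2 > 0"
    using limit by simp
  obtain n where n: "dist (f n) t < \<epsilon> / 2"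
    using metric_LIMSEQ_D[OF limit(3) e] by blast
  obtain C where C: "compact C"
      "\<And>u w. u \<in> H \<Longrightarrow> norm u \<le> 1 \<Longrightarrow> slice K tns (f n) u w \<Longrightarrow> \<exists>z\<in>C. dist z w \<le> \<epsilon> / 2"
    using limit(4)[OF e] by metis
  have "\<exists>z\<in>C. dist z w \<le> \<epsilon>" if u: "u \<in> H" "norm u \<le> 1" and w: "slice K tns t u w" for u w
  proof -
    obtain w1 where w1: "slice K tns (f n) u w1"
      using slice_exists[OF tp K u(1)] limit(1) by metis
    have "norm (w1 - w) \<le> norm u * norm (f n - t)"
      using slice_norm_le[OF tp u(1) slice_diff[OF K' w1 w]] .
    also have "\<dots> \<le> 1 * (\<epsilon> / 2)"
      using n u(2) by (intro mult_mono) (auto simp: dist_norm)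
    finally have "dist w1 w \<le> \<epsilon> / 2"
      by (simp add: dist_norm)
    moreover obtain z where "z \<in> C" "dist z w1 \<le> \<epsilon> / 2"
      using C(2)[OF u w1] by blast
    moreover have "dist z w \<le> dist z w1 + dist w1 w"
      by (rule dist_triangle)
    ultimately show ?thesis
      by (intro bexI[of _ z]) linarith+
  qed
  then show ?case
    using C(1) by blast
qed

text \<open>A set within every positive distance of some compact set is totally bounded.\<close>

lemma compact_closure_if_approx_compact:
  fixes S :: "'a::complete_space set"
  assumes "\<And>\<epsilon>. \<epsilon> > 0 \<Longrightarrow> \<exists>C. compact C \<and> (\<forall>w\<in>S. \<exists>z\<in>C. dist z w \<le> \<epsilon>)"
  shows "compact (closure S)"
  unfolding compact_eq_totally_bounded
proof (intro conjI allI impI)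
  show "complete (closure S)"
    by (simp add: complete_eq_closed)
next
  fix \<epsilon> :: real assume "\<epsilon> > 0"
  then have "\<epsilon> / 4 > 0"
    by simp
  then obtain C where C: "compact C" "\<And>w. w \<in> S \<Longrightarrow> \<exists>z\<in>C. dist z w \<le> \<epsilon> / 4"
    using assms by metis
  obtain k where k: "finite k" "C \<subseteq> (\<Union>x\<in>k. ball x (\<epsilon> / 4))"
    using C(1) \<open>\<epsilon> / 4 > 0\<close> unfolding compact_eq_totally_bounded by metis
  have "S \<subseteq> (\<Union>x\<in>k. cball x (\<epsilon> / 2))"
  proof
    fix w assume "w \<in> S"
    then obtain z where z: "z \<in> C" "dist z w \<le> \<epsilon> / 4"
      using C(2) by blast
    then obtain x where x: "x \<in> k" "dist x z < \<epsilon> / 4"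
      using k(2) by auto
    have "dist x w \<le> \<epsilon> / 2"
      using dist_triangle[of x w z] x(2) z(2) by linarith
    then show "w \<in> (\<Union>x\<in>k. cball x (\<epsilon> / 2))"
      using x(1) by auto
  qed
  moreover have "closed (\<Union>x\<in>k. cball x (\<epsilon> / 2))"
    using k(1) by (intro closed_UN) auto
  ultimately have "closure S \<subseteq> (\<Union>x\<in>k. cball x (\<epsilon> / 2))"
    by (rule closure_minimal)
  also have "\<dots> \<subseteq> (\<Union>x\<in>k. ball x \<epsilon>)"
    using \<open>\<epsilon> > 0\<close> by (intro UN_mono) auto
  finally show "\<exists>k. finite k \<and> closure S \<subseteq> (\<Union>x\<in>k. ball x \<epsilon>)"
    using k(1) by blast
qed

section \<open>Pairs of mutually adjoint antilinear operators\<close>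

text \<open>In the application \<open>N\<close> and \<open>M\<close> are the slices of one vector \<open>\<xi>\<close> in the first and in the second
  tensor factor. The composites \<open>M N\<close> and \<open>N M\<close> are linear and positive: they are the reduced
  density operators of \<open>\<xi>\<close>. The assumptions are symmetric in \<open>N\<close> and \<open>M\<close> (\<open>swap\<close>), which saves
  proving the statements about \<open>N M\<close> separately.\<close>

locale antilinear_pair =
  fixes H :: "'h::complex_hilbert_space set" and N M :: "'h \<Rightarrow> 'h"
  assumes hilbert: "hilbert_subspace H"
    and N_in: "u \<in> H \<Longrightarrow> N u \<in> H" and M_in: "u \<in> H \<Longrightarrow> M u \<in> H"
    and adjoint: "u \<in> H \<Longrightarrow> v \<in> H \<Longrightarrow> cinner v (N u) = cinner u (M v)"
    and N_bounded: "\<exists>B\<ge>0. \<forall>u\<in>H. norm (N u) \<le> B * norm u"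
begin

lemma sub: "csubspace H"
  using hilbert by (rule hilbert_subspace_csubspace)

lemma N_add: "u \<in> H \<Longrightarrow> v \<in> H \<Longrightarrow> N (u + v) = N u + N v"
  by (rule csubspace_eqI[OF sub])
    (simp_all add: N_in csubspace_add[OF sub] adjoint cinner_add_left cinner_add_right)

lemma N_scale: "u \<in> H \<Longrightarrow> N (c *\<^sub>C u) = cnj c *\<^sub>C N u"
  by (rule csubspace_eqI[OF sub])
    (simp_all add: N_in csubspace_scale[OF sub] adjoint cinner_scaleC_left cinner_scaleC_right)

lemma M_bounded: "\<exists>B\<ge>0. \<forall>u\<in>H. norm (M u) \<le> B * norm u"
proof -
  obtain B where B: "B \<ge> 0" "\<And>u. u \<in> H \<Longrightarrow> norm (N u) \<le> B * norm u"
    using N_bounded by blast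
  have "norm (M u) \<le> B * norm u" if u: "u \<in> H" for u
  proof -
    have "cinner (M u) (M u) = cinner u (N (M u))"
      using adjoint[OF M_in[OF u] u] by simp
    then have "(norm (M u))\<^sup>2 \<le> norm u * norm (N (M u))"
    by (rule norm_square_le)
    also have "\<dots> \<le> norm u * (B * norm (M u))"
      by (intro mult_left_mono B(2) M_in u) auto
    finally have "norm (M u) * norm (M u) \<le> (B * norm u) * norm (M u)"
      by (simp add: power2_eq_square mult.commute mult.left_commute)
    then show ?thesis
      using B(1) by (cases "norm (M u) = 0") auto
  qed
  then show ?thesis
    using B(1) by blast
qed

lemma swap: "antilinear_pair H M N"
  using hilbert N_in M_in adjoint M_bounded by unfold_locales auto

lemma M_add: "u \<in> H \<Longrightarrow> v \<in> H \<Longrightarrow> M (u + v) = M u + M v"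
  by (rule antilinear_pair.N_add[OF swap])

lemma M_scale: "u \<in> H \<Longrightarrow> M (c *\<^sub>C u) = cnj c *\<^sub>C M u"
  by (rule antilinear_pair.N_scale[OF swap])

lemma cinner_MN: "u \<in> H \<Longrightarrow> v \<in> H \<Longrightarrow> cinner v (M (N u)) = cinner (N u) (N v)"
  by (simp add: adjoint N_in)

lemma MN_in: "u \<in> H \<Longrightarrow> M (N u) \<in> H"
  by (simp add: M_in N_in)

lemma MN_bounded_operator: "bounded_operator_on H (\<lambda>u. M (N u))"
  unfolding bounded_operator_on_def
proof (intro conjI ballI allI)
  obtain A where A: "A \<ge> 0" "\<And>u. u \<in> H \<Longrightarrow> norm (N u) \<le> A * norm u"
    using N_bounded by blast
  obtain B where B: "B \<ge> 0" "\<And>u. u \<in> H \<Longrightarrow> norm (M u) \<le> B * norm u"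
    using M_bounded by blast
  have "norm (M (N u)) \<le> (B * A) * norm u" if "u \<in> H" for u
    using order_trans[OF B(2)[OF N_in[OF that]] mult_left_mono[OF A(2)[OF that] B(1)]]
    by (simp add: mult.assoc)
  then show "\<exists>K. \<forall>u\<in>H. norm (M (N u)) \<le> K * norm u"
    by blast
qed (simp_all add: MN_in N_add N_scale M_add M_scale N_in csubspace_scale[OF sub])

text \<open>The orthogonality says that all off-diagonal blocks \<open>P j M N P i\<close> vanish; a block diagonal
  operator commutes with the blocks.\<close>

lemma MN_commutes_pvm:
  fixes P :: "'i::finite \<Rightarrow> 'h \<Rightarrow> 'h"
  assumes P: "pvm_on H P"
    and orth: "\<And>i j u v. i \<noteq> j \<Longrightarrow> u \<in> H \<Longrightarrow> v \<in> H \<Longrightarrow> cinner (N (P i u)) (N (P j v)) = 0"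
    and u: "u \<in> H"
  shows "M (N (P i u)) = P i (M (N u))"
proof -
  note proj = pvm_projection[OF P] and P_in = projection_in[OF pvm_projection[OF P]]
  have off: "P j (M (N (P i u))) = 0" if "i \<noteq> j" "u \<in> H" for i j u
  proof (rule csubspace_eqI[OF sub])
    fix w assume w: "w \<in> H"
    have "cinner w (P j (M (N (P i u)))) = cinner (P j w) (M (N (P i u)))"
      using projection_sym[OF proj w] that by (simp add: MN_in P_in)
    also have "\<dots> = 0"
      using orth[OF that(1,2) w] cinner_MN[OF P_in[OF that(2)] P_in[OF w]] by simp
    finally show "cinner w (P j (M (N (P i u)))) = cinner w 0"
      by simp
  qed (use that in \<open>simp_all add: MN_in P_in csubspace_0[OF sub]\<close>)
  have "M (N (P i u)) = (\<Sum>j\<in>UNIV. P j (M (N (P i u))))"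
    using pvm_sum[OF P] u by (simp add: MN_in P_in)
  also have "\<dots> = (\<Sum>j\<in>UNIV. if i = j then P j (M (N (P i u))) else 0)"
    by (rule sum.cong) (use off u in auto)
  also have "\<dots> = P i (M (N (P i u)))"
    by simp
  also have "\<dots> = (\<Sum>j\<in>UNIV. if i = j then P i (M (N (P j u))) else 0)"
    by simp
  also have "\<dots> = (\<Sum>j\<in>UNIV. P i (M (N (P j u))))"
    by (rule sum.cong) (use off u in auto)
  also have "\<dots> = P i (M (N (\<Sum>j\<in>UNIV. P j u)))"
    using bounded_operator_sum[OF MN_bounded_operator sub, of UNIV "\<lambda>j. P j u"]
      bounded_operator_sum[OF projection_bounded[OF proj] sub, of UNIV "\<lambda>j. M (N (P j u))"] u
    by (simp add: P_in MN_in)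
  finally show ?thesis
    using pvm_sum[OF P u] by simp
qed

text \<open>The largest eigenvalue of a nonzero compact positive operator: along a maximizing sequence
  \<open>u\<close> for \<open>norm (N u)\<close>, the vectors \<open>M (N u) - c u\<close> tend to zero, and \<open>N u\<close> accumulates by
  compactness, so that \<open>c u\<close> accumulates at an eigenvector.\<close>

lemma top_eigenvector:
  assumes compact: "compact (closure (N ` {u \<in> H. norm u \<le> 1}))"
    and nonzero: "\<exists>u\<in>H. N u \<noteq> 0"
  obtains c u where "c > (0::real)" "u \<in> H" "u \<noteq> 0" "M (N u) = complex_of_real c *\<^sub>C u"
proof -
  let ?ball = "{u \<in> H. norm u \<le> 1}"
  define S where "S = (\<lambda>u. norm (N u)) ` ?ball"
  define s where "s = Sup S"
  obtain B where B: "B \<ge> 0" "\<And>u. u \<in> H \<Longrightarrow> norm (N u) \<le> B * norm u"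
    using N_bounded by blast
  have bdd: "bdd_above S"
    unfolding S_def
  proof (rule bdd_aboveI2)
    show "norm (N u) \<le> B" if "u \<in> ?ball" for u
      using B(2)[of u] mult_left_mono[of "norm u" 1 B] B(1) that by auto
  qed
  have N_zero: "N 0 = 0"
    using N_scale[OF csubspace_0[OF sub], of 0] by simp
  have le: "norm (N u) \<le> s * norm u" if "u \<in> H" for u
  proof (cases "u = 0")
    case False
    let ?u = "complex_of_real (1 / norm u) *\<^sub>C u"
    have "?u \<in> ?ball"
      using that False by (simp add: csubspace_scale[OF sub] norm_divide)
    then have "norm (N ?u) \<in> S"
      unfolding S_def by blast
    then have "norm (N ?u) \<le> s"
      unfolding s_def using bdd by (rule cSup_upper)
    moreover have "norm (N ?u) = norm (N u) / norm u"
      using that by (simp add: N_scale norm_divide)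
    ultimately show ?thesis
      using False by (simp add: divide_le_eq)
  qed (simp add: N_zero)
  obtain u0 where "u0 \<in> H" "N u0 \<noteq> 0"
    using nonzero by blast
  then have "0 < s * norm u0"
    using le[of u0] by (meson order_less_le_trans zero_less_norm_iff)
  then have s: "s > 0"
    by (simp add: zero_less_mult_iff)
  \<comment> \<open>The number \<open>s\<close> is the operator norm of \<open>N\<close>, so \<open>s\<^sup>2\<close> is the norm of \<open>M N\<close> and the
    eigenvalue to be found.\<close>
  define c where "c = s\<^sup>2"
  have MN_le: "norm (M (N u)) \<le> c * norm u" if u: "u \<in> H" for u
  proof -
    have "cinner (M (N u)) (M (N u)) = cinner (N u) (N (M (N u)))"
      using cinner_MN[OF u MN_in[OF u]] .
    then have "(norm (M (N u)))\<^sup>2 \<le> norm (N u) * norm (N (M (N u)))"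
    by (rule norm_square_le)
    also have "\<dots> \<le> (s * norm u) * (s * norm (M (N u)))"
      using le u MN_in s by (intro mult_mono) auto
    finally have "norm (M (N u)) * norm (M (N u)) \<le> (c * norm u) * norm (M (N u))"
      by (simp add: power2_eq_square c_def mult.commute mult.left_commute)
    then show ?thesis
      by (cases "norm (M (N u)) = 0") (auto simp: c_def)
  qed
  have "\<exists>u\<in>?ball. s - 1 / real (Suc n) < norm (N u)" for n
  proof -
    have "S \<noteq> {}"
      using csubspace_0[OF sub] unfolding S_def by auto
    then have "\<exists>x\<in>S. s - 1 / real (Suc n) < x"
      using less_cSup_iff[OF _ bdd, of "s - 1 / real (Suc n)"] unfolding s_def by auto
    then show ?thesis
      unfolding S_def by blast
  qed
  then obtain u where u: "\<And>n. u n \<in> ?ball" "\<And>n. s - 1 / real (Suc n) < norm (N (u n))"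
    by metis
  have uH: "u n \<in> H" and u1: "norm (u n) \<le> 1" for n
    using u(1) by auto
  have N_le: "norm (N (u n)) \<le> s" for n
    using le[OF uH[of n]] mult_left_mono[OF u1[of n] less_imp_le[OF s]] by simp
  have norm_lim: "(\<lambda>n. norm (N (u n))) \<longlonglongrightarrow> s"
  proof (rule tendsto_sandwich)
    show "(\<lambda>n. s - 1 / real (Suc n)) \<longlonglongrightarrow> s"
      using tendsto_diff[OF tendsto_const LIMSEQ_Suc[OF lim_1_over_n], of s] by simp
    show "\<forall>\<^sub>F n in sequentially. s - 1 / real (Suc n) \<le> norm (N (u n))"
      using u(2) by (simp add: less_imp_le)
    show "\<forall>\<^sub>F n in sequentially. norm (N (u n)) \<le> s"
      using N_le by simp
  qed (rule tendsto_const)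
  obtain l r where r: "strict_mono (r :: nat \<Rightarrow> nat)" and l: "(\<lambda>n. N (u (r n))) \<longlonglongrightarrow> l"
  proof -
    have "\<forall>n. N (u n) \<in> closure (N ` ?ball)"
      using u(1) closure_subset by blast
    moreover have "seq_compact (closure (N ` ?ball))"
      using compact by (simp add: compact_eq_seq_compact_metric)
    ultimately obtain l r where "strict_mono (r :: nat \<Rightarrow> nat)" "((\<lambda>n. N (u n)) \<circ> r) \<longlonglongrightarrow> l"
      by (metis seq_compactE)
    then show ?thesis
      using that by (simp add: o_def)
  qed
  have lH: "l \<in> H"
    using hilbert_subspace_limit[OF hilbert _ l] N_in uH by blast
  define d where "d n = M (N (u n)) - complex_of_real c *\<^sub>C u n" for n
  \<comment> \<open>In the expanded square the mixed term depends only on the norm of \<open>N (u n)\<close>, which tends to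
    its supremum \<open>s\<close>; in the limit the bound vanishes.\<close>
  have d_le: "(norm (d n))\<^sup>2 \<le> 2 * c\<^sup>2 - 2 * c * (norm (N (u n)))\<^sup>2" for n
  proof -
    let ?w = "M (N (u n))" and ?v = "complex_of_real c *\<^sub>C u n"
    have "cinner (u n) ?w = complex_of_real ((norm (N (u n)))\<^sup>2)"
      using cinner_MN[OF uH uH] by (simp add: cinner_self)
    then have "inner ?v ?w = c * (norm (N (u n)))\<^sup>2"
      by (simp add: cinner_scaleC_left flip: Re_cinner of_real_power)
    moreover have "(norm (x - y))\<^sup>2 = (norm x)\<^sup>2 + (norm y)\<^sup>2 - 2 * inner y x" for x y :: 'h
      by (simp add: power2_norm_eq_inner inner_diff_left inner_diff_right inner_commute)
    ultimately have "(norm (d n))\<^sup>2 = (norm ?w)\<^sup>2 + (norm ?v)\<^sup>2 - 2 * (c * (norm (N (u n)))\<^sup>2)"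
      unfolding d_def by simp
    moreover have "norm ?w \<le> c * 1"
      using order_trans[OF MN_le[OF uH] mult_left_mono[OF u1]] by (simp add: c_def)
    then have "(norm ?w)\<^sup>2 \<le> c\<^sup>2"
      by (intro power_mono) auto
    moreover have "norm ?v \<le> c * 1"
      using mult_left_mono[OF u1[of n], of c] by (simp add: c_def norm_power)
    then have "(norm ?v)\<^sup>2 \<le> c\<^sup>2"
      by (intro power_mono) auto
    ultimately show ?thesis
      by linarith
  qed
  have "(\<lambda>n. (norm (d n))\<^sup>2) \<longlonglongrightarrow> 0"
  proof (rule tendsto_sandwich[where f = "\<lambda>_. 0"])
    have "(\<lambda>n. 2 * c\<^sup>2 - 2 * c * (norm (N (u n)))\<^sup>2) \<longlonglongrightarrow> 2 * c\<^sup>2 - 2 * c * s\<^sup>2"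
      by (intro tendsto_intros norm_lim)
    then show "(\<lambda>n. 2 * c\<^sup>2 - 2 * c * (norm (N (u n)))\<^sup>2) \<longlonglongrightarrow> 0"
      by (simp add: c_def power2_eq_square)
    show "\<forall>\<^sub>F n in sequentially. (norm (d n))\<^sup>2 \<le> 2 * c\<^sup>2 - 2 * c * (norm (N (u n)))\<^sup>2"
      using d_le by simp
  qed auto
  then have "(\<lambda>n. sqrt ((norm (d n))\<^sup>2)) \<longlonglongrightarrow> sqrt 0"
    by (rule tendsto_real_sqrt)
  then have "d \<longlonglongrightarrow> 0"
    by (simp add: tendsto_norm_zero_iff)
  then have d_lim: "(\<lambda>n. d (r n)) \<longlonglongrightarrow> 0"
    using LIMSEQ_subseq_LIMSEQ[OF _ r] by (simp add: o_def)
  obtain C where C: "\<And>u. u \<in> H \<Longrightarrow> norm (M u) \<le> C * norm u"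
    using M_bounded by blast
  have w_lim: "(\<lambda>n. M (N (u (r n)))) \<longlonglongrightarrow> M l"
  proof (rule LIM_zero_cancel, rule Lim_null_comparison)
    show "(\<lambda>n. norm (N (u (r n)) - l) * C) \<longlonglongrightarrow> 0"
      by (intro tendsto_mult_left_zero tendsto_norm_zero LIM_zero l)
    have "norm (M (N (u (r n))) - M l) \<le> norm (N (u (r n)) - l) * C" for n
    proof -
      have "M (N (u (r n))) = M (N (u (r n)) - l) + M l"
        using M_add[of "N (u (r n)) - l" l] csubspace_diff[OF sub] lH N_in uH by simp
      then show ?thesis
        using C[OF csubspace_diff[OF sub N_in[OF uH] lH]] by (simp add: mult.commute)
    qed
    then show "\<forall>\<^sub>F n in sequentially. norm (M (N (u (r n))) - M l) \<le> norm (N (u (r n)) - l) * C"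
      by simp
  qed
  have cu_lim: "(\<lambda>n. complex_of_real c *\<^sub>C u (r n)) \<longlonglongrightarrow> M l"
    using tendsto_diff[OF w_lim d_lim] by (simp add: d_def)
  have "(\<lambda>n. M (N (complex_of_real c *\<^sub>C u (r n)))) \<longlonglongrightarrow> M (N (M l))"
    by (rule bounded_operator_tendsto[OF MN_bounded_operator sub _ M_in[OF lH] cu_lim])
      (rule csubspace_scale[OF sub uH])
  moreover have "(\<lambda>n. M (N (complex_of_real c *\<^sub>C u (r n)))) \<longlonglongrightarrow> complex_of_real c *\<^sub>C M l"
  proof -
    have "M (N (complex_of_real c *\<^sub>C u (r n))) = complex_of_real c *\<^sub>C M (N (u (r n)))" for n
      by (rule bounded_operator_scale[OF MN_bounded_operator uH])
    then show ?thesis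
      using tendsto_scaleC[OF tendsto_const w_lim] by simp
  qed
  ultimately have "M (N (M l)) = complex_of_real c *\<^sub>C M l"
    by (rule LIMSEQ_unique)
  moreover have "M l \<noteq> 0"
  proof
    assume "M l = 0"
    then have "cinner l (N (u (r n))) = 0" for n
      using adjoint[OF uH lH] by simp
    moreover have "(\<lambda>n. cinner l (N (u (r n)))) \<longlonglongrightarrow> cinner l l"
      by (intro tendsto_cinner tendsto_const l)
    ultimately have "cinner l l = 0"
      by (simp add: LIMSEQ_const_iff)
    moreover have "norm l = s"
      using LIMSEQ_unique[OF tendsto_norm[OF l]] LIMSEQ_subseq_LIMSEQ[OF norm_lim r]
      by (simp add: o_def)
    ultimately show False
      using s by (simp add: cinner_self)
  qed
  ultimately show ?thesis
    using that[of c "M l"] M_in[OF lH] s by (simp add: c_def)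
qed

lemma eigenspace_csubspace: "csubspace {u \<in> H. M (N u) = c *\<^sub>C u}"
  unfolding complex_vector.subspace_def
  by (auto simp: csubspace_0[OF sub] csubspace_add[OF sub] csubspace_scale[OF sub]
      bounded_operator_zero[OF MN_bounded_operator sub] bounded_operator_add[OF MN_bounded_operator]
      bounded_operator_scale[OF MN_bounded_operator] scaleC_add_right scaleC_scaleC mult.commute)

text \<open>On an eigenspace \<open>norm (N u)\<^sup>2\<close> is a constant multiple of \<open>norm u\<^sup>2\<close>, so a Hilbert--Schmidt bound
  limits the number of orthonormal vectors there.\<close>

lemma eigenspace_finite_dimensional:
  assumes hs: "\<And>n e. orthonormal n e \<Longrightarrow> (\<And>i. i < n \<Longrightarrow> e i \<in> H) \<Longrightarrow> (\<Sum>i<n. (norm (N (e i)))\<^sup>2) \<le> B"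
    and "c > 0"
  shows "finite_dimensional {u \<in> H. M (N u) = complex_of_real c *\<^sub>C u}"
proof -
  let ?K = "{u \<in> H. M (N u) = complex_of_real c *\<^sub>C u}"
  show ?thesis
    using eigenspace_csubspace[of "complex_of_real c"]
  proof (cases rule: orthonormal_basis_or_sequences)
    case (1 d e)
    then show ?thesis
      unfolding finite_dimensional_def by (intro exI[of _ "e ` {..<d}"]) auto
  next
    case 2
    \<comment> \<open>Each of \<open>n\<close> orthonormal eigenvectors contributes \<open>c\<close> to a sum bounded by \<open>B\<close>.\<close>
    define n where "n = Suc (nat \<lceil>B / c\<rceil>)"
    obtain e where e: "orthonormal n e" "\<And>i. i < n \<Longrightarrow> e i \<in> ?K"
      using 2 by metis
    have "(norm (N (e i)))\<^sup>2 = c" if "i < n" for i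
    proof -
      have i: "e i \<in> H" "M (N (e i)) = complex_of_real c *\<^sub>C e i" "cinner (e i) (e i) = 1"
        using e that by (auto simp: orthonormal_def)
      then have "complex_of_real ((norm (N (e i)))\<^sup>2) = complex_of_real c"
        using cinner_MN[OF i(1) i(1)] by (simp add: cinner_self cinner_scaleC_right)
      then show ?thesis
        using of_real_eq_iff by blast
    qed
    then have "real n * c \<le> B"
      using hs[OF e(1)] e(2) by auto
    moreover have "B / c < real n"
      unfolding n_def by linarith
    ultimately show ?thesis
      using \<open>c > 0\<close> by (simp add: divide_less_eq)
  qed
qed

end

section \<open>From spatial strategies to finite-dimensional models\<close>

text \<open>The common finite-dimensional core of strategies and representations: unlike in a strategy, both
  families of measures act on the same space and are multiplied there.\<close>

definition finite_dimensional_model ::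
  "('x, 'y, 'a::finite, 'b::finite) game \<Rightarrow> 'h::complex_hilbert_space set \<Rightarrow>
    ('x \<Rightarrow> 'a \<Rightarrow> 'h \<Rightarrow> 'h) \<Rightarrow> ('y \<Rightarrow> 'b \<Rightarrow> 'h \<Rightarrow> 'h) \<Rightarrow> bool" where
  "finite_dimensional_model lam H p q \<longleftrightarrow>
     finite_dimensional H \<and> H \<noteq> {0} \<and> (\<forall>x. pvm_on H (p x)) \<and> (\<forall>y. pvm_on H (q y)) \<and>
     (\<forall>x y a b. \<not> lam x y a b \<longrightarrow> (\<forall>u\<in>H. p x a (q y b u) = 0))"

lemma pvm_orthogonal:
  assumes Q: "pvm_on H Q" and z: "z \<in> H" and w: "w \<in> H"
    and zero: "\<And>b. Q b z = 0 \<or> Q b w = 0"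
  shows "cinner z w = 0"
proof -
  have "cinner (Q b z) w = 0" for b
    using zero[of b] projection_sym[OF pvm_projection[OF Q] z w, of b] by auto
  then have "cinner (\<Sum>b\<in>UNIV. Q b z) w = 0"
    by (simp add: cinner_sum_left)
  then show ?thesis
    using pvm_sum[OF Q z] by simp
qed

text \<open>The question that separates two answers \<open>a\<close> and \<open>a'\<close> makes \<open>N (P x a u)\<close> and \<open>N (P x a' v)\<close>
  have no common component under \<open>Q y\<close>, so \<open>M N\<close> commutes with the \<open>P x a\<close>, which therefore preserve
  its eigenspaces. On the eigenspace for \<open>c\<close>, the operator \<open>N\<close> divided by the square root of \<open>c\<close> is
  an antiunitary map onto the eigenspace of \<open>N M\<close> for \<open>c\<close>, with inverse \<open>M\<close> divided by the same
  root. So \<open>M Q N / c\<close> is the conjugate of \<open>Q\<close> by an antiunitary map, which makes it a measure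
  again, and \<open>P M Q = 0\<close> becomes the product relation of the model.\<close>

lemma (in antilinear_pair) eigenspace_model:
  fixes lam :: "('x::finite, 'y::finite, 'a::finite, 'b::finite) game"
  assumes lam: "imitation_game lam"
    and P: "\<And>x. pvm_on H (P x)" and Q: "\<And>y. pvm_on H (Q y)"
    and QNP: "\<And>x y a b u. \<not> lam x y a b \<Longrightarrow> u \<in> H \<Longrightarrow> Q y b (N (P x a u)) = 0"
    and PMQ: "\<And>x y a b u. \<not> lam x y a b \<Longrightarrow> u \<in> H \<Longrightarrow> P x a (M (Q y b u)) = 0"
    and c: "c > 0"
    and fd: "finite_dimensional {u \<in> H. M (N u) = complex_of_real c *\<^sub>C u}"
    and nz: "{u \<in> H. M (N u) = complex_of_real c *\<^sub>C u} \<noteq> {0}"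
  shows "finite_dimensional_model lam {u \<in> H. M (N u) = complex_of_real c *\<^sub>C u} P
    (\<lambda>y b u. complex_of_real (1 / c) *\<^sub>C M (Q y b (N u)))"
proof -
  interpret sw: antilinear_pair H M N
    by (rule swap)
  let ?K = "{u \<in> H. M (N u) = complex_of_real c *\<^sub>C u}"
  let ?q = "\<lambda>y b u. complex_of_real (1 / c) *\<^sub>C M (Q y b (N u))"
  note P_in = projection_in[OF pvm_projection[OF P]] and Q_in = projection_in[OF pvm_projection[OF Q]]
  note P_bd = projection_bounded[OF pvm_projection[OF P]]
    and Q_bd = projection_bounded[OF pvm_projection[OF Q]]
  have commP: "M (N (P x a u)) = P x a (M (N u))" if u: "u \<in> H" for x a u
  proof (rule MN_commutes_pvm[OF P _ u])
    fix a a' :: 'a and u v assume "a \<noteq> a'" and uv: "u \<in> H" "v \<in> H"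
    then obtain y where "\<And>b. \<not> lam x y a b \<or> \<not> lam x y a' b"
      using lam unfolding imitation_game_def by (fastforce simp: sum_eq_0_iff)
    then show "cinner (N (P x a u)) (N (P x a' v)) = 0"
      using uv QNP by (intro pvm_orthogonal[OF Q[of y]] N_in P_in) blast+
  qed
  have commQ: "N (M (Q y b u)) = Q y b (N (M u))" if u: "u \<in> H" for y b u
  proof (rule sw.MN_commutes_pvm[OF Q _ u])
    fix b b' :: 'b and u v assume "b \<noteq> b'" and uv: "u \<in> H" "v \<in> H"
    then obtain x where "\<And>a. \<not> lam x y a b \<or> \<not> lam x y a b'"
      using lam unfolding imitation_game_def by (fastforce simp: sum_eq_0_iff)
    then show "cinner (M (Q y b u)) (M (Q y b' v)) = 0"
      using uv PMQ by (intro pvm_orthogonal[OF P[of x]] M_in Q_in) blast+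
  qed
  have subK: "csubspace ?K"
    by (rule eigenspace_csubspace)
  have projP: "projection_on ?K (P x a)" for x a
  proof (rule projection_onI)
    fix u assume u: "u \<in> ?K"
    then show "P x a u \<in> ?K"
      by (simp add: P_in commP bounded_operator_scale[OF P_bd])
  qed (simp_all add: bounded_operator_add[OF P_bd] bounded_operator_scale[OF P_bd]
      projection_idem[OF pvm_projection[OF P]] projection_sym[OF pvm_projection[OF P]])
  have MQN: "M (Q y b (N u)) \<in> H" if "u \<in> H" for y b u
    using that by (intro M_in Q_in N_in)
  have rhoMQN: "M (N (M (Q y b (N u)))) = complex_of_real c *\<^sub>C M (Q y b (N u))" if "u \<in> ?K" for y b u
    using that by (simp add: commQ N_in N_scale M_scale bounded_operator_scale[OF Q_bd] Q_in)
  have projQ: "projection_on ?K (?q y b)" for y b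
  proof (rule projection_onI)
    fix u assume u: "u \<in> ?K"
    then show "?q y b u \<in> ?K"
      by (simp add: MQN csubspace_scale[OF sub] bounded_operator_scale[OF MN_bounded_operator]
          rhoMQN[OF u] scaleC_scaleC mult.commute)
    have "N (M (Q y b (N u))) = complex_of_real c *\<^sub>C Q y b (N u)"
      using u by (simp add: commQ N_in N_scale bounded_operator_scale[OF Q_bd])
    then have "M (Q y b (N (M (Q y b (N u))))) = complex_of_real c *\<^sub>C M (Q y b (N u))"
      using u by (simp add: M_scale bounded_operator_scale[OF Q_bd] Q_in N_in
          projection_idem[OF pvm_projection[OF Q]])
    then show "?q y b (?q y b u) = ?q y b u"
      using u c by (simp add: N_scale M_scale bounded_operator_scale[OF Q_bd] Q_in N_in MQN
          scaleC_scaleC)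
  next
    fix u v assume "u \<in> ?K" "v \<in> ?K"
    then have uv: "u \<in> H" "v \<in> H"
      by auto
    show "?q y b (u + v) = ?q y b u + ?q y b v"
      using uv by (simp add: N_add M_add N_in Q_in bounded_operator_add[OF Q_bd] scaleC_add_right)
    have "cinner (M (Q y b (N u))) v = cnj (cinner v (M (Q y b (N u))))"
      by (rule cinner_commute)
    also have "\<dots> = cnj (cinner (Q y b (N u)) (N v))"
      using adjoint[OF uv(2) Q_in[OF N_in[OF uv(1)]]] by simp
    also have "\<dots> = cinner (N v) (Q y b (N u))"
      by (rule cinner_commute[symmetric])
    also have "\<dots> = cinner (Q y b (N v)) (N u)"
      using projection_sym[OF pvm_projection[OF Q] N_in[OF uv(2)] N_in[OF uv(1)]] by simp
    also have "\<dots> = cinner u (M (Q y b (N v)))"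
      by (rule adjoint[OF uv(1) Q_in[OF N_in[OF uv(2)]]])
    finally show "cinner (?q y b u) v = cinner u (?q y b v)"
      by (simp add: cinner_scaleC_left cinner_scaleC_right)
  next
    fix k u assume "u \<in> ?K"
    then show "?q y b (k *\<^sub>C u) = k *\<^sub>C ?q y b u"
      by (simp add: N_scale M_scale bounded_operator_scale[OF Q_bd] Q_in N_in scaleC_scaleC mult.commute)
  qed
  have sumQ: "(\<Sum>b\<in>UNIV. ?q y b u) = u" if u: "u \<in> ?K" for y u
  proof -
    have uH: "u \<in> H"
      using u by simp
    have "(\<Sum>b\<in>F. M (Q y b (N u))) = M (\<Sum>b\<in>F. Q y b (N u))" if "finite F" for F
      using that
    proof (induction F)
      case empty
      show ?case
        using M_scale[OF csubspace_0[OF sub], of 0] by simp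
    next
      case (insert b F)
      then show ?case
        using uH by (simp add: M_add Q_in N_in csubspace_sum[OF sub])
    qed
    then have "(\<Sum>b\<in>UNIV. M (Q y b (N u))) = M (N u)"
      using pvm_sum[OF Q N_in[OF uH]] by simp
    then show ?thesis
      using u c by (simp add: scaleC_scaleC scaleC_one flip: complex_vector.scale_sum_right)
  qed
  have "P x a (?q y b u) = 0" if "\<not> lam x y a b" "u \<in> ?K" for x y a b u
    using that PMQ[OF that(1), of "N u"] by (simp add: bounded_operator_scale[OF P_bd] MQN N_in)
  then show ?thesis
    unfolding finite_dimensional_model_def
    using fd nz projP projQ sumQ pvm_sum[OF P] by (simp add: pvm_on_def)
qed

text \<open>The slices of \<open>\<xi>\<close> form an antilinear pair to which the preceding results apply. Compactness of
  \<open>N\<close> comes from approximating \<open>\<xi>\<close> by finite sums of simple tensors; the Hilbert--Schmidt bound is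
  the square norm of \<open>\<xi>\<close>.\<close>

theorem model_of_spatial_strategy:
  fixes lam :: "('x::finite, 'y::finite, 'a::finite, 'b::finite) game"
  assumes lam: "imitation_game lam"
    and p: "p \<in> C_qs TYPE('h::complex_hilbert_space)" "perfect_strategy lam p"
  shows "\<exists>(K :: 'h set) p q. finite_dimensional_model lam K p q"
proof -
  obtain H :: "'h set" and T tns \<xi> P Q where real: "realizes H T tns \<xi> P Q p"
    using p(1) by (auto simp: C_qs_def)
  then have H: "hilbert_subspace H" and tp: "tensor_product H H T tns" and \<xi>: "\<xi> \<in> T" "norm \<xi> = 1"
    and P: "\<And>x. pvm_on H (P x)" and Q: "\<And>y. pvm_on H (Q y)"
    by (auto simp: realizes_def)
  have H': "csubspace H"
    using H by (rule hilbert_subspace_csubspace)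
  have tp': "tensor_product H H T (\<lambda>u v. tns v u)"
    using tensor_product_swap[OF tp] .
  obtain N where N: "\<And>u. u \<in> H \<Longrightarrow> slice H tns \<xi> u (N u)"
    using slice_exists[OF tp H _ \<xi>(1)] by metis
  obtain M where M: "\<And>u. u \<in> H \<Longrightarrow> slice H (\<lambda>u v. tns v u) \<xi> u (M u)"
    using slice_exists[OF tp' H _ \<xi>(1)] by metis
  have N': "cinner v (N u) = cinner (tns u v) \<xi>" if "u \<in> H" "v \<in> H" for u v
    using N that by (simp add: slice_def)
  have M': "cinner u (M v) = cinner (tns u v) \<xi>" if "u \<in> H" "v \<in> H" for u v
    using M that by (simp add: slice_def)
  have N_le: "norm (N u) \<le> 1 * norm u" if "u \<in> H" for u
    using slice_norm_le[OF tp that N[OF that]] \<xi>(2) by simp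
  interpret antilinear_pair H N M
  proof
    show "\<exists>B\<ge>0. \<forall>u\<in>H. norm (N u) \<le> B * norm u"
      using N_le by (intro exI[of _ 1]) auto
  qed (use H N M N' M' in \<open>auto simp: slice_def\<close>)
  have zero: "cinner (tns (P x a u) (Q y b v)) \<xi> = 0" if "\<not> lam x y a b" "u \<in> H" "v \<in> H" for x y a b u v
  proof -
    obtain R where "tensor_operator H H T tns (P x a) (Q y b) R"
      "complex_of_real (p a b x y) = cinner \<xi> (R \<xi>)"
      using real unfolding realizes_def by blast
    then show ?thesis
      using tensor_operator_zero_expectation[OF tp pvm_projection[OF P] pvm_projection[OF Q] _ \<xi>(1) _ that(2,3)]
        p(2) that(1) by (simp add: perfect_strategy_def)
  qed
  note P_in = projection_in[OF pvm_projection[OF P]] and Q_in = projection_in[OF pvm_projection[OF Q]]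
  have QNP: "Q y b (N (P x a u)) = 0" if "\<not> lam x y a b" "u \<in> H" for x y a b u
  proof (rule csubspace_eqI[OF H'])
    fix w assume w: "w \<in> H"
    have "cinner w (Q y b (N (P x a u))) = cinner (Q y b w) (N (P x a u))"
      using projection_sym[OF pvm_projection[OF Q] w N_in[OF P_in[OF that(2)]]] by simp
    also have "\<dots> = 0"
      using zero[OF that w] by (simp add: N' P_in Q_in w that(2))
    finally show "cinner w (Q y b (N (P x a u))) = cinner w 0"
      by simp
  qed (use that in \<open>auto simp: P_in Q_in N_in csubspace_0[OF H']\<close>)
  have PMQ: "P x a (M (Q y b v)) = 0" if "\<not> lam x y a b" "v \<in> H" for x y a b v
  proof (rule csubspace_eqI[OF H'])
    fix w assume w: "w \<in> H"
    have "cinner w (P x a (M (Q y b v))) = cinner (P x a w) (M (Q y b v))"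
      using projection_sym[OF pvm_projection[OF P] w M_in[OF Q_in[OF that(2)]]] by simp
    also have "\<dots> = 0"
      using zero[OF that(1) w that(2)] by (simp add: M' P_in Q_in w that(2))
    finally show "cinner w (P x a (M (Q y b v))) = cinner w 0"
      by simp
  qed (use that in \<open>auto simp: P_in Q_in M_in csubspace_0[OF H']\<close>)
  have nonzero: "\<exists>u\<in>H. N u \<noteq> 0"
  proof (rule ccontr)
    assume "\<not> (\<exists>u\<in>H. N u \<noteq> 0)"
    then have *: "cinner (tns u v) \<xi> = 0" if "u \<in> H" "v \<in> H" for u v
      using N'[OF that] that by simp
    have "cinner t \<xi> = 0" if "t \<in> T" for t
      using tp that
    proof (induction rule: tensor_product_induct)
      case (limit f t)
      have "(\<lambda>n. cinner (f n) \<xi>) \<longlonglongrightarrow> cinner t \<xi>"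
        using limit(3) by (intro tendsto_cinner tendsto_const)
      then show ?case
        using limit(4) by (simp add: LIMSEQ_const_iff)
    qed (simp_all add: * cinner_add_left cinner_scaleC_left)
    then show False
      using \<xi> by (force simp: cinner_self)
  qed
  have compact: "compact (closure (N ` {u \<in> H. norm u \<le> 1}))"
  proof (rule compact_closure_if_approx_compact)
    fix \<epsilon> :: real assume "\<epsilon> > 0"
    then obtain C where "compact C"
      "\<And>u w. u \<in> H \<Longrightarrow> norm u \<le> 1 \<Longrightarrow> slice H tns \<xi> u w \<Longrightarrow> \<exists>z\<in>C. dist z w \<le> \<epsilon>"
      using slice_approx_compact[OF tp H \<xi>(1)] by metis
    then show "\<exists>C. compact C \<and> (\<forall>w\<in>N ` {u \<in> H. norm u \<le> 1}. \<exists>z\<in>C. dist z w \<le> \<epsilon>)"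
      using N by (intro exI[of _ C]) auto
  qed
  have hs: "(\<Sum>i<n. (norm (N (e i)))\<^sup>2) \<le> 1" if e: "orthonormal n e" "\<And>i. i < n \<Longrightarrow> e i \<in> H" for n e
  proof -
    \<comment> \<open>The sum is both the square norm of \<open>t\<close> and its inner product with \<open>\<xi>\<close>.\<close>
    define t where "t = (\<Sum>i<n. tns (e i) (N (e i)))"
    define S where "S = (\<Sum>i<n. (norm (N (e i)))\<^sup>2)"
    have "S \<ge> 0"
      unfolding S_def by (intro sum_nonneg) auto
    have "cinner t \<xi> = (\<Sum>i<n. complex_of_real ((norm (N (e i)))\<^sup>2))"
      unfolding t_def cinner_sum_left
      by (rule sum.cong) (use e(2) in \<open>auto simp: N_in cinner_self simp flip: N'\<close>)
    then have t\<xi>: "cinner t \<xi> = complex_of_real S"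
      by (simp add: S_def)
    have "cinner t t = (\<Sum>i<n. \<Sum>j<n. if i = j then complex_of_real ((norm (N (e i)))\<^sup>2) else 0)"
      unfolding t_def cinner_sum_left cinner_sum_right
      by (intro sum.cong) (use e in \<open>auto simp: tensor_cinner[OF tp] N_in orthonormal_def cinner_self\<close>)
    then have "complex_of_real ((norm t)\<^sup>2) = complex_of_real S"
      by (simp add: S_def cinner_self)
    then have tt: "(norm t)\<^sup>2 = S"
      using of_real_eq_iff by blast
    have "S \<le> norm t"
      using cinner_Cauchy_Schwarz[of t \<xi>] \<open>S \<ge> 0\<close> by (simp add: t\<xi> \<xi>(2))
    then have "norm t * norm t \<le> norm t * 1"
      using tt by (simp add: power2_eq_square)
    then have "norm t \<le> 1"
      by (cases "norm t = 0") auto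
    then show ?thesis
      using \<open>S \<le> norm t\<close> by (simp add: S_def)
  qed
  obtain c u where c: "c > 0" and u: "u \<in> H" "u \<noteq> 0" "M (N u) = complex_of_real c *\<^sub>C u"
    using top_eigenvector[OF compact nonzero] by blast
  let ?K = "{u \<in> H. M (N u) = complex_of_real c *\<^sub>C u}"
  have "finite_dimensional ?K"
    by (rule eigenspace_finite_dimensional[OF hs c])
  moreover have "?K \<noteq> {0}"
    using u by blast
  ultimately show ?thesis
    using eigenspace_model[of lam P Q c] lam P Q QNP PMQ c by blast
qed

section \<open>The free *-algebra and its C*-seminorms\<close>

lemma poly_mapping_sum_single: "f = (\<Sum>k\<in>Poly_Mapping.keys f. Poly_Mapping.single k (Poly_Mapping.lookup f k))"
  by (rule poly_mapping_eqI)
    (auto simp: lookup_sum lookup_single when_def in_keys_iff)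

lemma free_alg_induct [case_names single add]:
  assumes "\<And>w c. Pr (Poly_Mapping.single w c)" "\<And>f g. Pr f \<Longrightarrow> Pr g \<Longrightarrow> Pr (f + g)"
  shows "Pr (f :: 'g free_alg)"
proof -
  have "Pr (\<Sum>k\<in>F. Poly_Mapping.single k (Poly_Mapping.lookup f k))" if "finite F" for F
    using that
  proof (induction F)
    case empty
    show ?case using assms(1)[of 0 0] by simp
  qed (simp add: assms)
  then show ?thesis
    by (subst poly_mapping_sum_single) simp
qed

lemma rev_word_rev_word [simp]: "rev_word (rev_word w) = w"
  by (simp add: rev_word_def)

lemma free_star_star [simp]: "free_star (free_star f) = f"
  by (rule poly_mapping_eqI) (simp add: lookup_free_star)

lemma free_star_add: "free_star (f + g) = free_star f + free_star g"
  by (rule poly_mapping_eqI) (simp add: lookup_free_star lookup_add)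

lemma free_star_diff: "free_star (f - g) = free_star f - free_star g"
  by (rule poly_mapping_eqI) (simp add: lookup_free_star lookup_minus)

lemma free_star_single: "free_star (Poly_Mapping.single w c) = Poly_Mapping.single (rev_word w) (cnj c)"
  by (rule poly_mapping_eqI) (auto simp: lookup_free_star lookup_single when_def)

lemma free_star_gen [simp]: "free_star (gen g) = gen g"
  by (simp add: gen_def free_star_single rev_word_def)

lemma rev_word_zero [simp]: "rev_word 0 = 0"
  by (simp add: rev_word_def zero_gen_word_def)

lemma free_star_one [simp]: "free_star 1 = 1"
  using free_star_single[of 0 1] by simp

lemma free_smult_minus_one: "free_smult (-1) f = - f"
  by (rule poly_mapping_eqI) (simp add: lookup_free_smult)

lemma free_smult_zero: "free_smult 0 f = 0"
  by (simp add: free_smult_def)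

lemma free_smult_diff: "free_smult c (f - g) = free_smult c f - free_smult c g"
  by (simp add: free_smult_def right_diff_distrib)

lemma single_Cons: "Poly_Mapping.single (GenWord (g # ls)) 1 = gen g * Poly_Mapping.single (GenWord ls) 1"
  by (simp add: gen_def mult_single plus_gen_word_def)

lemma cstar_seminormD:
  assumes "cstar_seminorm s"
  shows cstar_add: "s (f + g) \<le> s f + s g"
    and cstar_smult: "s (free_smult c f) = cmod c * s f"
    and cstar_mult: "s (f * g) \<le> s f * s g"
    and cstar_star_mult: "s (free_star f * f) = (s f)\<^sup>2"
  using assms by (auto simp: cstar_seminorm_def)

lemma cstar_zero: "cstar_seminorm s \<Longrightarrow> s 0 = 0"
  using cstar_smult[of s 0 0] by (simp add: free_smult_zero)

lemma cstar_minus: "cstar_seminorm s \<Longrightarrow> s (- f) = s f"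
  using cstar_smult[of s "-1" f] by (simp add: free_smult_minus_one)

lemma cstar_nonneg: "cstar_seminorm s \<Longrightarrow> s f \<ge> 0"
  using cstar_add[of s f "- f"] by (simp add: cstar_zero cstar_minus)

lemma cstar_star_le: "cstar_seminorm s \<Longrightarrow> s f \<le> s (free_star f)"
  using cstar_star_mult[of s f] cstar_mult[of s "free_star f" f] cstar_nonneg[of s f]
    cstar_nonneg[of s "free_star f"]
  by (cases "s f = 0") (auto simp: power2_eq_square)

lemma cstar_star: "cstar_seminorm s \<Longrightarrow> s (free_star f) = s f"
  using cstar_star_le[of s f] cstar_star_le[of s "free_star f"] by simp

text \<open>By the C*-identity \<open>s f\<close> is a root of \<open>t\<^sup>2 = t\<close>.\<close>

lemma cstar_projection_le_1:
  assumes s: "cstar_seminorm s" and "free_star f = f" "s (f * f - f) = 0"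
  shows "s f \<le> 1"
proof -
  have "s f = s (f * f + - (f * f - f))"
    by simp
  also have "\<dots> \<le> s (f * f) + s (- (f * f - f))"
    by (rule cstar_add[OF s])
  finally have "s f \<le> s (f * f)"
    using assms(3) by (simp only: cstar_minus[OF s])
  moreover have "s (f * f) = s ((f * f - f) + f)"
    by simp
  then have "s (f * f) \<le> s f"
    using cstar_add[OF s, of "f * f - f" f] assms(3) by simp
  moreover have "s (f * f) = (s f)\<^sup>2"
    using cstar_star_mult[OF s, of f] assms(2) by simp
  ultimately have "s f * s f = s f * 1"
    by (simp add: power2_eq_square)
  then show ?thesis
    by (simp only: mult_cancel_left) auto
qed

lemma cstar_one_le_1: "cstar_seminorm s \<Longrightarrow> s 1 \<le> 1"
  using cstar_projection_le_1[of s 1] by (simp add: cstar_zero)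

text \<open>This bound does not depend on \<open>s\<close>, and so makes the supremum in the universal seminorm finite.\<close>

lemma cstar_le_sum_coefficients:
  assumes s: "cstar_seminorm s" and gen: "\<And>g. s (gen g) \<le> 1"
  shows "s f \<le> (\<Sum>k\<in>Poly_Mapping.keys f. cmod (Poly_Mapping.lookup f k))"
proof -
  have word: "s (Poly_Mapping.single (GenWord ls) 1) \<le> 1" for ls
  proof (induction ls)
    case Nil
    have "Poly_Mapping.single (GenWord []) 1 = (1 :: 'a free_alg)"
      by (simp flip: zero_gen_word_def)
    then show ?case
      using cstar_one_le_1[OF s] by simp
  next
    case (Cons g ls)
    have "s (gen g * Poly_Mapping.single (GenWord ls) 1) \<le> s (gen g) * s (Poly_Mapping.single (GenWord ls) 1)"
      by (rule cstar_mult[OF s])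
    also have "\<dots> \<le> 1 * 1"
      using gen Cons cstar_nonneg[OF s] by (intro mult_mono) auto
    finally show ?case
      by (simp add: single_Cons)
  qed
  have single: "s (Poly_Mapping.single w c) \<le> cmod c" for w c
  proof -
    have "Poly_Mapping.single w c = free_smult c (Poly_Mapping.single (GenWord (letters w)) 1)"
      by (simp add: free_smult_def mult_single)
    then show ?thesis
      using cstar_smult[OF s] mult_left_mono[OF word[of "letters w"], of "cmod c"] by simp
  qed
  have "s (\<Sum>k\<in>F. Poly_Mapping.single k (Poly_Mapping.lookup f k))
      \<le> (\<Sum>k\<in>F. cmod (Poly_Mapping.lookup f k))" if "finite F" for F
    using that
  proof (induction F)
    case empty
    show ?case by (simp add: cstar_zero[OF s])
  next
    case (insert k F)
    then show ?case
      using cstar_add[OF s, of "Poly_Mapping.single k (Poly_Mapping.lookup f k)"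
          "\<Sum>k\<in>F. Poly_Mapping.single k (Poly_Mapping.lookup f k)"]
        single[of k "Poly_Mapping.lookup f k"] by simp
  qed
  from this[OF finite_keys[of f]] show ?thesis
    using poly_mapping_sum_single[of f] by simp
qed

section \<open>The universal C*-algebra as a completion\<close>

text \<open>The supremum that defines the universal seminorm is that of a set of reals, and so has its
  intended meaning only under this boundedness condition.\<close>

locale bounded_relations =
  fixes Rel :: "'g free_alg set"
  assumes bounded: "\<And>f. bdd_above ((\<lambda>s. s f) ` {s. cstar_seminorm s \<and> (\<forall>r\<in>Rel. s r = 0)})"

lemma bounded_relations_if_projections:
  assumes "\<And>g. gen g * gen g - gen g \<in> Rel"
  shows "bounded_relations Rel"
proof
  fix f :: "'a free_alg"
  show "bdd_above ((\<lambda>s. s f) ` {s. cstar_seminorm s \<and> (\<forall>r\<in>Rel. s r = 0)})"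
  proof (rule bdd_aboveI2)
    fix s :: "'a free_alg \<Rightarrow> real"
    assume "s \<in> {s. cstar_seminorm s \<and> (\<forall>r\<in>Rel. s r = 0)}"
    then show "s f \<le> (\<Sum>k\<in>Poly_Mapping.keys f. cmod (Poly_Mapping.lookup f k))"
      using assms by (intro cstar_le_sum_coefficients cstar_projection_le_1) auto
  qed
qed

context bounded_relations
begin

abbreviation U :: "'g free_alg \<Rightarrow> real" where "U \<equiv> univ_seminorm Rel"

lemma U_upper: "cstar_seminorm s \<Longrightarrow> (\<And>r. r \<in> Rel \<Longrightarrow> s r = 0) \<Longrightarrow> s f \<le> U f"
  unfolding univ_seminorm_def by (rule cSUP_upper[OF _ bounded]) auto

lemma cstar_seminorm_zero: "cstar_seminorm (\<lambda>_. 0)"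
  by (simp add: cstar_seminorm_def)

lemma U_least:
  assumes "\<And>s. cstar_seminorm s \<Longrightarrow> (\<And>r. r \<in> Rel \<Longrightarrow> s r = 0) \<Longrightarrow> s f \<le> c"
  shows "U f \<le> c"
  unfolding univ_seminorm_def
proof (rule cSUP_least)
  show "{s. cstar_seminorm s \<and> (\<forall>r\<in>Rel. s r = 0)} \<noteq> {}"
    using cstar_seminorm_zero by fastforce
qed (use assms in auto)

lemma U_nonneg: "U f \<ge> 0"
  using U_upper[OF cstar_seminorm_zero] by simp

lemma U_add: "U (f + g) \<le> U f + U g"
  by (rule U_least) (meson U_upper add_mono cstar_add order_trans)

lemma U_mult: "U (f * g) \<le> U f * U g"
proof (rule U_least)
  fix s assume s: "cstar_seminorm s" "\<And>r. r \<in> Rel \<Longrightarrow> s r = 0"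
  have "s f * s g \<le> U f * U g"
    using U_upper[OF s] cstar_nonneg[OF s(1)] U_nonneg by (intro mult_mono) auto
  then show "s (f * g) \<le> U f * U g"
    using cstar_mult[OF s(1), of f g] by linarith
qed

lemma U_smult: "U (free_smult c f) \<le> cmod c * U f"
  by (rule U_least) (simp add: cstar_smult U_upper mult_left_mono)

lemma U_star: "U (free_star f) \<le> U f"
  by (rule U_least) (simp add: cstar_star U_upper)

lemma U_minus: "U (- f) \<le> U f"
  by (rule U_least) (simp add: cstar_minus U_upper)

lemma U_rel: "r \<in> Rel \<Longrightarrow> U r = 0"
  using U_least[of r 0] U_nonneg[of r] by fastforce

lemma U_zero: "U 0 = 0"
  using U_least[of 0 0] U_nonneg[of 0] by (simp add: cstar_zero)

lemma U_commute: "U (f - g) \<le> U (g - f)"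
  using U_minus[of "g - f"] by simp

lemma U_triangle: "U (f - h) \<le> U (f - g) + U (g - h)"
  using U_add[of "f - g" "g - h"] by simp

lemma cauchyD: "f \<in> cauchy_seqs Rel \<Longrightarrow> e > 0 \<Longrightarrow> \<exists>N. \<forall>m\<ge>N. \<forall>n\<ge>N. U (f m - f n) < e"
  by (simp add: cauchy_seqs_def)

text \<open>Every operation of the algebra is Lipschitz along bounded sequences. This lemma and the next one
  turn the Lipschitz estimate into closure of the Cauchy sequences under the operation, and into
  compatibility of the operation with null sequences.\<close>

lemma cauchy_dominated:
  assumes "f \<in> cauchy_seqs Rel" "g \<in> cauchy_seqs Rel"
    and le: "\<And>m n. U (h m - h n) \<le> K * (U (f m - f n) + U (g m - g n))"
  shows "h \<in> cauchy_seqs Rel"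
  unfolding cauchy_seqs_def
proof (intro CollectI allI impI)
  fix e :: real assume "e > 0"
  define k where "k = \<bar>K\<bar> + 1"
  define d where "d = e / (2 * k)"
  have k: "k > 0"
    by (simp add: k_def)
  then have d: "d > 0"
    using \<open>e > 0\<close> by (simp add: d_def)
  obtain N1 where N1: "\<And>m n. m \<ge> N1 \<Longrightarrow> n \<ge> N1 \<Longrightarrow> U (f m - f n) < d"
    using cauchyD[OF assms(1) d] by blast
  obtain N2 where N2: "\<And>m n. m \<ge> N2 \<Longrightarrow> n \<ge> N2 \<Longrightarrow> U (g m - g n) < d"
    using cauchyD[OF assms(2) d] by blast
  have "U (h m - h n) < e" if "m \<ge> max N1 N2" "n \<ge> max N1 N2" for m n
  proof -
    have "U (h m - h n) \<le> K * (U (f m - f n) + U (g m - g n))"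
      by (rule le)
    also have "\<dots> \<le> k * (U (f m - f n) + U (g m - g n))"
      using U_nonneg by (intro mult_right_mono add_nonneg_nonneg) (auto simp: k_def)
    also have "\<dots> < k * (d + d)"
      using N1[of m n] N2[of m n] that k by (intro mult_strict_left_mono add_strict_mono) auto
    also have "\<dots> = e"
      using k by (simp add: d_def)
    finally show ?thesis .
  qed
  then show "\<exists>N. \<forall>m\<ge>N. \<forall>n\<ge>N. U (h m - h n) < e"
    by blast
qed

lemma null_dominated:
  assumes "(f, f') \<in> null_rel Rel" "(g, g') \<in> null_rel Rel"
    and "h \<in> cauchy_seqs Rel" "h' \<in> cauchy_seqs Rel"
    and le: "\<And>n. U (h n - h' n) \<le> K * (U (f n - f' n) + U (g n - g' n))"
  shows "(h, h') \<in> null_rel Rel"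
proof -
  have "(\<lambda>n. K * (U (f n - f' n) + U (g n - g' n))) \<longlonglongrightarrow> K * (0 + 0)"
    using assms(1,2) unfolding null_rel_def by (intro tendsto_mult tendsto_const tendsto_add) auto
  then have "(\<lambda>n. U (h n - h' n)) \<longlonglongrightarrow> 0"
    using le U_nonneg by (intro tendsto_sandwich[where f = "\<lambda>_. 0" and g = "\<lambda>n. U (h n - h' n)"]) auto
  then show ?thesis
    using assms(3,4) by (simp add: null_rel_def)
qed

lemma cauchy_const: "(\<lambda>n. f) \<in> cauchy_seqs Rel"
  by (simp add: cauchy_seqs_def U_zero)

lemma null_rel_refl: "f \<in> cauchy_seqs Rel \<Longrightarrow> (f, f) \<in> null_rel Rel"
  by (simp add: null_rel_def U_zero)

lemma null_rel_cauchy: "(f, g) \<in> null_rel Rel \<Longrightarrow> f \<in> cauchy_seqs Rel \<and> g \<in> cauchy_seqs Rel"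
  by (simp add: null_rel_def)

lemma null_rel_sym:
  assumes "(f, g) \<in> null_rel Rel"
  shows "(g, f) \<in> null_rel Rel"
  by (rule null_dominated[OF assms null_rel_refl[of f], of _ _ 1])
    (use null_rel_cauchy[OF assms] U_commute in \<open>auto simp: U_zero\<close>)

lemma null_rel_trans:
  assumes "(f, g) \<in> null_rel Rel" "(g, h) \<in> null_rel Rel"
  shows "(f, h) \<in> null_rel Rel"
  by (rule null_dominated[OF assms, of _ _ 1])
    (use null_rel_cauchy[OF assms(1)] null_rel_cauchy[OF assms(2)] U_triangle in auto)

lemma equiv_null_rel: "equiv (cauchy_seqs Rel) (null_rel Rel)"
proof (rule equivI)
  show "null_rel Rel \<subseteq> cauchy_seqs Rel \<times> cauchy_seqs Rel"
    by (auto simp: null_rel_def)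
  show "refl_on (cauchy_seqs Rel) (null_rel Rel)"
    by (simp add: refl_on_def null_rel_refl)
  show "sym (null_rel Rel)"
    by (meson symI null_rel_sym)
  show "trans (null_rel Rel)"
    by (meson transI null_rel_trans)
qed

lemma limit_class_eq: "(f, g) \<in> null_rel Rel \<Longrightarrow> limit_class Rel f = limit_class Rel g"
  unfolding limit_class_def by (rule equiv_class_eq[OF equiv_null_rel])

lemma mem_limit_class: "g \<in> limit_class Rel f \<longleftrightarrow> (f, g) \<in> null_rel Rel"
  by (simp add: limit_class_def)

lemma cauchy_bounded:
  assumes "f \<in> cauchy_seqs Rel"
  obtains B where "B \<ge> 0" "\<And>n. U (f n) \<le> B"
proof -
  obtain N where N: "\<And>m. m \<ge> N \<Longrightarrow> U (f m - f N) < 1"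
    using cauchyD[OF assms zero_less_one] by blast
  define B where "B = (\<Sum>n\<le>N. U (f n)) + 1"
  have le: "U (f n) \<le> (\<Sum>n\<le>N. U (f n))" if "n \<le> N" for n
    using that U_nonneg by (intro member_le_sum) auto
  have "U (f n) \<le> B" for n
  proof (cases "n \<le> N")
    case False
    then have "U (f n) \<le> U (f n - f N) + U (f N)"
      using U_add[of "f n - f N" "f N"] by simp
    then show ?thesis
      using N[of n] le[of N] False by (simp add: B_def)
  qed (use le in \<open>auto simp: B_def intro: add_increasing2\<close>)
  moreover have "B \<ge> 0"
    unfolding B_def using U_nonneg by (intro add_nonneg_nonneg sum_nonneg) auto
  ultimately show ?thesis
    using that by blast
qed

text \<open>The product is Lipschitz only along bounded sequences; Cauchy sequences are bounded.\<close>

lemma U_mult_diff_le: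
  assumes "U g \<le> B" "U f' \<le> B"
  shows "U (f * g - f' * g') \<le> B * (U (f - f') + U (g - g'))"
proof -
  have "f * g - f' * g' = (f - f') * g + f' * (g - g')"
    by (simp add: algebra_simps)
  then have "U (f * g - f' * g') \<le> U ((f - f') * g) + U (f' * (g - g'))"
    using U_add by metis
  also have "\<dots> \<le> U (f - f') * U g + U f' * U (g - g')"
    by (intro add_mono U_mult)
  also have "\<dots> \<le> U (f - f') * B + B * U (g - g')"
    using assms U_nonneg by (intro add_mono mult_left_mono mult_right_mono) auto
  finally show ?thesis
    by (simp add: algebra_simps)
qed

lemma U_add_diff_le: "U (f + g - (f' + g')) \<le> 1 * (U (f - f') + U (g - g'))"
  using U_add[of "f - f'" "g - g'"] by (simp add: algebra_simps)

lemma U_smult_diff_le: "U (free_smult c f - free_smult c f') \<le> cmod c * (U (f - f') + U (f - f'))"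
proof -
  have "U (free_smult c f - free_smult c f') \<le> cmod c * U (f - f')"
    using U_smult[of c "f - f'"] by (simp add: free_smult_diff)
  also have "\<dots> \<le> cmod c * (U (f - f') + U (f - f'))"
    using U_nonneg by (intro mult_left_mono) auto
  finally show ?thesis .
qed

lemma U_star_diff_le: "U (free_star f - free_star f') \<le> 1 * (U (f - f') + U (f - f'))"
  using U_star[of "f - f'"] U_nonneg[of "f - f'"] by (simp add: free_star_diff)

lemma cauchy_add: "f \<in> cauchy_seqs Rel \<Longrightarrow> g \<in> cauchy_seqs Rel \<Longrightarrow> (\<lambda>n. f n + g n) \<in> cauchy_seqs Rel"
  by (erule (1) cauchy_dominated) (rule U_add_diff_le)

lemma cauchy_smult: "f \<in> cauchy_seqs Rel \<Longrightarrow> (\<lambda>n. free_smult c (f n)) \<in> cauchy_seqs Rel"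
  by (rule cauchy_dominated[OF _ _ U_smult_diff_le])

lemma cauchy_star: "f \<in> cauchy_seqs Rel \<Longrightarrow> (\<lambda>n. free_star (f n)) \<in> cauchy_seqs Rel"
  by (rule cauchy_dominated[OF _ _ U_star_diff_le])

lemma cauchy_mult:
  assumes "f \<in> cauchy_seqs Rel" "g \<in> cauchy_seqs Rel"
  shows "(\<lambda>n. f n * g n) \<in> cauchy_seqs Rel"
proof -
  obtain B where B: "\<And>n. U (f n) \<le> B"
    using cauchy_bounded[OF assms(1)] by blast
  obtain C where C: "\<And>n. U (g n) \<le> C"
    using cauchy_bounded[OF assms(2)] by blast
  have "U (f n) \<le> max B C" "U (g n) \<le> max B C" for n
    using B[of n] C[of n] by auto
  then show ?thesis
    by (intro cauchy_dominated[OF assms, of _ "max B C"] U_mult_diff_le)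
qed

abbreviation C :: "(nat \<Rightarrow> 'g free_alg) set star_algebra" where
  "C \<equiv> universal_cstar_algebra Rel"

lemma UN_constant: "x \<in> X \<Longrightarrow> (\<And>y. y \<in> X \<Longrightarrow> h y = c) \<Longrightarrow> (\<Union>y\<in>X. h y) = c"
  by auto

lemma limit_class_in_carrier: "f \<in> cauchy_seqs Rel \<Longrightarrow> limit_class Rel f \<in> carrier C"
  by (simp add: universal_cstar_algebra_def limit_class_def quotientI)

lemma carrier_cases:
  assumes "V \<in> carrier C"
  obtains f where "f \<in> cauchy_seqs Rel" "V = limit_class Rel f"
  using assms by (auto simp: universal_cstar_algebra_def limit_class_def elim: quotientE)

lemma limit_class_add:
  assumes "f \<in> cauchy_seqs Rel" "g \<in> cauchy_seqs Rel"
  shows "limit_class Rel f \<oplus>\<^bsub>C\<^esub> limit_class Rel g = limit_class Rel (\<lambda>n. f n + g n)"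
proof -
  have "limit_class Rel (\<lambda>n. f' n + g' n) = limit_class Rel (\<lambda>n. f n + g n)"
    if "(f, f') \<in> null_rel Rel" "(g, g') \<in> null_rel Rel" for f' g'
    using that null_rel_cauchy[OF that(1)] null_rel_cauchy[OF that(2)]
    by (intro limit_class_eq[symmetric] null_dominated[OF that _ _ U_add_diff_le] cauchy_add) auto
  then have "(\<Union>f'\<in>limit_class Rel f. \<Union>g'\<in>limit_class Rel g. limit_class Rel (\<lambda>n. f' n + g' n))
      = limit_class Rel (\<lambda>n. f n + g n)"
    using null_rel_refl[OF assms(1)] null_rel_refl[OF assms(2)]
    by (intro UN_constant[of f] UN_constant[of g]) (unfold mem_limit_class)
  then show ?thesis
    by (simp add: universal_cstar_algebra_def)
qed

lemma limit_class_mult: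
  assumes "f \<in> cauchy_seqs Rel" "g \<in> cauchy_seqs Rel"
  shows "limit_class Rel f \<otimes>\<^bsub>C\<^esub> limit_class Rel g = limit_class Rel (\<lambda>n. f n * g n)"
proof -
  have "limit_class Rel (\<lambda>n. f' n * g' n) = limit_class Rel (\<lambda>n. f n * g n)"
    if "(f, f') \<in> null_rel Rel" "(g, g') \<in> null_rel Rel" for f' g'
  proof -
    have c: "f' \<in> cauchy_seqs Rel" "g' \<in> cauchy_seqs Rel"
      using null_rel_cauchy that by blast+
    obtain B where B: "\<And>n. U (f' n) \<le> B"
      using cauchy_bounded[OF c(1)] by blast
    obtain B' where B': "\<And>n. U (g n) \<le> B'"
      using cauchy_bounded[OF assms(2)] by blast
    have "U (f' n) \<le> max B B'" "U (g n) \<le> max B B'" for n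
      using B[of n] B'[of n] by auto
    then show ?thesis
      by (intro limit_class_eq[symmetric] null_dominated[OF that, of _ _ "max B B'"]
          cauchy_mult assms c U_mult_diff_le)
  qed
  then have "(\<Union>f'\<in>limit_class Rel f. \<Union>g'\<in>limit_class Rel g. limit_class Rel (\<lambda>n. f' n * g' n))
      = limit_class Rel (\<lambda>n. f n * g n)"
    using null_rel_refl[OF assms(1)] null_rel_refl[OF assms(2)]
    by (intro UN_constant[of f] UN_constant[of g]) (unfold mem_limit_class)
  then show ?thesis
    by (simp add: universal_cstar_algebra_def)
qed

lemma limit_class_smult:
  assumes "f \<in> cauchy_seqs Rel"
  shows "c \<odot>\<^bsub>C\<^esub> limit_class Rel f = limit_class Rel (\<lambda>n. free_smult c (f n))"
proof -
  have "limit_class Rel (\<lambda>n. free_smult c (f' n)) = limit_class Rel (\<lambda>n. free_smult c (f n))"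
    if "(f, f') \<in> null_rel Rel" for f'
    using null_rel_cauchy[OF that]
    by (intro limit_class_eq[symmetric] null_dominated[OF that that _ _ U_smult_diff_le] cauchy_smult) auto
  then have "(\<Union>f'\<in>limit_class Rel f. limit_class Rel (\<lambda>n. free_smult c (f' n)))
      = limit_class Rel (\<lambda>n. free_smult c (f n))"
    using null_rel_refl[OF assms] by (intro UN_constant[of f]) (unfold mem_limit_class)
  then show ?thesis
    by (simp add: universal_cstar_algebra_def)
qed

lemma limit_class_star:
  assumes "f \<in> cauchy_seqs Rel"
  shows "star C (limit_class Rel f) = limit_class Rel (\<lambda>n. free_star (f n))"
proof -
  have "limit_class Rel (\<lambda>n. free_star (f' n)) = limit_class Rel (\<lambda>n. free_star (f n))"
    if "(f, f') \<in> null_rel Rel" for f'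
    using null_rel_cauchy[OF that]
    by (intro limit_class_eq[symmetric] null_dominated[OF that that _ _ U_star_diff_le] cauchy_star) auto
  then have "(\<Union>f'\<in>limit_class Rel f. limit_class Rel (\<lambda>n. free_star (f' n)))
      = limit_class Rel (\<lambda>n. free_star (f n))"
    using null_rel_refl[OF assms] by (intro UN_constant[of f]) (unfold mem_limit_class)
  then show ?thesis
    by (simp add: universal_cstar_algebra_def)
qed

lemma limit_class_zero: "\<zero>\<^bsub>C\<^esub> = limit_class Rel (\<lambda>n. 0)"
  by (simp add: universal_cstar_algebra_def)

lemma limit_class_const_eq:
  assumes "f - g \<in> Rel"
  shows "limit_class Rel (\<lambda>n. f) = limit_class Rel (\<lambda>n. g)"
  by (rule limit_class_eq) (simp add: null_rel_def cauchy_const U_rel[OF assms])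

end

section \<open>Evaluation of the free *-algebra at projections\<close>

definition word_op :: "('g \<Rightarrow> 'h \<Rightarrow> 'h) \<Rightarrow> 'g gen_word \<Rightarrow> 'h \<Rightarrow> 'h" where
  "word_op A w u = foldr A (letters w) u"

text \<open>The extension of \<open>A\<close> to a homomorphism on the free algebra. The function \<open>A g\<close> is meaningful only
  on a subspace \<open>H\<close>, so multiplicativity holds only there.\<close>

definition ev :: "('g \<Rightarrow> 'h \<Rightarrow> 'h) \<Rightarrow> 'g free_alg \<Rightarrow> 'h \<Rightarrow> 'h::complex_hilbert_space" where
  "ev A f u = (\<Sum>w\<in>Poly_Mapping.keys f. Poly_Mapping.lookup f w *\<^sub>C word_op A w u)"

lemma ev_superset:
  assumes "finite S" "Poly_Mapping.keys f \<subseteq> S"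
  shows "ev A f u = (\<Sum>w\<in>S. Poly_Mapping.lookup f w *\<^sub>C word_op A w u)"
  unfolding ev_def
  by (rule sum.mono_neutral_left) (use assms in \<open>auto simp: in_keys_iff\<close>)

lemma ev_add: "ev A (f + g) u = ev A f u + ev A g u"
proof -
  let ?S = "Poly_Mapping.keys f \<union> Poly_Mapping.keys g"
  have "Poly_Mapping.keys (f + g) \<subseteq> ?S"
    by (rule keys_add)
  then show ?thesis
    using ev_superset[of ?S "f + g" A u] ev_superset[of ?S f A u] ev_superset[of ?S g A u]
    by (simp add: lookup_add scaleC_add_left sum.distrib)
qed

lemma ev_single: "ev A (Poly_Mapping.single w c) u = c *\<^sub>C word_op A w u"
  using ev_superset[of "{w}" "Poly_Mapping.single w c" A u] by simp

lemma ev_zero [simp]: "ev A 0 u = 0"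
  by (simp add: ev_def)

lemma ev_minus: "ev A (- f) u = - ev A f u"
  using ev_add[of A f "- f" u] by (simp add: eq_neg_iff_add_eq_0 add.commute)

lemma ev_diff: "ev A (f - g) u = ev A f u - ev A g u"
  using ev_add[of A f "- g" u] by (simp add: ev_minus)

lemma ev_sum: "ev A (\<Sum>i\<in>I. f i) u = (\<Sum>i\<in>I. ev A (f i) u)"
  by (induction I rule: infinite_finite_induct) (simp_all add: ev_add)

lemma word_op_zero [simp]: "word_op A 0 u = u"
  by (simp add: word_op_def zero_gen_word_def)

lemma ev_one [simp]: "ev A 1 u = u"
  using ev_single[of A 0 1 u] by (simp add: scaleC_one)

lemma ev_gen [simp]: "ev A (gen g) u = A g u"
  by (simp add: gen_def ev_single word_op_def scaleC_one)

lemma ev_smult: "ev A (free_smult c f) u = c *\<^sub>C ev A f u"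
proof (induction f rule: free_alg_induct)
  case (single w k)
  show ?case
    by (simp add: free_smult_def mult_single ev_single scaleC_scaleC)
next
  case (add f g)
  then show ?case
    by (simp add: free_smult_def distrib_left ev_add scaleC_add_right)
qed

locale projection_family =
  fixes H :: "'h::complex_hilbert_space set" and A :: "'g \<Rightarrow> 'h \<Rightarrow> 'h"
  assumes hilbert: "hilbert_subspace H" and projection: "projection_on H (A g)"
begin

lemma sub: "csubspace H"
  using hilbert by (rule hilbert_subspace_csubspace)

lemmas A_bounded = projection_bounded[OF projection]

lemma word_op_in: "u \<in> H \<Longrightarrow> word_op A w u \<in> H"
proof -
  assume "u \<in> H"
  then have "foldr A ls u \<in> H" for ls
    by (induction ls) (simp_all add: projection_in[OF projection])
  then show ?thesis
    by (simp add: word_op_def)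
qed

lemma word_op_add: "u \<in> H \<Longrightarrow> v \<in> H \<Longrightarrow> word_op A w (u + v) = word_op A w u + word_op A w v"
proof -
  assume uv: "u \<in> H" "v \<in> H"
  have "foldr A ls (u + v) = foldr A ls u + foldr A ls v" for ls
    using word_op_in[of _ "GenWord _"] uv
    by (induction ls) (simp_all add: word_op_def bounded_operator_add[OF A_bounded])
  then show ?thesis
    by (simp add: word_op_def)
qed

lemma word_op_scale: "u \<in> H \<Longrightarrow> word_op A w (c *\<^sub>C u) = c *\<^sub>C word_op A w u"
proof -
  assume u: "u \<in> H"
  have "foldr A ls (c *\<^sub>C u) = c *\<^sub>C foldr A ls u" for ls
    using word_op_in[of _ "GenWord _"] u
    by (induction ls) (simp_all add: word_op_def bounded_operator_scale[OF A_bounded])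
  then show ?thesis
    by (simp add: word_op_def)
qed

lemma word_op_norm_le: "u \<in> H \<Longrightarrow> norm (word_op A w u) \<le> norm u"
proof -
  assume u: "u \<in> H"
  have "norm (foldr A ls u) \<le> norm u" for ls
  proof (induction ls)
    case (Cons g ls)
    have "foldr A ls u \<in> H"
      using word_op_in[OF u, of "GenWord ls"] by (simp add: word_op_def)
    then show ?case
      using projection_norm_le[OF projection, of "foldr A ls u" g] Cons by simp
  qed simp
  then show ?thesis
    by (simp add: word_op_def)
qed

lemma word_op_adjoint:
  "u \<in> H \<Longrightarrow> v \<in> H \<Longrightarrow> cinner (word_op A w u) v = cinner u (word_op A (rev_word w) v)"
proof -
  have "cinner (foldr A ls u) v = cinner u (foldr A (rev ls) v)" if "u \<in> H" "v \<in> H" for ls u v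
    using that
  proof (induction ls arbitrary: v)
    case (Cons g ls)
    have "foldr A ls u \<in> H"
      using word_op_in[OF Cons.prems(1), of "GenWord ls"] by (simp add: word_op_def)
    then show ?case
      using Cons projection_sym[OF projection, of "foldr A ls u" v g]
      by (simp add: projection_in[OF projection])
  qed simp
  then show "u \<in> H \<Longrightarrow> v \<in> H \<Longrightarrow> ?thesis"
    by (simp add: word_op_def rev_word_def)
qed

lemma ev_in: "u \<in> H \<Longrightarrow> ev A f u \<in> H"
  unfolding ev_def by (intro csubspace_sum[OF sub] csubspace_scale[OF sub] word_op_in)

lemma ev_add_vector: "u \<in> H \<Longrightarrow> v \<in> H \<Longrightarrow> ev A f (u + v) = ev A f u + ev A f v"
  by (simp add: ev_def word_op_add scaleC_add_right sum.distrib)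

lemma ev_scale_vector: "u \<in> H \<Longrightarrow> ev A f (c *\<^sub>C u) = c *\<^sub>C ev A f u"
  by (simp add: ev_def word_op_scale scaleC_scaleC complex_vector.scale_sum_right mult.commute)

lemma ev_mult: "u \<in> H \<Longrightarrow> ev A (f * g) u = ev A f (ev A g u)"
proof (induction f rule: free_alg_induct)
  case (single w c)
  then show ?case
  proof (induction g rule: free_alg_induct)
    case (single w' c')
    then show ?case
      by (simp add: mult_single ev_single word_op_scale word_op_in scaleC_scaleC)
        (simp add: word_op_def plus_gen_word_def)
  next
    case (add f g)
    then show ?case
      by (simp add: distrib_left ev_add ev_add_vector ev_in)
  qed
next
  case (add f f')
  then show ?case
    by (simp add: distrib_right ev_add)
qed

lemma ev_adjoint: "u \<in> H \<Longrightarrow> v \<in> H \<Longrightarrow> cinner (ev A f u) v = cinner u (ev A (free_star f) v)"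
proof (induction f rule: free_alg_induct)
  case (single w c)
  then show ?case
    by (simp add: free_star_single ev_single cinner_scaleC_left cinner_scaleC_right word_op_adjoint)
next
  case (add f g)
  then show ?case
    by (simp add: free_star_add ev_add cinner_add_left cinner_add_right)
qed

definition op_norm :: "'g free_alg \<Rightarrow> real" where
  "op_norm f = Inf {K. K \<ge> 0 \<and> (\<forall>u\<in>H. norm (ev A f u) \<le> K * norm u)}"

lemma op_norm_le: "K \<ge> 0 \<Longrightarrow> (\<And>u. u \<in> H \<Longrightarrow> norm (ev A f u) \<le> K * norm u) \<Longrightarrow> op_norm f \<le> K"
  unfolding op_norm_def by (rule cInf_lower) (auto intro!: bdd_belowI[of _ 0])

lemma op_norm_nonempty: "\<exists>K\<ge>0. \<forall>u\<in>H. norm (ev A f u) \<le> K * norm u"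
proof (intro exI conjI ballI)
  let ?K = "\<Sum>w\<in>Poly_Mapping.keys f. cmod (Poly_Mapping.lookup f w)"
  show "?K \<ge> 0"
    by (intro sum_nonneg) auto
  fix u assume u: "u \<in> H"
  have "norm (ev A f u) \<le> (\<Sum>w\<in>Poly_Mapping.keys f. cmod (Poly_Mapping.lookup f w) * norm u)"
    unfolding ev_def
    by (intro sum_norm_le) (simp add: mult_left_mono word_op_norm_le[OF u])
  then show "norm (ev A f u) \<le> ?K * norm u"
    by (simp add: sum_distrib_right)
qed

lemma op_norm_nonneg: "op_norm f \<ge> 0"
  unfolding op_norm_def using op_norm_nonempty[of f] by (intro cInf_greatest) auto

lemma norm_ev_le: "u \<in> H \<Longrightarrow> norm (ev A f u) \<le> op_norm f * norm u"
proof (cases "u = 0")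
  case True
  then show ?thesis
    using op_norm_nonempty[of f] csubspace_0[OF sub] by fastforce
next
  case False
  assume u: "u \<in> H"
  have "norm (ev A f u) / norm u \<le> op_norm f"
    unfolding op_norm_def
    using op_norm_nonempty[of f] u False by (intro cInf_greatest) (auto simp: divide_le_eq)
  then show ?thesis
    using False by (simp add: divide_le_eq)
qed

lemma op_norm_star_le: "op_norm (free_star f) \<le> op_norm f"
proof (rule op_norm_le[OF op_norm_nonneg])
  fix u assume u: "u \<in> H"
  let ?v = "ev A (free_star f) u"
  have "cinner ?v ?v = cinner (ev A f ?v) u"
    using ev_adjoint[OF ev_in[OF u] u] by simp
  then have "(norm ?v)\<^sup>2 \<le> norm (ev A f ?v) * norm u"
    by (rule norm_square_le)
  also have "\<dots> \<le> (op_norm f * norm ?v) * norm u"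
    by (intro mult_right_mono norm_ev_le ev_in u) auto
  finally have "norm ?v * norm ?v \<le> (op_norm f * norm u) * norm ?v"
    by (simp add: power2_eq_square mult.commute mult.left_commute)
  then show "norm ?v \<le> op_norm f * norm u"
    using op_norm_nonneg by (cases "norm ?v = 0") auto
qed

lemma op_norm_mult: "op_norm (f * g) \<le> op_norm f * op_norm g"
proof (rule op_norm_le)
  fix u assume u: "u \<in> H"
  have "norm (ev A f (ev A g u)) \<le> op_norm f * norm (ev A g u)"
    by (intro norm_ev_le ev_in u)
  also have "\<dots> \<le> op_norm f * (op_norm g * norm u)"
    by (intro mult_left_mono norm_ev_le u op_norm_nonneg)
  finally show "norm (ev A (f * g) u) \<le> op_norm f * op_norm g * norm u"
    by (simp add: ev_mult u mult.assoc)
qed (simp add: op_norm_nonneg)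

lemma op_norm_smult_le: "op_norm (free_smult c f) \<le> cmod c * op_norm f"
  by (rule op_norm_le) (simp_all add: op_norm_nonneg ev_smult mult.assoc mult_left_mono norm_ev_le)

text \<open>The half of the C*-identity that uses the inner product: the square norm of \<open>ev A f u\<close> is the
  inner product of \<open>u\<close> with \<open>ev A (free_star f * f) u\<close>.\<close>

lemma op_norm_square_le: "(op_norm f)\<^sup>2 \<le> op_norm (free_star f * f)"
proof -
  let ?K = "op_norm (free_star f * f)"
  have "norm (ev A f u) \<le> sqrt ?K * norm u" if u: "u \<in> H" for u
  proof -
    have "cinner (ev A f u) (ev A f u) = cinner u (ev A (free_star f * f) u)"
      using ev_adjoint[OF u ev_in[OF u]] by (simp add: ev_mult u)
    then have "(norm (ev A f u))\<^sup>2 \<le> norm u * norm (ev A (free_star f * f) u)"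
    by (rule norm_square_le)
    also have "\<dots> \<le> norm u * (?K * norm u)"
      by (intro mult_left_mono norm_ev_le u) auto
    also have "\<dots> = (sqrt ?K * norm u)\<^sup>2"
      using op_norm_nonneg by (simp add: power_mult_distrib power2_eq_square mult.commute mult.left_commute)
    finally show ?thesis
      by (rule power2_le_imp_le) (simp add: op_norm_nonneg)
  qed
  then have "op_norm f \<le> sqrt ?K"
    by (intro op_norm_le) (simp_all add: op_norm_nonneg)
  then have "(op_norm f)\<^sup>2 \<le> (sqrt ?K)\<^sup>2"
    by (intro power_mono op_norm_nonneg)
  then show ?thesis
    by (simp add: op_norm_nonneg)
qed

lemma cstar_seminorm_op_norm: "cstar_seminorm op_norm"
  unfolding cstar_seminorm_def
proof (intro conjI allI)
  fix f g
  show "op_norm (f + g) \<le> op_norm f + op_norm g"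
  proof (rule op_norm_le)
    fix u assume "u \<in> H"
    then show "norm (ev A (f + g) u) \<le> (op_norm f + op_norm g) * norm u"
      using norm_triangle_ineq[of "ev A f u" "ev A g u"] norm_ev_le[of u f] norm_ev_le[of u g]
      by (simp add: ev_add distrib_right)
  qed (simp add: op_norm_nonneg)
  show "op_norm (f * g) \<le> op_norm f * op_norm g"
    by (rule op_norm_mult)
  have "op_norm (free_star f * f) \<le> op_norm f * op_norm f"
    using op_norm_mult[of "free_star f" f] mult_right_mono[OF op_norm_star_le op_norm_nonneg] order_trans
    by blast
  then show "op_norm (free_star f * f) = (op_norm f)\<^sup>2"
    using op_norm_square_le[of f] by (simp add: power2_eq_square)
next
  fix c f
  show "op_norm (free_smult c f) = cmod c * op_norm f"
  proof (cases "c = 0")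
    case True
    have "op_norm 0 \<le> 0"
      by (rule op_norm_le) simp_all
    then show ?thesis
      using True op_norm_nonneg[of 0] by (simp add: free_smult_zero)
  next
    case False
    have "f = free_smult (1 / c) (free_smult c f)"
      using False by (intro poly_mapping_eqI) (simp add: lookup_free_smult)
    then have "op_norm f \<le> cmod (1 / c) * op_norm (free_smult c f)"
      using op_norm_smult_le by metis
    then have "cmod c * op_norm f \<le> op_norm (free_smult c f)"
      using False by (simp add: norm_divide field_simps)
    then show ?thesis
      using op_norm_smult_le[of c f] by simp
  qed
qed

lemma op_norm_eq_0: "(\<And>u. u \<in> H \<Longrightarrow> ev A f u = 0) \<Longrightarrow> op_norm f = 0"
  using op_norm_le[of 0 f] op_norm_nonneg[of f] by force

end

section \<open>Representations of the universal algebra\<close>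

text \<open>Operators that satisfy the relations. Their operator norm is one of the seminorms below the
  universal one, so evaluation is contractive for the universal seminorm and extends to the
  completion.\<close>

locale represented_relations = bounded_relations Rel + projection_family H A
  for Rel :: "'g free_alg set" and H :: "'h::complex_hilbert_space set" and A :: "'g \<Rightarrow> 'h \<Rightarrow> 'h" +
  assumes relations: "r \<in> Rel \<Longrightarrow> u \<in> H \<Longrightarrow> ev A r u = 0"
begin

text \<open>By \<open>rep_limit\<close> the limit exists and is independent of the chosen representative.\<close>

definition rep :: "(nat \<Rightarrow> 'g free_alg) set \<Rightarrow> 'h \<Rightarrow> 'h" where
  "rep V u = lim (\<lambda>n. ev A ((SOME f. f \<in> V) n) u)"

lemma norm_ev_le_U: "u \<in> H \<Longrightarrow> norm (ev A f u) \<le> U f * norm u"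
  using norm_ev_le[of u f] U_upper[OF cstar_seminorm_op_norm op_norm_eq_0[OF relations], of f]
  by (meson mult_right_mono norm_ge_zero order_trans)

lemma Cauchy_ev:
  assumes "f \<in> cauchy_seqs Rel" "u \<in> H"
  shows "Cauchy (\<lambda>n. ev A (f n) u)"
proof (rule metric_CauchyI)
  fix e :: real assume e: "e > 0"
  define d where "d = e / (norm u + 1)"
  have u: "norm u + 1 > 0"
    by (simp add: add_nonneg_pos)
  then obtain N where N: "\<And>m n. m \<ge> N \<Longrightarrow> n \<ge> N \<Longrightarrow> U (f m - f n) < d"
    using cauchyD[OF assms(1), of d] e by (auto simp: d_def)
  have "dist (ev A (f m) u) (ev A (f n) u) < e" if "m \<ge> N" "n \<ge> N" for m n
  proof -
    have "dist (ev A (f m) u) (ev A (f n) u) \<le> U (f m - f n) * norm u"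
      using norm_ev_le_U[OF assms(2), of "f m - f n"] by (simp add: ev_diff dist_norm)
    also have "\<dots> \<le> U (f m - f n) * (norm u + 1)"
      by (intro mult_left_mono U_nonneg) auto
    also have "\<dots> < d * (norm u + 1)"
      using N[OF that] u by (intro mult_strict_right_mono)
    also have "\<dots> = e"
      using u by (simp add: d_def)
    finally show ?thesis .
  qed
  then show "\<exists>N. \<forall>m\<ge>N. \<forall>n\<ge>N. dist (ev A (f m) u) (ev A (f n) u) < e"
    by blast
qed

lemma rep_limit:
  assumes "f \<in> cauchy_seqs Rel" "u \<in> H"
  shows "(\<lambda>n. ev A (f n) u) \<longlonglongrightarrow> rep (limit_class Rel f) u"
proof -
  define f' where "f' = (SOME f'. f' \<in> limit_class Rel f)"
  have "f' \<in> limit_class Rel f"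
    unfolding f'_def using null_rel_refl[OF assms(1)] by (metis mem_limit_class someI)
  then have f': "(f, f') \<in> null_rel Rel"
    by (simp add: mem_limit_class)
  have "Cauchy (\<lambda>n. ev A (f' n) u)"
    using Cauchy_ev null_rel_cauchy[OF f'] assms(2) by blast
  then have 1: "(\<lambda>n. ev A (f' n) u) \<longlonglongrightarrow> rep (limit_class Rel f) u"
    unfolding rep_def f'_def[symmetric] by (simp add: Cauchy_convergent convergent_LIMSEQ_iff[symmetric])
  have "(\<lambda>n. U (f n - f' n) * norm u) \<longlonglongrightarrow> 0"
    using f' unfolding null_rel_def by (intro tendsto_mult_left_zero) auto
  moreover have "\<forall>\<^sub>F n in sequentially. norm (ev A (f n) u - ev A (f' n) u) \<le> U (f n - f' n) * norm u"
    using norm_ev_le_U[OF assms(2)] by (simp flip: ev_diff)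
  ultimately have "(\<lambda>n. ev A (f n) u - ev A (f' n) u) \<longlonglongrightarrow> 0"
    by (rule Lim_null_comparison[rotated])
  from tendsto_add[OF this 1] show ?thesis
    by simp
qed

lemma rep_const: "u \<in> H \<Longrightarrow> rep (limit_class Rel (\<lambda>n. f)) u = ev A f u"
  using rep_limit[OF cauchy_const] LIMSEQ_unique tendsto_const by metis

lemma rep_in:
  assumes "f \<in> cauchy_seqs Rel" "u \<in> H"
  shows "rep (limit_class Rel f) u \<in> H"
  using hilbert_subspace_limit[OF hilbert _ rep_limit[OF assms]] ev_in[OF assms(2)] by blast

lemma rep_bounded_operator:
  assumes f: "f \<in> cauchy_seqs Rel"
  shows "bounded_operator_on H (rep (limit_class Rel f))"
  unfolding bounded_operator_on_def
proof (intro conjI ballI allI)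
  fix u v assume uv: "u \<in> H" "v \<in> H"
  have "(\<lambda>n. ev A (f n) (u + v)) \<longlonglongrightarrow> rep (limit_class Rel f) u + rep (limit_class Rel f) v"
    using tendsto_add[OF rep_limit[OF f uv(1)] rep_limit[OF f uv(2)]] uv by (simp add: ev_add_vector)
  then show "rep (limit_class Rel f) (u + v) = rep (limit_class Rel f) u + rep (limit_class Rel f) v"
    using rep_limit[OF f csubspace_add[OF sub uv]] LIMSEQ_unique by blast
next
  fix c u assume u: "u \<in> H"
  have "(\<lambda>n. ev A (f n) (c *\<^sub>C u)) \<longlonglongrightarrow> c *\<^sub>C rep (limit_class Rel f) u"
    using tendsto_scaleC[OF tendsto_const rep_limit[OF f u]] u by (simp add: ev_scale_vector)
  then show "rep (limit_class Rel f) (c *\<^sub>C u) = c *\<^sub>C rep (limit_class Rel f) u"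
    using rep_limit[OF f csubspace_scale[OF sub u]] LIMSEQ_unique by blast
next
  obtain B where B: "\<And>n. U (f n) \<le> B"
    using cauchy_bounded[OF f] by blast
  have "norm (rep (limit_class Rel f) u) \<le> B * norm u" if u: "u \<in> H" for u
  proof (rule LIMSEQ_le_const2[OF tendsto_norm[OF rep_limit[OF f u]]])
    have "norm (ev A (f n) u) \<le> B * norm u" for n
      using norm_ev_le_U[OF u, of "f n"] mult_right_mono[OF B[of n], of "norm u"] by simp
    then show "\<exists>N. \<forall>n\<ge>N. norm (ev A (f n) u) \<le> B * norm u"
      by blast
  qed
  then show "\<exists>K. \<forall>u\<in>H. norm (rep (limit_class Rel f) u) \<le> K * norm u"
    by blast
qed (rule rep_in[OF f])

lemma rep_mult:
  assumes f: "f \<in> cauchy_seqs Rel" and g: "g \<in> cauchy_seqs Rel" and u: "u \<in> H"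
  shows "rep (limit_class Rel (\<lambda>n. f n * g n)) u = rep (limit_class Rel f) (rep (limit_class Rel g) u)"
proof -
  let ?v = "rep (limit_class Rel g) u"
  obtain B where B: "B \<ge> 0" "\<And>n. U (f n) \<le> B"
    using cauchy_bounded[OF f] by blast
  have v: "?v \<in> H"
    by (rule rep_in[OF g u])
  \<comment> \<open>Replacing \<open>ev A (g n) u\<close> by its limit costs at most \<open>B\<close> times the distance.\<close>
  have "norm (ev A (f n * g n) u - ev A (f n) ?v) \<le> norm (ev A (g n) u - ?v) * B" for n
  proof -
    have gu: "ev A (g n) u \<in> H"
      by (rule ev_in[OF u])
    have "ev A (f n) (ev A (g n) u) = ev A (f n) (ev A (g n) u - ?v) + ev A (f n) ?v"
      using ev_add_vector[OF csubspace_diff[OF sub gu v] v, of "f n"] by simp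
    then have "norm (ev A (f n * g n) u - ev A (f n) ?v) = norm (ev A (f n) (ev A (g n) u - ?v))"
      by (simp add: ev_mult[OF u])
    also have "\<dots> \<le> U (f n) * norm (ev A (g n) u - ?v)"
      by (intro norm_ev_le_U csubspace_diff[OF sub] gu v)
    also have "\<dots> \<le> norm (ev A (g n) u - ?v) * B"
      using mult_right_mono[OF B(2)[of n], of "norm (ev A (g n) u - ?v)"] by (simp add: mult.commute)
    finally show ?thesis .
  qed
  then have "\<forall>\<^sub>F n in sequentially. norm (ev A (f n * g n) u - ev A (f n) ?v) \<le> norm (ev A (g n) u - ?v) * B"
    by simp
  moreover have "(\<lambda>n. norm (ev A (g n) u - ?v) * B) \<longlonglongrightarrow> 0"
    by (intro tendsto_mult_left_zero tendsto_norm_zero LIM_zero rep_limit[OF g u])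
  ultimately have "(\<lambda>n. ev A (f n * g n) u - ev A (f n) ?v) \<longlonglongrightarrow> 0"
    by (rule Lim_null_comparison)
  from tendsto_add[OF this rep_limit[OF f v]]
  have "(\<lambda>n. ev A (f n * g n) u) \<longlonglongrightarrow> rep (limit_class Rel f) ?v"
    by simp
  then show ?thesis
    using rep_limit[OF cauchy_mult[OF f g] u] LIMSEQ_unique by blast
qed

lemma rep_adjoint:
  assumes f: "f \<in> cauchy_seqs Rel" and u: "u \<in> H" and v: "v \<in> H"
  shows "cinner (rep (limit_class Rel f) u) v = cinner u (rep (limit_class Rel (\<lambda>n. free_star (f n))) v)"
proof (rule LIMSEQ_unique)
  show "(\<lambda>n. cinner (ev A (f n) u) v) \<longlonglongrightarrow> cinner (rep (limit_class Rel f) u) v"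
    by (intro tendsto_cinner tendsto_const rep_limit f u)
  have "(\<lambda>n. cinner u (ev A (free_star (f n)) v))
      \<longlonglongrightarrow> cinner u (rep (limit_class Rel (\<lambda>n. free_star (f n))) v)"
    by (intro tendsto_cinner tendsto_const rep_limit cauchy_star f v)
  then show "(\<lambda>n. cinner (ev A (f n) u) v)
      \<longlonglongrightarrow> cinner u (rep (limit_class Rel (\<lambda>n. free_star (f n))) v)"
    by (simp add: ev_adjoint u v)
qed

lemma rep_representation: "representation_on C H rep"
  unfolding representation_on_def
proof (intro conjI ballI allI)
  fix V assume "V \<in> carrier C"
  then obtain f where f: "f \<in> cauchy_seqs Rel" and V: "V = limit_class Rel f"
    by (rule carrier_cases)
  show "bounded_operator_on H (rep V)"
    unfolding V by (rule rep_bounded_operator[OF f])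
  fix u assume u: "u \<in> H"
  show "rep (c \<odot>\<^bsub>C\<^esub> V) u = c *\<^sub>C rep V u" for c
  proof -
    have "(\<lambda>n. ev A (free_smult c (f n)) u) \<longlonglongrightarrow> c *\<^sub>C rep V u"
      unfolding V ev_smult by (intro tendsto_scaleC tendsto_const rep_limit f u)
    then show ?thesis
      using rep_limit[OF cauchy_smult[OF f] u] LIMSEQ_unique
      unfolding V limit_class_smult[OF f] by blast
  qed
  show "cinner (rep V u) v = cinner u (rep (star C V) v)" if v: "v \<in> H" for v
    unfolding V limit_class_star[OF f] by (rule rep_adjoint[OF f u v])
  fix W assume "W \<in> carrier C"
  then obtain g where g: "g \<in> cauchy_seqs Rel" and W: "W = limit_class Rel g"
    by (rule carrier_cases)
  show "rep (V \<oplus>\<^bsub>C\<^esub> W) u = rep V u + rep W u"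
  proof -
    have "(\<lambda>n. ev A (f n + g n) u) \<longlonglongrightarrow> rep V u + rep W u"
      unfolding V W ev_add by (intro tendsto_add rep_limit f g u)
    then show ?thesis
      using rep_limit[OF cauchy_add[OF f g] u] LIMSEQ_unique
      unfolding V W limit_class_add[OF f g] by blast
  qed
  show "rep (V \<otimes>\<^bsub>C\<^esub> W) u = rep V (rep W u)"
    unfolding V W limit_class_mult[OF f g] by (rule rep_mult[OF f g u])
qed

lemma rep_nondegenerate: "nondegenerate_on C H rep"
proof -
  let ?S = "{rep V u | V u. V \<in> carrier C \<and> u \<in> H}"
  have "u \<in> ?S" if "u \<in> H" for u
    using rep_const[OF that, of 1] that limit_class_in_carrier[OF cauchy_const[of 1]] by force
  moreover have "rep V u \<in> H" if "V \<in> carrier C" "u \<in> H" for V u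
    using carrier_cases[OF that(1)] rep_in that(2) by metis
  ultimately have S: "?S = H"
    by blast
  have "cspan H = H"
    using sub by (simp only: complex_vector.span_eq_iff)
  then show ?thesis
    unfolding nondegenerate_on_def S using hilbert by (simp only: hilbert_subspace_def closure_closed)
qed

lemma carrier_nonzero:
  assumes "H \<noteq> {0}"
  shows "carrier C \<noteq> {\<zero>\<^bsub>C\<^esub>}"
proof
  assume "carrier C = {\<zero>\<^bsub>C\<^esub>}"
  then have eq: "limit_class Rel (\<lambda>n. 1) = limit_class Rel (\<lambda>n. 0)"
    using limit_class_in_carrier[OF cauchy_const[of 1]] by (simp add: limit_class_zero)
  have "u = 0" if "u \<in> H" for u
    using rep_const[OF that, of 1] rep_const[OF that, of 0] by (simp add: eq)
  then show False
    using assms csubspace_0[OF sub] by blast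
qed

end

lemma bounded_relations_game:
  fixes lam :: "('x::finite, 'y::finite, 'a::finite, 'b::finite) game"
  shows "bounded_relations (game_relations lam)"
proof (rule bounded_relations_if_projections)
  fix g :: "('x, 'y, 'a, 'b) game_gen"
  show "gen g * gen g - gen g \<in> game_relations lam"
    by (cases g) (auto simp: game_relations_def)
qed

fun game_projections ::
  "('x \<Rightarrow> 'a \<Rightarrow> 'h \<Rightarrow> 'h) \<Rightarrow> ('y \<Rightarrow> 'b \<Rightarrow> 'h \<Rightarrow> 'h) \<Rightarrow> ('x, 'y, 'a, 'b) game_gen \<Rightarrow> 'h \<Rightarrow> 'h" where
  "game_projections p q (GenP x a) = p x a"
| "game_projections p q (GenQ y b) = q y b"

text \<open>The relations of the game hold in a model, so evaluation at the model extends to the game algebra.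
  The unit acts as the identity; this gives nondegeneracy, and a nonzero algebra because \<open>H\<close> is
  nonzero.\<close>

theorem representation_of_model:
  fixes lam :: "('x::finite, 'y::finite, 'a::finite, 'b::finite) game"
  assumes "finite_dimensional_model lam (H :: 'h::complex_hilbert_space set) p q"
  shows "carrier (game_algebra lam) \<noteq> {\<zero>\<^bsub>game_algebra lam\<^esub>}"
    and "has_nondegenerate_fd_representation TYPE('h) (game_algebra lam)"
proof -
  have fd: "finite_dimensional H" and nz: "H \<noteq> {0}"
    and p: "\<And>x. pvm_on H (p x)" and q: "\<And>y. pvm_on H (q y)"
    and pq: "\<And>x y a b u. \<not> lam x y a b \<Longrightarrow> u \<in> H \<Longrightarrow> p x a (q y b u) = 0"
    using assms by (auto simp: finite_dimensional_model_def)
  have H: "hilbert_subspace H"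
    using fd by (rule finite_dimensional_hilbert_subspace)
  interpret bounded_relations "game_relations lam"
    by (rule bounded_relations_game)
  interpret projection_family H "game_projections p q"
  proof
    show "projection_on H (game_projections p q g)" for g
      by (cases g) (simp_all add: pvm_projection[OF p] pvm_projection[OF q])
  qed (rule H)
  interpret represented_relations "game_relations lam" H "game_projections p q"
  proof
    fix r u assume "r \<in> game_relations lam" and u: "u \<in> H"
    then show "ev (game_projections p q) r u = 0"
      using pvm_sum[OF p u] pvm_sum[OF q u] pq
      by (auto simp: game_relations_def ev_diff ev_mult ev_sum
          projection_idem[OF pvm_projection[OF p]] projection_idem[OF pvm_projection[OF q]])
  qed
  show "carrier (game_algebra lam) \<noteq> {\<zero>\<^bsub>game_algebra lam\<^esub>}"
    unfolding game_algebra_def by (rule carrier_nonzero[OF nz])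
  show "has_nondegenerate_fd_representation TYPE('h) (game_algebra lam)"
    unfolding game_algebra_def has_nondegenerate_fd_representation_def
    using H fd nz rep_representation rep_nondegenerate by blast
qed

text \<open>The generators are mapped to operators that satisfy the relations, except that a representation
  is not required to preserve the unit. The unit is mapped to an operator that fixes every \<open>\<pi> V u\<close>,
  and by nondegeneracy these span a dense subspace.\<close>

theorem model_of_representation:
  fixes lam :: "('x::finite, 'y::finite, 'a::finite, 'b::finite) game"
  assumes "has_nondegenerate_fd_representation TYPE('h::complex_hilbert_space) (game_algebra lam)"
  shows "\<exists>(H :: 'h set) p q. finite_dimensional_model lam H p q"
proof -
  interpret bounded_relations "game_relations lam"
    by (rule bounded_relations_game)
  define c where "c f = limit_class (game_relations lam) (\<lambda>n. f)" for f
  obtain H :: "'h set" and \<pi> where H: "hilbert_subspace H" and fd: "finite_dimensional H"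
    and nz: "H \<noteq> {0}" and rep: "representation_on C H \<pi>" and nd: "nondegenerate_on C H \<pi>"
    using assms by (auto simp: has_nondegenerate_fd_representation_def game_algebra_def)
  have sub: "csubspace H"
    using H by (rule hilbert_subspace_csubspace)
  have c_in: "c f \<in> carrier C" for f
    unfolding c_def by (rule limit_class_in_carrier[OF cauchy_const])
  have bd: "bounded_operator_on H (\<pi> V)" if "V \<in> carrier C" for V
    using rep that by (simp add: representation_on_def)
  have add: "\<pi> (c (f + g)) u = \<pi> (c f) u + \<pi> (c g) u" if "u \<in> H" for f g u
    using rep that c_in limit_class_add[OF cauchy_const[of f] cauchy_const[of g]]
    unfolding representation_on_def c_def by metis
  have mult: "\<pi> (c (f * g)) u = \<pi> (c f) (\<pi> (c g) u)" if "u \<in> H" for f g u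
    using rep that c_in limit_class_mult[OF cauchy_const[of f] cauchy_const[of g]]
    unfolding representation_on_def c_def by metis
  have adj: "cinner (\<pi> (c f) u) v = cinner u (\<pi> (c (free_star f)) v)" if "u \<in> H" "v \<in> H" for f u v
    using rep that c_in limit_class_star[OF cauchy_const[of f]]
    unfolding representation_on_def c_def by metis
  have rel: "c f = c g" if "f - g \<in> game_relations lam" for f g
    unfolding c_def by (rule limit_class_const_eq[OF that])
  have zero: "\<pi> (c 0) u = 0" if "u \<in> H" for u
    using add[OF that, of 0 0] by simp
  have sum: "\<pi> (c (\<Sum>i\<in>I. f i)) u = (\<Sum>i\<in>I. \<pi> (c (f i)) u)" if "u \<in> H" for I and f :: "_ \<Rightarrow> _" and u
    by (induction I rule: infinite_finite_induct) (simp_all add: zero add that)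
  have one: "\<pi> (c 1) u = u" if "u \<in> H" for u
  proof -
    let ?S = "{\<pi> V u | V u. V \<in> carrier C \<and> u \<in> H}"
    have fix_S: "w \<in> H \<and> \<pi> (c 1) w = w" if wS: "w \<in> ?S" for w
    proof -
      obtain V v where V: "V \<in> carrier C" and v: "v \<in> H" and w: "w = \<pi> V v"
        using wS by blast
      obtain f where f: "f \<in> cauchy_seqs (game_relations lam)" and Vf: "V = limit_class (game_relations lam) f"
        using V by (rule carrier_cases)
      have "c 1 \<otimes>\<^bsub>C\<^esub> V = V"
        unfolding c_def Vf limit_class_mult[OF cauchy_const f] by simp
      moreover have "\<pi> (c 1 \<otimes>\<^bsub>C\<^esub> V) v = \<pi> (c 1) (\<pi> V v)"
        using rep c_in V v unfolding representation_on_def by blast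
      ultimately show ?thesis
        using bounded_operator_in[OF bd[OF V] v] w by simp
    qed
    have fix_span: "w \<in> H \<and> \<pi> (c 1) w = w" if "w \<in> cspan ?S" for w
      using that
    proof (induction rule: complex_vector.span_induct_alt)
      case base
      show ?case
        using csubspace_0[OF sub] bounded_operator_zero[OF bd[OF c_in] sub] by simp
    next
      case (step k x y)
      then show ?case
        using fix_S[of x]
        by (simp add: csubspace_add[OF sub] csubspace_scale[OF sub] bounded_operator_add[OF bd[OF c_in]]
            bounded_operator_scale[OF bd[OF c_in]])
    qed
    have "u \<in> closure (cspan ?S)"
      using nd that by (simp add: nondegenerate_on_def)
    then obtain w where w: "\<And>n. w n \<in> cspan ?S" "w \<longlonglongrightarrow> u"
      using closure_sequential[of u "cspan ?S"] by blast
    then have "(\<lambda>n. \<pi> (c 1) (w n)) \<longlonglongrightarrow> \<pi> (c 1) u"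
      using fix_span that by (intro bounded_operator_tendsto[OF bd[OF c_in] sub]) auto
    then show ?thesis
      using w fix_span LIMSEQ_unique by simp
  qed
  have proj: "projection_on H (\<pi> (c (gen g)))" for g
    unfolding projection_on_def
  proof (intro conjI ballI)
    show "bounded_operator_on H (\<pi> (c (gen g)))"
      by (rule bd[OF c_in])
    have "gen g * gen g - gen g \<in> game_relations lam"
      by (cases g) (auto simp: game_relations_def)
    then show "\<pi> (c (gen g)) (\<pi> (c (gen g)) u) = \<pi> (c (gen g)) u" if "u \<in> H" for u
      using mult[OF that, of "gen g" "gen g"] rel by simp
    show "cinner (\<pi> (c (gen g)) u) v = cinner u (\<pi> (c (gen g)) v)" if "u \<in> H" "v \<in> H" for u v
      using adj[OF that, of "gen g"] by simp
  qed
  have "c (\<Sum>a\<in>UNIV. gen (GenP x a)) = c 1" for x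
    by (rule rel) (auto simp: game_relations_def)
  then have "pvm_on H (\<lambda>a. \<pi> (c (gen (GenP x a))))" for x
    unfolding pvm_on_def using proj one by (simp flip: sum)
  moreover have "c (\<Sum>b\<in>UNIV. gen (GenQ y b)) = c 1" for y
    by (rule rel) (auto simp: game_relations_def)
  then have "pvm_on H (\<lambda>b. \<pi> (c (gen (GenQ y b))))" for y
    unfolding pvm_on_def using proj one by (simp flip: sum)
  moreover have "\<pi> (c (gen (GenP x a))) (\<pi> (c (gen (GenQ y b))) u) = 0"
    if "\<not> lam x y a b" "u \<in> H" for x y a b u
  proof -
    have "gen (GenP x a) * gen (GenQ y b) - 0 \<in> game_relations lam"
      using that(1) by (auto simp: game_relations_def)
    then show ?thesis
      using mult[OF that(2)] zero[OF that(2)] rel by metis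
  qed
  ultimately have "finite_dimensional_model lam H (\<lambda>x a. \<pi> (c (gen (GenP x a)))) (\<lambda>y b. \<pi> (c (gen (GenQ y b))))"
    unfolding finite_dimensional_model_def using fd nz by blast
  then show ?thesis
    by blast
qed

section \<open>From finite-dimensional models to maximally entangled strategies\<close>

lemma tensor_sum_left:
  assumes "tensor_product H K T tns" "csubspace H" "v \<in> K" "\<And>i. i \<in> I \<Longrightarrow> f i \<in> H"
  shows "tns (\<Sum>i\<in>I. c i *\<^sub>C f i) v = (\<Sum>i\<in>I. c i *\<^sub>C tns (f i) v)"
  using assms(4)
proof (induction I rule: infinite_finite_induct)
  case (insert i I)
  then have "tns (c i *\<^sub>C f i + (\<Sum>i\<in>I. c i *\<^sub>C f i)) v
      = tns (c i *\<^sub>C f i) v + tns (\<Sum>i\<in>I. c i *\<^sub>C f i) v"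
    using assms by (intro tensor_add_left[OF assms(1)] csubspace_scale csubspace_sum) auto
  then show ?case
    using insert assms by (simp add: tensor_scale_left[OF assms(1)])
qed (use tensor_scale_left[OF assms(1) csubspace_0[OF assms(2)] assms(3), of 0] in simp_all)

lemma tensor_sum_right:
  assumes "tensor_product H K T tns" "csubspace K" "u \<in> H" "\<And>i. i \<in> I \<Longrightarrow> f i \<in> K"
  shows "tns u (\<Sum>i\<in>I. c i *\<^sub>C f i) = (\<Sum>i\<in>I. c i *\<^sub>C tns u (f i))"
  using tensor_sum_left[OF tensor_product_swap[OF assms(1)] assms(2-4)] .

text \<open>The tensor square is modelled on \<open>d\<^sup>2\<close> orthonormal vectors of the ambient space, indexed by
  pairs \<open>(i, j)\<close> through \<open>i d + j\<close>; these become the tensors of the basis vectors.\<close>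

lemma tensor_square_exists:
  fixes e :: "nat \<Rightarrow> 'h::complex_hilbert_space"
  assumes e: "orthonormal d e" and inf: "infinite_dimensional_type TYPE('h)"
  shows "\<exists>T tns. tensor_product (cspan (e ` {..<d})) (cspan (e ` {..<d})) T tns"
proof -
  let ?H = "cspan (e ` {..<d})"
  obtain f :: "nat \<Rightarrow> 'h" where f: "orthonormal (d * d) f"
    using infinite_dimensional_orthonormal[OF inf] by blast
  define g where "g i j = f (i * d + j)" for i j
  define tns where "tns u v = (\<Sum>i<d. \<Sum>j<d. (cinner (e i) u * cinner (e j) v) *\<^sub>C g i j)" for u v
  have index: "i * d + j < d * d" if "i < d" "j < d" for i j
  proof -
    have "i * d + j < Suc i * d"
      using that by simp
    also have "\<dots> \<le> d * d"
      using that by (intro mult_le_mono1) simp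
    finally show ?thesis .
  qed
  have g_orth: "cinner (g i j) (g i' j') = (if i = i' then if j = j' then 1 else 0 else 0)"
    if "i < d" "j < d" "i' < d" "j' < d" for i j i' j'
  proof -
    have "i * d + j = i' * d + j' \<longleftrightarrow> i = i' \<and> j = j'"
      using that by (metis add.commute div_mult_self3 mod_mult_self3 div_less mod_less add_0 not_less0)
    then show ?thesis
      using f index that unfolding g_def orthonormal_def by auto
  qed
  have coeff: "cinner (g i j) (tns u v) = cinner (e i) u * cinner (e j) v" if "i < d" "j < d" for i j u v
  proof -
    have "cinner (g i j) (tns u v)
        = (\<Sum>i'<d. \<Sum>j'<d. if i = i' then if j = j' then cinner (e i') u * cinner (e j') v else 0 else 0)"
      unfolding tns_def cinner_sum_right cinner_scaleC_right
      by (intro sum.cong) (use that g_orth in auto)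
    also have "\<dots> = (\<Sum>i'<d. if i = i' then \<Sum>j'<d. if j = j' then cinner (e i') u * cinner (e j') v else 0 else 0)"
      by (intro sum.cong) auto
    finally show ?thesis
      using that by simp
  qed
  have inner: "cinner (tns u v) (tns u' v') = cinner u u' * cinner v v'" if "u' \<in> ?H" "v' \<in> ?H" for u v u' v'
  proof -
    have "cinner (tns u v) (tns u' v')
        = (\<Sum>i<d. \<Sum>j<d. (cinner u (e i) * cinner (e i) u') * (cinner v (e j) * cinner (e j) v'))"
      unfolding tns_def[of u v] cinner_sum_left cinner_scaleC_left
    proof (intro sum.cong refl)
      fix i j assume "i \<in> {..<d}" "j \<in> {..<d}"
      then show "cnj (cinner (e i) u * cinner (e j) v) * cinner (g i j) (tns u' v')
          = (cinner u (e i) * cinner (e i) u') * (cinner v (e j) * cinner (e j) v')"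
        by (simp add: coeff cinner_commute[of u "e i"] cinner_commute[of v "e j"])
    qed
    also have "\<dots> = cinner u u' * cinner v v'"
      by (simp add: orthonormal_Parseval[OF e that(1), of u] orthonormal_Parseval[OF e that(2), of v]
          sum_product)
    finally show ?thesis .
  qed
  have eH: "e i \<in> ?H" if "i < d" for i
    using that by (intro complex_vector.span_base) auto
  have tns_e: "tns (e i) (e j) = g i j" if "i < d" "j < d" for i j
  proof -
    have "tns (e i) (e j) = (\<Sum>i'<d. \<Sum>j'<d. if i' = i then if j' = j then g i' j' else 0 else 0)"
      unfolding tns_def
      by (intro sum.cong) (use e that in \<open>auto simp: orthonormal_def scaleC_one\<close>)
    also have "\<dots> = (\<Sum>i'<d. if i' = i then \<Sum>j'<d. if j' = j then g i' j' else 0 else 0)"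
      by (intro sum.cong) auto
    finally show ?thesis
      using that by simp
  qed
  have span: "cspan {tns u v | u v. u \<in> ?H \<and> v \<in> ?H} = cspan (f ` {..<d * d})" (is "cspan ?S = ?T")
  proof (rule antisym; rule complex_vector.span_minimal)
    have "tns u v \<in> ?T" for u v
      unfolding tns_def g_def
      by (intro complex_vector.span_sum complex_vector.span_scale complex_vector.span_base)
        (use index in auto)
    then show "?S \<subseteq> ?T"
      by blast
    have "f k \<in> ?S" if "k < d * d" for k
    proof -
      have "d > 0"
        using that by (cases d) auto
      then have "k div d < d" "k mod d < d"
        using that by (simp_all add: less_mult_imp_div_less)
      then have "f k = tns (e (k div d)) (e (k mod d))"
        by (simp add: tns_e g_def)
      then show ?thesis
        using eH \<open>k div d < d\<close> \<open>k mod d < d\<close> by blast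
    qed
    then show "f ` {..<d * d} \<subseteq> cspan ?S"
      by (auto intro: complex_vector.span_base)
  qed simp_all
  have "tensor_product ?H ?H ?T tns"
    unfolding tensor_product_def
  proof (intro conjI ballI allI)
    show "hilbert_subspace ?T"
      by (simp add: hilbert_subspace_def orthonormal_closed_span[OF f])
    show "closure (cspan ?S) = ?T"
      unfolding span by (rule closure_closed[OF orthonormal_closed_span[OF f]])
  qed (simp_all add: inner, simp_all add: tns_def cinner_add_right cinner_scaleC_right
      distrib_left distrib_right scaleC_add_left sum.distrib scaleC_scaleC mult.assoc mult.left_commute
      complex_vector.scale_sum_right)
  then show ?thesis
    by blast
qed

text \<open>On the finitely many tensors of basis vectors the operator is prescribed; a linear map of finite
  rank given by inner products is bounded.\<close>

lemma tensor_operator_exists: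
  assumes tp: "tensor_product H H T tns" and e: "orthonormal d e" "cspan (e ` {..<d}) = H"
    and F: "bounded_operator_on H F" and G: "bounded_operator_on H G"
  shows "\<exists>R. tensor_operator H H T tns F G R"
proof -
  have H: "csubspace H"
    using e(2) by auto
  have eH: "e i \<in> H" if "i < d" for i
    using that e(2) by (auto intro: complex_vector.span_base)
  have T: "csubspace T"
    using tensor_hilbert[OF tp] by (rule hilbert_subspace_csubspace)
  define R where "R t = (\<Sum>i<d. \<Sum>j<d. cinner (tns (e i) (e j)) t *\<^sub>C tns (F (e i)) (G (e j)))" for t
  have "R (tns u v) = tns (F u) (G v)" if u: "u \<in> H" and v: "v \<in> H" for u v
  proof -
    have ex: "w = (\<Sum>i<d. cinner (e i) w *\<^sub>C e i)" if "w \<in> H" for w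
      using orthonormal_expansion[OF e(1)] e(2) that by blast
    have img: "A w = (\<Sum>i<d. cinner (e i) w *\<^sub>C A (e i))" if A: "bounded_operator_on H A" and w: "w \<in> H" for A w
    proof -
      have "A w = A (\<Sum>i<d. cinner (e i) w *\<^sub>C e i)"
        using ex[OF w] by simp
      also have "\<dots> = (\<Sum>i<d. A (cinner (e i) w *\<^sub>C e i))"
        by (rule bounded_operator_sum[OF A H]) (simp add: csubspace_scale[OF H] eH)
      also have "\<dots> = (\<Sum>i<d. cinner (e i) w *\<^sub>C A (e i))"
        by (rule sum.cong) (simp_all add: bounded_operator_scale[OF A] eH)
      finally show ?thesis .
    qed
    have "tns (F u) (G v) = (\<Sum>i<d. cinner (e i) u *\<^sub>C tns (F (e i)) (G v))"
      by (subst img[OF F u], rule tensor_sum_left[OF tp H])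
        (simp_all add: bounded_operator_in[OF F] bounded_operator_in[OF G] v eH)
    also have "\<dots> = (\<Sum>i<d. cinner (e i) u *\<^sub>C (\<Sum>j<d. cinner (e j) v *\<^sub>C tns (F (e i)) (G (e j))))"
    proof (intro sum.cong refl)
      fix i assume "i \<in> {..<d}"
      then have "tns (F (e i)) (G v) = (\<Sum>j<d. cinner (e j) v *\<^sub>C tns (F (e i)) (G (e j)))"
        by (subst img[OF G v], intro tensor_sum_right[OF tp H])
          (simp_all add: bounded_operator_in[OF F] bounded_operator_in[OF G] eH)
      then show "cinner (e i) u *\<^sub>C tns (F (e i)) (G v)
          = cinner (e i) u *\<^sub>C (\<Sum>j<d. cinner (e j) v *\<^sub>C tns (F (e i)) (G (e j)))"
        by simp
    qed
    also have "\<dots> = R (tns u v)"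
      unfolding R_def complex_vector.scale_sum_right scaleC_scaleC
      by (intro sum.cong) (simp_all add: tensor_cinner[OF tp] u v eH)
    finally show ?thesis
      by simp
  qed
  moreover have "bounded_operator_on T R"
    unfolding bounded_operator_on_def
  proof (intro conjI ballI allI exI)
    fix t assume "t \<in> T"
    show "R t \<in> T"
      unfolding R_def
      by (intro csubspace_sum[OF T] csubspace_scale[OF T] tensor_in[OF tp] bounded_operator_in[OF F]
          bounded_operator_in[OF G] eH) auto
    have "norm (R t) \<le> (\<Sum>i<d. \<Sum>j<d. (norm (tns (e i) (e j)) * norm t) * norm (tns (F (e i)) (G (e j))))"
      unfolding R_def
      by (intro sum_norm_le) (simp add: mult_right_mono cinner_Cauchy_Schwarz)
    also have "\<dots> = (\<Sum>i<d. \<Sum>j<d. norm (tns (e i) (e j)) * norm (tns (F (e i)) (G (e j)))) * norm t"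
      by (simp add: sum_distrib_right mult.assoc mult.commute[of "norm t"])
    finally show "norm (R t)
        \<le> (\<Sum>i<d. \<Sum>j<d. norm (tns (e i) (e j)) * norm (tns (F (e i)) (G (e j)))) * norm t" .
  qed (simp_all add: R_def cinner_add_right cinner_scaleC_right scaleC_add_left sum.distrib scaleC_scaleC
      complex_vector.scale_sum_right)
  ultimately show ?thesis
    unfolding tensor_operator_def by blast
qed

text \<open>Complex conjugation of coordinates in an orthonormal basis. For a self-adjoint \<open>Q\<close> the operator
  \<open>J Q J\<close> has the conjugate matrix, that is, the transposed one (\<open>conjugate_entry\<close>); in this form it
  is clear that transposition maps projection-valued measures to such measures.\<close>

locale conjugation =
  fixes d :: nat and e :: "nat \<Rightarrow> 'h::complex_hilbert_space" and H :: "'h set"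
  assumes onb: "orthonormal d e" and H: "H = cspan (e ` {..<d})"
begin

definition J :: "'h \<Rightarrow> 'h" where
  "J v = (\<Sum>i<d. cinner v (e i) *\<^sub>C e i)"

lemma sub: "csubspace H"
  by (simp add: H)

lemma e_in: "i < d \<Longrightarrow> e i \<in> H"
  by (auto simp: H intro: complex_vector.span_base)

lemma J_in: "J v \<in> H"
  unfolding J_def by (intro csubspace_sum[OF sub] csubspace_scale[OF sub] e_in) simp

lemma J_add: "J (u + v) = J u + J v"
  by (simp add: J_def cinner_add_left scaleC_add_left sum.distrib)

lemma J_scale: "J (c *\<^sub>C u) = cnj c *\<^sub>C J u"
  by (simp add: J_def cinner_scaleC_left complex_vector.scale_sum_right scaleC_scaleC)

lemma cinner_e_J: "i < d \<Longrightarrow> cinner (e i) (J v) = cinner v (e i)"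
  unfolding J_def by (rule orthonormal_cinner_sum[OF onb])

lemma cinner_J_J: "u \<in> H \<Longrightarrow> v \<in> H \<Longrightarrow> cinner (J u) (J v) = cinner v u"
proof -
  assume "u \<in> H" "v \<in> H"
  have "cinner (J u) (J v) = (\<Sum>i<d. cinner (J u) (e i) * cinner (e i) (J v))"
    using orthonormal_Parseval[OF onb] J_in H by blast
  also have "\<dots> = (\<Sum>i<d. cinner v (e i) * cinner (e i) u)"
    by (intro sum.cong refl)
      (metis cinner_e_J cinner_commute lessThan_iff mult.commute)
  also have "\<dots> = cinner v u"
    using orthonormal_Parseval[OF onb] \<open>u \<in> H\<close> H by metis
  finally show ?thesis .
qed

lemma J_J: "u \<in> H \<Longrightarrow> J (J u) = u"
proof -
  assume u: "u \<in> H"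
  have "J (J u) = (\<Sum>i<d. cinner (e i) u *\<^sub>C e i)"
    unfolding J_def[of "J u"]
    by (intro sum.cong refl) (metis cinner_e_J cinner_commute lessThan_iff)
  then show ?thesis
    using orthonormal_expansion[OF onb] u H by metis
qed

lemma J_e: "i < d \<Longrightarrow> J (e i) = e i"
proof -
  assume i: "i < d"
  have "J (e i) = (\<Sum>j<d. if i = j then e j else 0)"
    unfolding J_def by (rule sum.cong) (use onb i in \<open>auto simp: orthonormal_def scaleC_one\<close>)
  then show ?thesis
    using i by simp
qed

lemma cinner_J_left: "u \<in> H \<Longrightarrow> v \<in> H \<Longrightarrow> cinner (J u) v = cinner (J v) u"
  using cinner_J_J[of u "J v"] by (simp add: J_in J_J)

lemma cinner_J_right: "u \<in> H \<Longrightarrow> v \<in> H \<Longrightarrow> cinner u (J v) = cinner v (J u)"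
  using cinner_J_left[of u v] cinner_commute[of u "J v"] cinner_commute[of v "J u"] by simp

lemma J_sum: "J (\<Sum>i\<in>I. f i) = (\<Sum>i\<in>I. J (f i))"
proof (induction I rule: infinite_finite_induct)
  case (insert i I)
  then show ?case by (simp add: J_add)
qed (simp_all add: J_def)

lemma conjugate_pvm:
  assumes Q: "pvm_on H Q"
  shows "pvm_on H (\<lambda>b v. J (Q b (J v)))"
  unfolding pvm_on_def
proof (intro conjI allI ballI)
  note proj = pvm_projection[OF Q]
  note bd = projection_bounded[OF proj] and Q_in = projection_in[OF proj]
  fix b
  show "projection_on H (\<lambda>v. J (Q b (J v)))"
  proof (rule projection_onI)
    fix u v assume uv: "u \<in> H" "v \<in> H"
    have "cinner (J (Q b (J u))) v = cinner (J v) (Q b (J u))"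
      by (rule cinner_J_left[OF Q_in[OF J_in] uv(2)])
    also have "\<dots> = cinner (Q b (J v)) (J u)"
      by (rule projection_sym[OF proj J_in J_in, symmetric])
    also have "\<dots> = cinner u (J (Q b (J v)))"
      by (rule cinner_J_right[OF Q_in[OF J_in] uv(1)])
    finally show "cinner (J (Q b (J u))) v = cinner u (J (Q b (J v)))" .
  qed (simp_all add: J_in J_add J_scale J_J Q_in bounded_operator_add[OF bd] bounded_operator_scale[OF bd]
      projection_idem[OF proj])
next
  fix u assume "u \<in> H"
  then show "(\<Sum>b\<in>UNIV. J (Q b (J u))) = u"
    using pvm_sum[OF Q J_in] by (simp add: J_J flip: J_sum)
qed

lemma conjugate_entry:
  assumes Q: "projection_on H Q" and "i < d" "k < d"
  shows "cinner (e i) (J (Q (J (e k)))) = cinner (e k) (Q (e i))"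
proof -
  have "cinner (e i) (J (Q (J (e k)))) = cinner (Q (e k)) (e i)"
    using assms cinner_e_J by (simp add: J_e)
  then show ?thesis
    using projection_sym[OF Q] assms e_in by simp
qed

end

text \<open>The vector \<open>\<xi>\<close> turns the tensor product of \<open>p x a\<close> with the transpose of \<open>q y b\<close> into the
  normalized trace \<open>tr a b x y\<close> of the product \<open>p x a q y b\<close>, which vanishes for losing answers.\<close>

theorem maximally_entangled_strategy_of_model:
  fixes lam :: "('x::finite, 'y::finite, 'a::finite, 'b::finite) game"
  assumes model: "finite_dimensional_model lam (H :: 'h::complex_hilbert_space set) p q"
    and inf: "infinite_dimensional_type TYPE('h)"
  shows "\<exists>r\<in>C_q_max_entangled TYPE('h). perfect_strategy lam r"
proof -
  have fd: "finite_dimensional H" and nz: "H \<noteq> {0}"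
    and p: "\<And>x. pvm_on H (p x)" and q: "\<And>y. pvm_on H (q y)"
    and pq: "\<And>x y a b u. \<not> lam x y a b \<Longrightarrow> u \<in> H \<Longrightarrow> p x a (q y b u) = 0"
    using model by (auto simp: finite_dimensional_model_def)
  obtain d e where e: "orthonormal d e" and He: "cspan (e ` {..<d}) = H"
    using finite_dimensional_orthonormal_basis[OF fd] by blast
  interpret conjugation d e H
    by unfold_locales (use e He in auto)
  have d: "d > 0"
    using nz He by (cases d) auto
  obtain T tns where tp: "tensor_product H H T tns"
    using tensor_square_exists[OF e inf] He by blast
  note T = hilbert_subspace_csubspace[OF tensor_hilbert[OF tp]]
  define Q where "Q y b v = J (q y b (J v))" for y b v
  have Q: "pvm_on H (Q y)" for y
    unfolding Q_def by (rule conjugate_pvm[OF q])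
  note P_in = projection_in[OF pvm_projection[OF p]] and Q_in = projection_in[OF pvm_projection[OF Q]]
  define s where "s = complex_of_real (1 / sqrt (real d))"
  define \<xi> where "\<xi> = s *\<^sub>C (\<Sum>i<d. tns (e i) (e i))"
  have \<xi>T: "\<xi> \<in> T"
    unfolding \<xi>_def by (intro csubspace_scale[OF T] csubspace_sum[OF T] tensor_in[OF tp] e_in) auto
  have ss: "cnj s * s = 1 / of_nat d"
    by (simp add: s_def flip: of_real_mult)
  have cinner_\<xi>: "cinner \<xi> (s *\<^sub>C (\<Sum>k<d. z k))
      = 1 / of_nat d * (\<Sum>k<d. \<Sum>i<d. cinner (tns (e i) (e i)) (z k))" for z
  proof -
    have "cinner \<xi> (s *\<^sub>C (\<Sum>k<d. z k)) = cnj s * s * cinner (\<Sum>i<d. tns (e i) (e i)) (\<Sum>k<d. z k)"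
      unfolding \<xi>_def cinner_scaleC_left cinner_scaleC_right by (simp only: mult.assoc mult.left_commute)
    then show ?thesis
      unfolding cinner_sum_right by (simp only: cinner_sum_left ss)
  qed
  have "cinner \<xi> \<xi> = 1 / of_nat d * (\<Sum>k<d. \<Sum>i<d. cinner (tns (e i) (e i)) (tns (e k) (e k)))"
    using cinner_\<xi>[of "\<lambda>k. tns (e k) (e k)"] by (simp only: \<xi>_def)
  also have "(\<Sum>k<d. \<Sum>i<d. cinner (tns (e i) (e i)) (tns (e k) (e k))) = (\<Sum>k<d. \<Sum>i<d. if i = k then 1 else 0)"
    by (intro sum.cong refl) (use e in \<open>auto simp: tensor_cinner[OF tp] e_in orthonormal_def\<close>)
  finally have "complex_of_real ((norm \<xi>)\<^sup>2) = complex_of_real 1"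
    using d by (simp add: cinner_self)
  then have "(norm \<xi>)\<^sup>2 = 1"
    using of_real_eq_iff by blast
  then have norm_\<xi>: "norm \<xi> = 1"
    using norm_ge_zero[of \<xi>] power2_eq_1_iff[of "norm \<xi>"] by linarith
  define tr where "tr a b x y = 1 / of_nat d * (\<Sum>k<d. \<Sum>i<d. cinner (e i) (p x a (e k)) * cinner (e k) (q y b (e i)))"
    for a b x y
  have expect: "cinner \<xi> (R \<xi>) = tr a b x y" if R: "tensor_operator H H T tns (p x a) (Q y b) R" for a b x y R
  proof -
    have Rb: "bounded_operator_on T R" and Rt: "\<And>u v. u \<in> H \<Longrightarrow> v \<in> H \<Longrightarrow> R (tns u v) = tns (p x a u) (Q y b v)"
      using R by (auto simp: tensor_operator_def)
    have "R \<xi> = s *\<^sub>C R (\<Sum>k<d. tns (e k) (e k))"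
      unfolding \<xi>_def by (intro bounded_operator_scale[OF Rb] csubspace_sum[OF T] tensor_in[OF tp] e_in) auto
    also have "R (\<Sum>k<d. tns (e k) (e k)) = (\<Sum>k<d. R (tns (e k) (e k)))"
      by (intro bounded_operator_sum[OF Rb T] tensor_in[OF tp] e_in) auto
    also have "\<dots> = (\<Sum>k<d. tns (p x a (e k)) (Q y b (e k)))"
      by (intro sum.cong refl) (simp add: Rt e_in)
    finally have "cinner \<xi> (R \<xi>) = 1 / of_nat d
        * (\<Sum>k<d. \<Sum>i<d. cinner (tns (e i) (e i)) (tns (p x a (e k)) (Q y b (e k))))"
      by (simp only: cinner_\<xi>)
    also have "(\<Sum>k<d. \<Sum>i<d. cinner (tns (e i) (e i)) (tns (p x a (e k)) (Q y b (e k))))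
        = (\<Sum>k<d. \<Sum>i<d. cinner (e i) (p x a (e k)) * cinner (e k) (q y b (e i)))"
    proof (intro sum.cong refl)
      fix k i assume "k \<in> {..<d}" "i \<in> {..<d}"
      then show "cinner (tns (e i) (e i)) (tns (p x a (e k)) (Q y b (e k)))
          = cinner (e i) (p x a (e k)) * cinner (e k) (q y b (e i))"
        using conjugate_entry[OF pvm_projection[OF q], of i k y b]
        by (simp add: tensor_cinner[OF tp] e_in P_in Q_in Q_def[symmetric])
    qed
    finally show ?thesis
      by (simp add: tr_def)
  qed
  have tr_real: "cnj (tr a b x y) = tr a b x y" for a b x y
  proof -
    have "cnj (tr a b x y) = 1 / of_nat d * (\<Sum>k<d. \<Sum>i<d. cinner (e k) (p x a (e i)) * cinner (e i) (q y b (e k)))"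
      unfolding tr_def complex_cnj_mult cnj_sum
    proof (intro arg_cong2[where f = "(*)"] sum.cong refl)
      fix k i assume "k \<in> {..<d}" "i \<in> {..<d}"
      then have "e k \<in> H" "e i \<in> H"
        by (simp_all add: e_in)
      then show "cnj (cinner (e i) (p x a (e k))) = cinner (e k) (p x a (e i))"
        "cnj (cinner (e k) (q y b (e i))) = cinner (e i) (q y b (e k))"
        using projection_sym[OF pvm_projection[OF p]] projection_sym[OF pvm_projection[OF q]]
          cinner_commute by metis+
    qed simp
    also have "\<dots> = tr a b x y"
      unfolding tr_def by (subst sum.swap) simp
    finally show ?thesis .
  qed
  have tr_zero: "tr a b x y = 0" if "\<not> lam x y a b" for a b x y
  proof -
    have "(\<Sum>k<d. cinner (e i) (p x a (e k)) * cinner (e k) (q y b (e i))) = 0" if i: "i < d" for i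
    proof -
      have qe: "q y b (e i) \<in> H"
        using projection_in[OF pvm_projection[OF q] e_in[OF i]] .
      have "(\<Sum>k<d. cinner (e i) (p x a (e k)) * cinner (e k) (q y b (e i)))
          = (\<Sum>k<d. cinner (p x a (e i)) (e k) * cinner (e k) (q y b (e i)))"
        by (intro sum.cong refl) (simp add: projection_sym[OF pvm_projection[OF p]] e_in i)
      also have "\<dots> = cinner (p x a (e i)) (q y b (e i))"
        using orthonormal_Parseval[OF e] qe He by metis
      also have "\<dots> = cinner (e i) (p x a (q y b (e i)))"
        by (rule projection_sym[OF pvm_projection[OF p] e_in[OF i] qe])
      also have "\<dots> = 0"
        using pq[OF \<open>\<not> lam x y a b\<close> e_in[OF i]] by simp
      finally show ?thesis .
    qed
    then have "(\<Sum>i<d. \<Sum>k<d. cinner (e i) (p x a (e k)) * cinner (e k) (q y b (e i))) = 0"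
      by simp
    then show ?thesis
      unfolding tr_def by (subst sum.swap) simp
  qed
  define r where "r a b x y = Re (tr a b x y)" for a b x y
  have "complex_of_real (r a b x y) = tr a b x y" for a b x y
    unfolding r_def using tr_real[of a b x y] by (simp add: complex_eq_iff)
  then have "\<exists>R. tensor_operator H H T tns (p x a) (Q y b) R \<and> complex_of_real (r a b x y) = cinner \<xi> (R \<xi>)"
    for a b x y
    using tensor_operator_exists[OF tp e He projection_bounded[OF pvm_projection[OF p]]
        projection_bounded[OF pvm_projection[OF Q]]] expect by metis
  then have "realizes H T tns \<xi> p Q r"
    unfolding realizes_def
    using finite_dimensional_hilbert_subspace[OF fd] tp \<xi>T norm_\<xi> p Q by blast
  then have "r \<in> C_q_max_entangled TYPE('h)"
    unfolding C_q_max_entangled_def \<xi>_def s_def orthonormal_basis_of_def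
    using e He unfolding orthonormal_def by blast
  moreover have "perfect_strategy lam r"
    by (simp add: perfect_strategy_def r_def tr_zero)
  ultimately show ?thesis
    by blast
qed

lemma C_q_max_entangled_subset_C_q: "C_q_max_entangled TYPE('h::complex_hilbert_space) \<subseteq> C_q TYPE('h)"
proof
  fix p :: "('x::finite, 'y::finite, 'a::finite, 'b::finite) correlation"
  assume "p \<in> C_q_max_entangled TYPE('h)"
  then obtain H :: "'h set" and T tns d e P Q where basis: "orthonormal_basis_of H d e"
    and real: "realizes H T tns (complex_of_real (1 / sqrt (real d)) *\<^sub>C (\<Sum>i<d. tns (e i) (e i))) P Q p"
    unfolding C_q_max_entangled_def by blast
  have "finite_dimensional H"
    using basis unfolding orthonormal_basis_of_def finite_dimensional_def by blast
  then show "p \<in> C_q TYPE('h)"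
    using real unfolding C_q_def by blast
qed

lemma C_q_subset_C_qs: "C_q TYPE('h::complex_hilbert_space) \<subseteq> C_qs TYPE('h)"
  unfolding C_q_def C_qs_def by blast

theorem corollary5p4:
  fixes lam :: "('x::finite, 'y::finite, 'a::finite, 'b::finite) game"
  assumes "imitation_game lam"
    and "infinite_dimensional_type TYPE('h::complex_hilbert_space)"
  shows "((\<exists>p\<in>C_qs TYPE('h). perfect_strategy lam p) \<longleftrightarrow>
            (\<exists>p\<in>C_q TYPE('h). perfect_strategy lam p)) \<and>
         ((\<exists>p\<in>C_q TYPE('h). perfect_strategy lam p) \<longleftrightarrow>
            (\<exists>p\<in>C_q_max_entangled TYPE('h). perfect_strategy lam p)) \<and>
         ((\<exists>p\<in>C_q_max_entangled TYPE('h). perfect_strategy lam p) \<longleftrightarrow>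
            (carrier (game_algebra lam) \<noteq> {\<zero>\<^bsub>game_algebra lam\<^esub>} \<and>
             has_nondegenerate_fd_representation TYPE('h) (game_algebra lam)))"
proof -
  have qs: "\<exists>(H :: 'h set) p q. finite_dimensional_model lam H p q"
    if "\<exists>p\<in>C_qs TYPE('h). perfect_strategy lam p"
    using that model_of_spatial_strategy[OF assms(1)] by blast
  have max: "\<exists>p\<in>C_q_max_entangled TYPE('h). perfect_strategy lam p"
    if "\<exists>(H :: 'h set) p q. finite_dimensional_model lam H p q"
    using that maximally_entangled_strategy_of_model[OF _ assms(2)] by blast
  have rep: "(\<exists>(H :: 'h set) p q. finite_dimensional_model lam H p q) \<longleftrightarrow>
      carrier (game_algebra lam) \<noteq> {\<zero>\<^bsub>game_algebra lam\<^esub>} \<and>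
      has_nondegenerate_fd_representation TYPE('h) (game_algebra lam)"
    (is "?model \<longleftrightarrow> ?rep")
  proof
    assume ?model
    then obtain H :: "'h set" and p q where "finite_dimensional_model lam H p q"
      by blast
    then show ?rep
      using representation_of_model by (intro conjI)
  next
    assume ?rep
    then show ?model
      using model_of_representation by blast
  qed
  have "\<exists>p\<in>C_q TYPE('h). perfect_strategy lam p"
    if "\<exists>p\<in>C_q_max_entangled TYPE('h). perfect_strategy lam p"
    using that C_q_max_entangled_subset_C_q by blast
  moreover have "\<exists>p\<in>C_qs TYPE('h). perfect_strategy lam p"
    if "\<exists>p\<in>C_q TYPE('h). perfect_strategy lam p"
    using that C_q_subset_C_qs by blast
  ultimately show ?thesis
    using qs max rep by argo
qed

end
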